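(* Let $d\ge 2$ and let $(w_e)$ be i.i.d. positive random conductances on the nearest-neighbour edges of $\mathbb{Z}^d$, with law $\mathbb{P}$ and distribution function $F(u)=\mathbb{P}[w\le u]$. Assume that $F$ is continuous and varies regularly at zero with index $\gamma\in(0,1/4)$, and that there exists $a^\ast>0$ such that $F(ab)\ge bF(a)$ for all $a\le a^\ast$ and all $0\le b\le 1$. Let $L^\ast$ be the function, slowly varying at infinity, such that $h(|B_n|)=n^{\frac{1}{2\gamma}}L^\ast(n)$, where $h$ is defined in the context. Let $k\in\mathbb{N}$ and let $\lambda_k^{(n)}$ be the $k$th Dirichlet eigenvalue of $-\mathcal{L}^w$ in $B_n$ with zero Dirichlet conditions outside $B_n$. Then, as $n\to\infty$, $L^\ast(n)\,n^{\frac{1}{2\gamma}}\lambda_k^{(n)}$ converges in distribution to a non-degenerate random variable. More precisely, $$\lim_{n\to\infty}\mathbb{P}\left[L^\ast(n)\,n^{\frac{1}{2\gamma}}\lambda_k^{(n)}>\zeta\right]=\exp\left(-\zeta^{2d\gamma}\right)\sum_{j=0}^{k-1}\frac{\zeta^{2d\gamma j}}{j!}\qquad\text{for all }\zeta\in[0,\infty).$$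
   Context: Write $x\sim y$ if $x,y\in\mathbb{Z}^d$ and $|x-y|_1=1$. Edges are undirected, so $w_{xy}=w_{yx}$. The random conductance Laplacian is $(\mathcal{L}^w f)(x)=\sum_{y\sim x}w_{xy}(f(y)-f(x))$. The box is $B_n=[-n,n]^d\cap\mathbb{Z}^d$. The Dirichlet eigenvalues $\lambda_1^{(n)}\le\lambda_2^{(n)}\le\dots\le\lambda^{(n)}_{|B_n|}$ (with multiplicity) are those of the problem $-\mathcal{L}^w\psi=\lambda\psi$ on $B_n$, $\psi=0$ on $\mathbb{Z}^d\setminus B_n$. $F$ varies regularly at zero with index $\gamma$ if $\lim_{t\downarrow 0}F(ts)/F(t)=s^\gamma$ for all $s>0$. Let $\pi_z=\sum_{x\sim z}w_{xz}$ and let $F_\pi$ be the distribution function of $\pi_0$, i.e. of the sum of $2d$ independent copies of $w$. Define $h(u)=\inf\{s: 1/F_\pi(1/s)=u\}$ (only large $u$ matter). When $F$ varies regularly at zero with index $\gamma>0$, $F_\pi$ varies regularly at zero with index $2d\gamma$ and $h$ varies regularly at infinity with index $1/(2d\gamma)$, so that a slowly varying $L^\ast$ with $h(|B_n|)=n^{\frac{1}{2\gamma}}L^\ast(n)$ exists. *)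

theory Defs
  imports "HOL-Probability.Probability" "HOL-Library.Function_Algebras"
begin

definition adjacent :: "int ^ 'd \<Rightarrow> int ^ 'd::finite \<Rightarrow> bool" where
  "adjacent x y \<longleftrightarrow> (\<Sum>i\<in>UNIV. \<bar>x $ i - y $ i\<bar>) = 1"

text \<open>Edges are undirected: the conductance of the edge between \<open>x\<close> and \<open>y\<close> is \<open>c {x, y}\<close>, where
  \<open>c\<close> is a function on vertex sets of which only the values on \<open>edges\<close> matter.\<close>

definition edges :: "(int ^ 'd::finite) set set" where
  "edges = {{x, y} | x y. adjacent x y}"

definition lattice_box :: "nat \<Rightarrow> (int ^ 'd::finite) set" where
  "lattice_box n = {x. \<forall>i. x $ i \<in> {- int n..int n}}"

definition laplacian ::
  "((int ^ 'd) set \<Rightarrow> real) \<Rightarrow> (int ^ 'd \<Rightarrow> real) \<Rightarrow> int ^ 'd::finite \<Rightarrow> real" where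
  "laplacian c f x = (\<Sum>y | adjacent y x. c {x, y} * (f y - f x))"

definition vertex_conductance :: "((int ^ 'd) set \<Rightarrow> real) \<Rightarrow> int ^ 'd::finite \<Rightarrow> real" where
  "vertex_conductance c z = (\<Sum>x | adjacent x z. c {x, z})"

definition dirichlet_eigenspace ::
  "((int ^ 'd) set \<Rightarrow> real) \<Rightarrow> nat \<Rightarrow> real \<Rightarrow> (int ^ 'd::finite \<Rightarrow> real) set" where
  "dirichlet_eigenspace c n l =
     {\<psi>. (\<forall>x. x \<notin> lattice_box n \<longrightarrow> \<psi> x = 0) \<and>
          (\<forall>x\<in>lattice_box n. - laplacian c \<psi> x = l * \<psi> x)}"

text \<open>Function spaces are not an instance of \<open>real_vector\<close>, so the dimension of an eigenspace is
  taken with respect to an explicit pointwise scalar multiplication.\<close>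

definition fun_scale :: "real \<Rightarrow> ('b \<Rightarrow> real) \<Rightarrow> 'b \<Rightarrow> real" where
  "fun_scale a f = (\<lambda>x. a * f x)"

lemma vector_space_fun_scale: "vector_space fun_scale"
  by unfold_locales (auto simp: fun_scale_def fun_eq_iff algebra_simps)

definition eigenvalue_multiplicity ::
  "((int ^ 'd::finite) set \<Rightarrow> real) \<Rightarrow> nat \<Rightarrow> real \<Rightarrow> nat" where
  "eigenvalue_multiplicity c n l = vector_space.dim fun_scale (dirichlet_eigenspace c n l)"

text \<open>All Dirichlet eigenvalues in increasing order, each repeated according to its multiplicity.
  There are only finitely many of them, as required by \<^const>\<open>sorted_list_of_set\<close>, because the box
  is finite.\<close>

definition dirichlet_eigenvalues :: "((int ^ 'd::finite) set \<Rightarrow> real) \<Rightarrow> nat \<Rightarrow> real list" where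
  "dirichlet_eigenvalues c n =
     concat (map (\<lambda>l. replicate (eigenvalue_multiplicity c n l) l)
       (sorted_list_of_set {l. \<exists>\<psi>\<in>dirichlet_eigenspace c n l. \<psi> \<noteq> (\<lambda>x. 0)}))"

text \<open>The index \<open>k\<close> is one-based; the value is meaningful for \<open>1 \<le> k \<le> card (lattice_box n)\<close>.\<close>

definition dirichlet_eigenvalue :: "((int ^ 'd::finite) set \<Rightarrow> real) \<Rightarrow> nat \<Rightarrow> nat \<Rightarrow> real" where
  "dirichlet_eigenvalue c n k = dirichlet_eigenvalues c n ! (k - 1)"

definition regularly_varying :: "real filter \<Rightarrow> (real \<Rightarrow> real) \<Rightarrow> real \<Rightarrow> bool" where
  "regularly_varying A f \<rho> \<longleftrightarrow> (\<forall>s>0. ((\<lambda>t. f (t * s) / f t) \<longlongrightarrow> s powr \<rho>) A)"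

abbreviation regularly_varying_at_zero :: "(real \<Rightarrow> real) \<Rightarrow> real \<Rightarrow> bool" where
  "regularly_varying_at_zero \<equiv> regularly_varying (at_right 0)"

abbreviation slowly_varying_at_infinity :: "(real \<Rightarrow> real) \<Rightarrow> bool" where
  "slowly_varying_at_infinity f \<equiv> regularly_varying at_top f 0"

text \<open>The function \<open>h\<close> for a distribution function \<open>G\<close>, namely that of \<open>vertex_conductance\<close> at the
  origin. Only its values at large arguments are used.\<close>

definition inverse_scale :: "(real \<Rightarrow> real) \<Rightarrow> real \<Rightarrow> real" where
  "inverse_scale G u = Inf {s. s > 0 \<and> 1 / G (1 / s) = u}"

end

theory Submission
  imports Defs
begin

text \<open>
  An isolated site with small total conductance is a trap, and the \<open>k\<close>-th eigenvalue is asymptotically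
  the \<open>k\<close>-th smallest total conductance in the box. The number of sites with total conductance at most
  \<open>\<zeta> / h n\<close> is asymptotically Poisson with mean \<open>\<zeta> powr (2 * CARD('d) * \<gamma>)\<close>, because adjacent
  sites are jointly that bad with probability at most \<open>F (\<zeta> / h n) ^ (4 * CARD('d) - 1)\<close>, which is
  \<open>o (1 / card (lattice_box n))\<close>.

  The indicator functions of \<open>k\<close> non-adjacent traps are orthogonal for the energy form, so the
  minimax principle bounds the eigenvalue from above. For the lower bound the minimax principle
  leaves functions that vanish at the fewer than \<open>k\<close> traps. Since \<open>\<gamma> < 1 / 4\<close>, edges of conductance
  at most \<open>A * n\<^sup>2 / h n\<close> have polynomially small density, so every block of bounded size contains
  boundedly many of them, and the Poincare inequality can be transported along an open network of
  lattice lines at the cost of the factor \<open>n\<^sup>2\<close>. No block contains \<open>4 * CARD('d) - 2\<close> edges of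
  conductance at most \<open>A / h n\<close>, so every site with a better incident edge reaches this network by a
  straight ray. Only the sites all of whose edges are bad remain; they are pairwise non-adjacent and
  contribute their total conductance to the energy up to a factor close to one.
\<close>

section \<open>Minimax principle for symmetric matrices\<close>

text \<open>All exponents come from one relation:
  \<open>vol n * F (1 / h n) ^ (2 * CARD('d))\<close> stays bounded, so \<open>F (1 / h n)\<close>
  is at most of order \<open>n powr (- 1 / 2)\<close>. Enlarging the argument by the factor
  \<open>n\<^sup>2\<close> costs at most \<open>n powr (2 * \<rho>)\<close> for any \<rho> above
  \<gamma>, and the total exponent can be made negative because \<gamma> < 1/4. Two thresholds are
  needed. Paths of length of order \<open>n\<close> must use edges above
  \<open>A * n\<^sup>2 / h n\<close> to absorb the Poincare factor, but a site may well have no such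
  edge; edges above \<open>A / h n\<close> are good enough for paths of bounded length. Both kinds
  of path cost an error of order \<open>h n / A\<close>, which a large constant \<open>A\<close>
  makes small against the main term of order \<open>h n\<close>. The number
  \<open>4 * CARD('d) - 2\<close> meets two demands: it counts the rays available to a pair of
  neighbours, and it exceeds \<open>2 * CARD('d)\<close> in dimension at least two, so that crowded
  blocks are unlikely. The main term must carry the sharp constant, so every edge at an isolated
  site may be counted only once and the error of replacing a neighbour's value by zero must have an
  arbitrarily small weight.\<close>

interpretation fs: vector_space fun_scale
  by (rule vector_space_fun_scale)

section \<open>Finite-dimensional linear algebra in the function space\<close>

lemma sum_fun_apply: "(\<Sum>i\<in>I. f i :: 'b \<Rightarrow> real) x = (\<Sum>i\<in>I. f i x)"
  by (induction I rule: infinite_finite_induct) auto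

definition delta :: "'b \<Rightarrow> 'b \<Rightarrow> real" where
  "delta x = (\<lambda>y. if y = x then 1 else 0)"

lemma inj_delta: "inj delta"
  by (rule injI) (metis delta_def zero_neq_one)

lemma sum_scale_delta:
  assumes "finite B"
  shows "(\<Sum>x\<in>B. fun_scale (g x) (delta x)) = (\<lambda>y. if y \<in> B then g y else 0)"
  using assms by (auto simp: fun_eq_iff sum_fun_apply fun_scale_def delta_def if_distrib cong: if_cong)

lemma span_delta:
  assumes "finite B"
  shows "fs.span (delta ` B) = {f. \<forall>x. x \<notin> B \<longrightarrow> f x = 0}"
proof
  have "fs.subspace {f. \<forall>x. x \<notin> B \<longrightarrow> f x = 0}"
    by (auto simp: fs.subspace_def fun_scale_def)
  then show "fs.span (delta ` B) \<subseteq> {f. \<forall>x. x \<notin> B \<longrightarrow> f x = 0}"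
    by (intro fs.span_minimal) (auto simp: delta_def)
next
  show "{f. \<forall>x. x \<notin> B \<longrightarrow> f x = 0} \<subseteq> fs.span (delta ` B)"
  proof safe
    fix f :: "'a \<Rightarrow> real" assume f: "\<forall>x. x \<notin> B \<longrightarrow> f x = 0"
    have "f = (\<Sum>x\<in>B. fun_scale (f x) (delta x))"
      using f by (simp add: sum_scale_delta[OF assms] fun_eq_iff)
    also have "\<dots> \<in> fs.span (delta ` B)"
      by (intro fs.span_sum fs.span_scale fs.span_base) auto
    finally show "f \<in> fs.span (delta ` B)" .
  qed
qed

lemma independent_delta:
  assumes "finite B"
  shows "fs.independent (delta ` B)"
proof
  assume "fs.dependent (delta ` B)"
  then obtain u v where v: "v \<in> delta ` B" "u v \<noteq> 0" and s: "(\<Sum>v\<in>delta ` B. fun_scale (u v) v) = 0"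
    using fs.dependent_finite[of "delta ` B"] assms by auto
  obtain x where x: "x \<in> B" "v = delta x" using v by auto
  have "(\<Sum>y\<in>B. fun_scale (u (delta y)) (delta y)) = 0"
    using s by (simp add: sum.reindex inj_on_subset[OF inj_delta])
  then have "u (delta x) = 0" using x
    by (simp add: sum_scale_delta[OF assms] fun_eq_iff) metis
  with v x show False by simp
qed

lemma nontrivial_solution:
  fixes b :: "'i \<Rightarrow> 'j \<Rightarrow> real"
  assumes I: "finite I" and J: "finite J" and less: "card J < card I"
  obtains a where "\<exists>i\<in>I. a i \<noteq> 0" "\<And>j. j \<in> J \<Longrightarrow> (\<Sum>i\<in>I. a i * b i j) = 0"
proof -
  define u where "u i = (\<lambda>j. if j \<in> J then b i j else 0)" for i
  show ?thesis
  proof (cases "inj_on u I")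
    case False
    then obtain i i' where i: "i \<in> I" "i' \<in> I" "i \<noteq> i'" "u i = u i'"
      by (auto simp: inj_on_def)
    define a where "a k = (if k = i then 1 else if k = i' then - 1 else 0 :: real)" for k
    show ?thesis
    proof (rule that[of a])
      show "\<exists>k\<in>I. a k \<noteq> 0" using i by (auto simp: a_def)
      fix j assume j: "j \<in> J"
      have "(\<Sum>k\<in>I. a k * b k j) = (\<Sum>k\<in>{i,i'}. a k * b k j)"
        using i I by (intro sum.mono_neutral_right) (auto simp: a_def)
      also have "\<dots> = b i j - b i' j" using i by (simp add: a_def)
      also have "\<dots> = 0" using fun_cong[OF i(4), of j] j by (simp add: u_def)
      finally show "(\<Sum>k\<in>I. a k * b k j) = 0" .
    qed
  next
    case True
    have "fs.dependent (u ` I)"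
    proof (rule ccontr)
      assume "fs.independent (u ` I)"
      moreover have "u ` I \<subseteq> fs.span (delta ` J)"
        by (auto simp: span_delta[OF J] u_def)
      ultimately have "card (u ` I) \<le> card (delta ` J)"
        using fs.independent_span_bound[of "delta ` J" "u ` I"] J by auto
      then show False
        using less by (simp add: card_image True inj_on_subset[OF inj_delta])
    qed
    then obtain c where c: "\<exists>v\<in>u ` I. c v \<noteq> 0" "(\<Sum>v\<in>u ` I. fun_scale (c v) v) = 0"
      using fs.dependent_finite[of "u ` I"] I by auto
    show ?thesis
    proof (rule that[of "\<lambda>i. c (u i)"])
      show "\<exists>i\<in>I. c (u i) \<noteq> 0" using c(1) by auto
      fix j assume j: "j \<in> J"
      have "(\<Sum>i\<in>I. fun_scale (c (u i)) (u i)) = 0"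
        using c(2) by (simp add: sum.reindex[OF True])
      from fun_cong[OF this, of j] show "(\<Sum>i\<in>I. c (u i) * b i j) = 0"
        using j by (simp add: sum_fun_apply fun_scale_def u_def)
    qed
  qed
qed

text \<open>The entries at most \<open>c\<close> form an initial segment of a sorted list. This
  trades a position in the list for a count, which is how eigenvalues are compared below.\<close>

lemma sorted_nth_le_iff:
  fixes c :: "'a :: linorder"
  assumes "sorted xs" "i < length xs"
  shows "xs ! i \<le> c \<longleftrightarrow> i < length (filter (\<lambda>x. x \<le> c) xs)"
  using assms
proof (induction xs arbitrary: i)
  case (Cons x xs)
  have "filter (\<lambda>x. x \<le> c) xs = []" if "\<not> x \<le> c"
    using Cons.prems that by (auto simp: filter_empty_conv)
  moreover have "c < xs ! j" if "\<not> x \<le> c" "j < length xs" for j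
    using Cons.prems that nth_mem[of j xs] by (auto simp: not_le intro: less_le_trans)
  ultimately show ?case using Cons by (cases i) (auto simp: not_le)
qed simp

lemma sorted_concat_replicate:
  "sorted xs \<Longrightarrow> sorted (concat (map (\<lambda>l. replicate (m l) l) xs))"
  by (induction xs) (auto simp: sorted_append)

lemma length_filter_concat_replicate:
  "distinct xs \<Longrightarrow> length (filter P (concat (map (\<lambda>l. replicate (m l) l) xs))) = (\<Sum>l | l \<in> set xs \<and> P l. m l)"
proof (induction xs)
  case (Cons x xs)
  have "{l. l \<in> set (x # xs) \<and> P l} = (if P x then insert x {l. l \<in> set xs \<and> P l} else {l. l \<in> set xs \<and> P l})"
    by auto
  then show ?case using Cons by (auto simp: filter_replicate)
qed simp

section \<open>Spectral theorem for a symmetric matrix on a finite index set\<close>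

locale symmetric_matrix =
  fixes B :: "'b set" and a :: "'b \<Rightarrow> 'b \<Rightarrow> real"
  assumes fin: "finite B"
    and sym: "\<And>x y. x \<in> B \<Longrightarrow> y \<in> B \<Longrightarrow> a x y = a y x"
begin

definition ip :: "('b \<Rightarrow> real) \<Rightarrow> ('b \<Rightarrow> real) \<Rightarrow> real" where
  "ip f g = (\<Sum>x\<in>B. f x * g x)"

definition ap :: "('b \<Rightarrow> real) \<Rightarrow> 'b \<Rightarrow> real" where
  "ap f = (\<lambda>x. if x \<in> B then \<Sum>y\<in>B. a x y * f y else 0)"

text \<open>The space on which the matrix acts. Vectors are functions on the whole index type, so
  that boxes of all sizes live in one function space; \<open>ap\<close> is cut off outside
  \<open>B\<close> in order to stay in it.\<close>

definition supp :: "('b \<Rightarrow> real) set" where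
  "supp = {f. \<forall>x. x \<notin> B \<longrightarrow> f x = 0}"

definition eigspace :: "real \<Rightarrow> ('b \<Rightarrow> real) set" where
  "eigspace l = {f \<in> supp. ap f = fun_scale l f}"

definition orthonormal_eigs :: "('b \<Rightarrow> real) set \<Rightarrow> bool" where
  "orthonormal_eigs S \<longleftrightarrow> (\<forall>v\<in>S. ip v v = 1) \<and> (\<forall>v\<in>S. \<forall>u\<in>S. u \<noteq> v \<longrightarrow> ip u v = 0) \<and>
     (\<forall>v\<in>S. \<exists>l. v \<in> eigspace l)"

lemma ip_commute: "ip f g = ip g f"
  by (simp add: ip_def mult.commute)

lemma ip_simps [simp]:
  "ip (f + g) h = ip f h + ip g h" "ip h (f + g) = ip h f + ip h g"
  "ip (f - g) h = ip f h - ip g h" "ip h (f - g) = ip h f - ip h g"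
  "ip (fun_scale c f) h = c * ip f h" "ip h (fun_scale c f) = c * ip h f"
  "ip 0 h = 0" "ip h 0 = 0"
  by (simp_all add: ip_def fun_scale_def algebra_simps sum.distrib sum_subtractf sum_distrib_left)

lemma ip_sum_left: "ip (\<Sum>i\<in>I. f i) h = (\<Sum>i\<in>I. ip (f i) h)"
  by (induction I rule: infinite_finite_induct) (simp_all only: sum.infinite sum.empty sum.insert ip_simps not_False_eq_True)

lemma ip_sum_right: "ip h (\<Sum>i\<in>I. f i) = (\<Sum>i\<in>I. ip h (f i))"
  by (simp only: ip_commute[of h] ip_sum_left)

lemma ap_simps [simp]:
  "ap (f + g) = ap f + ap g" "ap (f - g) = ap f - ap g" "ap (fun_scale c f) = fun_scale c (ap f)" "ap 0 = 0"
  by (auto simp: ap_def fun_scale_def algebra_simps sum.distrib sum_subtractf sum_distrib_left fun_eq_iff)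

lemma ap_sum: "ap (\<Sum>i\<in>I. f i) = (\<Sum>i\<in>I. ap (f i))"
  by (induction I rule: infinite_finite_induct) (simp_all only: sum.infinite sum.empty sum.insert ap_simps not_False_eq_True)

lemma ap_symmetric: "ip (ap f) g = ip f (ap g)"
proof -
  have "ip (ap f) g = (\<Sum>x\<in>B. \<Sum>y\<in>B. a x y * f y * g x)"
    by (simp add: ip_def ap_def sum_distrib_right)
  also have "\<dots> = (\<Sum>y\<in>B. \<Sum>x\<in>B. a x y * f y * g x)" by (rule sum.swap)
  also have "\<dots> = ip f (ap g)"
    by (auto simp: ip_def ap_def sum_distrib_left sym intro!: sum.cong)
  finally show ?thesis .
qed

lemma ip_nonneg: "0 \<le> ip f f"
  by (simp add: ip_def sum_nonneg)

lemma ip_eq_0: "f \<in> supp \<Longrightarrow> ip f f = 0 \<Longrightarrow> f = 0"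
  using fin by (auto simp: ip_def supp_def sum_nonneg_eq_0_iff fun_eq_iff)

lemma ip_pos: "f \<in> supp \<Longrightarrow> f \<noteq> 0 \<Longrightarrow> 0 < ip f f"
  using ip_nonneg[of f] ip_eq_0[of f] by linarith

lemma supp_simps [simp, intro]:
  "f \<in> supp \<Longrightarrow> g \<in> supp \<Longrightarrow> f + g \<in> supp" "f \<in> supp \<Longrightarrow> g \<in> supp \<Longrightarrow> f - g \<in> supp"
  "f \<in> supp \<Longrightarrow> fun_scale c f \<in> supp" "ap f \<in> supp" "0 \<in> supp"
  by (auto simp: supp_def fun_scale_def ap_def)

lemma supp_sum: "(\<And>i. i \<in> I \<Longrightarrow> f i \<in> supp) \<Longrightarrow> (\<Sum>i\<in>I. f i) \<in> supp"
  by (induction I rule: infinite_finite_induct) auto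

lemma eigspace_orthogonal:
  assumes "u \<in> eigspace l" "v \<in> eigspace m" "l \<noteq> m"
  shows "ip u v = 0"
proof -
  have "l * ip u v = m * ip u v"
    using ap_symmetric[of u v] assms by (simp add: eigspace_def)
  with assms show ?thesis by simp
qed

text \<open>In the product topology of the function type the sphere is a closed subset of a product
  of intervals [-1, 1] over \<open>B\<close> and points 0 elsewhere, which is compact by Tychonoff.
  Orthogonality to \<open>S\<close> adds only closed conditions.\<close>

lemma compact_unit_sphere:
  "compact {f \<in> supp. (\<forall>v\<in>S. ip v f = 0) \<and> ip f f = 1}" (is "compact ?K")
proof -
  define T where "T x = (if x \<in> B then {-1..1} else {0 :: real})" for x
  have coord: "continuous_on UNIV (\<lambda>f :: 'b \<Rightarrow> real. f x)" for x
    by simp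
  have "compactin (product_topology (\<lambda>_. euclidean) UNIV) (PiE UNIV T)"
    by (subst compactin_PiE) (auto simp: T_def)
  then have comp: "compact (PiE UNIV T)"
    by (simp add: euclidean_product_topology)
  have "closed {f. ip v f = 0}" for v
    unfolding ip_def by (intro closed_Collect_eq continuous_intros coord)
  moreover have "closed {f. ip f f = 1}"
    unfolding ip_def by (intro closed_Collect_eq continuous_intros coord)
  moreover have "closed {f :: 'b \<Rightarrow> real. f x = 0}" for x
    by (intro closed_Collect_eq continuous_intros coord)
  moreover have "?K = PiE UNIV T \<inter> ((\<Inter>x\<in>- B. {f. f x = 0}) \<inter> (\<Inter>v\<in>S. {f. ip v f = 0}) \<inter> {f. ip f f = 1})"
  proof -
    have "\<bar>f x\<bar> \<le> 1" if "ip f f = 1" "x \<in> B" for f x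
    proof -
      have "(f x)\<^sup>2 \<le> ip f f"
        unfolding ip_def power2_eq_square using that fin by (intro member_le_sum) auto
      with that show ?thesis by (simp add: abs_square_le_1)
    qed
    then have "f \<in> ?K \<longleftrightarrow> (\<forall>x. f x \<in> T x) \<and> (\<forall>x\<in>- B. f x = 0) \<and> (\<forall>v\<in>S. ip v f = 0) \<and> ip f f = 1" for f
      by (auto simp: supp_def T_def abs_le_iff minus_le_iff)
    then show ?thesis by (auto simp: PiE_def)
  qed
  ultimately show ?thesis
    by (simp only:) (intro compact_Int_closed comp closed_Int closed_INT ballI; assumption)
qed

text \<open>First order condition at a minimum: if \<open>p\<close> were nonzero, the choice
  \<open>e = - p / r\<close> with \<open>r\<close> positive and above \<open>q\<close> would make
  the expression negative.\<close>

lemma quadratic_nonneg_imp_linear_0: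
  fixes p q :: real
  assumes "\<And>e. 0 \<le> 2 * e * p + e\<^sup>2 * q"
  shows "p = 0"
proof (rule ccontr)
  assume p: "p \<noteq> 0"
  define r where "r = \<bar>q\<bar> + 1"
  have r: "r > 0" "q < r" by (auto simp: r_def)
  have "2 * (- p / r) * p + (- p / r)\<^sup>2 * q = (p\<^sup>2 / r) * (q / r - 2)"
    using r by (simp add: field_simps power2_eq_square)
  moreover have "(p\<^sup>2 / r) * (q / r - 2) < 0"
    using r p by (intro mult_pos_neg) (auto simp: field_simps)
  ultimately show False using assms[of "- p / r"] by linarith
qed

text \<open>The minimiser of the quadratic form on the unit sphere of an invariant subspace is an
  eigenvector.\<close>

lemma ex_eigenvector_orthogonal:
  assumes S: "\<And>v. v \<in> S \<Longrightarrow> \<exists>l. v \<in> eigspace l"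
    and g: "g \<in> supp" "g \<noteq> 0" "\<And>v. v \<in> S \<Longrightarrow> ip v g = 0"
  obtains f l where "f \<in> eigspace l" "ip f f = 1" "\<And>v. v \<in> S \<Longrightarrow> ip v f = 0"
proof -
  define W where "W = {f \<in> supp. \<forall>v\<in>S. ip v f = 0}"
  define K where "K = {f \<in> supp. (\<forall>v\<in>S. ip v f = 0) \<and> ip f f = 1}"
  define q where "q f = ip f (ap f)" for f
  have KW: "f \<in> K \<longleftrightarrow> f \<in> W \<and> ip f f = 1" for f
    by (auto simp: K_def W_def)
  have Wadd: "f + h \<in> W" "f - h \<in> W" "fun_scale c f \<in> W" if "f \<in> W" "h \<in> W" for f h c
    using that by (auto simp: W_def)
  \<comment> \<open>Symmetry moves \<open>ap\<close> onto the eigenvector \<open>v\<close>, so the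
    orthogonal complement of \<open>S\<close> is invariant. This keeps the residual \<open>r\<close>
    below inside \<open>W\<close>.\<close>
  have Wap: "ap f \<in> W" if "f \<in> W" for f
  proof -
    have "ip v (ap f) = 0" if v: "v \<in> S" for v
    proof -
      obtain l where "v \<in> eigspace l" using S[OF v] ..
      then have "ip v (ap f) = l * ip v f" by (simp add: ap_symmetric[symmetric] eigspace_def)
      then show ?thesis using \<open>f \<in> W\<close> v by (simp add: W_def)
    qed
    then show ?thesis by (simp add: W_def)
  qed
  have norm_in_K: "fun_scale (1 / sqrt (ip f f)) f \<in> K" if "f \<in> W" "f \<noteq> 0" for f
    using that ip_pos[of f] by (auto simp: KW Wadd W_def)
  have gW: "g \<in> W" using g by (auto simp: W_def)
  then have "K \<noteq> {}" using norm_in_K[of g] g by auto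
  moreover have "compact K" unfolding K_def by (rule compact_unit_sphere)
  moreover have "continuous_on K q"
  proof -
    have "continuous_on UNIV (\<lambda>f. \<Sum>x\<in>B. f x * (\<Sum>y\<in>B. a x y * f y))"
      by (intro continuous_intros) simp_all
    moreover have "q = (\<lambda>f. \<Sum>x\<in>B. f x * (\<Sum>y\<in>B. a x y * f y))"
      by (auto simp: q_def ip_def ap_def)
    ultimately show ?thesis using continuous_on_subset by auto
  qed
  ultimately obtain f where f: "f \<in> K" "\<And>h. h \<in> K \<Longrightarrow> q f \<le> q h"
    using continuous_attains_inf[of K q] by auto
  define l where "l = q f"
  have fW: "f \<in> W" "ip f f = 1" using f by (auto simp: KW)
  have lower: "l * ip h h \<le> q h" if "h \<in> W" for h
  proof (cases "h = 0")
    case False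
    have pos: "ip h h > 0" using ip_pos that False by (auto simp: W_def)
    have "l \<le> q (fun_scale (1 / sqrt (ip h h)) h)"
      using f(2) norm_in_K that False by (simp add: l_def)
    also have "\<dots> = q h / ip h h" using pos by (simp add: q_def)
    finally show ?thesis using pos by (simp add: field_simps)
  qed (simp add: q_def)
  \<comment> \<open>The minimiser is perturbed in the direction of its own residual. The first order
    term is then \<open>ip r r\<close>, whose vanishing is the eigenvalue equation.\<close>
  define r where "r = ap f - fun_scale l f"
  have rW: "r \<in> W" using fW by (auto simp: r_def intro: Wadd Wap)
  have "ip r r = 0"
  proof (rule quadratic_nonneg_imp_linear_0[where q = "q r - l * ip r r"])
    fix e :: real
    define h where "h = f + fun_scale e r"
    have "l * ip h h \<le> q h" using rW fW by (intro lower) (auto simp: h_def intro: Wadd)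
    moreover have "ip h h = 1 + 2 * e * ip f r + e\<^sup>2 * ip r r"
      using fW by (simp add: h_def ip_commute[of r f] power2_eq_square algebra_simps)
    moreover have "q h = l + 2 * e * ip r (ap f) + e\<^sup>2 * q r"
      using ap_symmetric[of f r]
      by (simp add: q_def h_def l_def ip_commute[of r f] ip_commute[of "ap f" r]
          power2_eq_square algebra_simps)
    moreover have "ip r (ap f) = ip r r + l * ip f r"
      by (simp add: r_def ip_commute[of "ap f" f])
    ultimately show "0 \<le> 2 * e * ip r r + e\<^sup>2 * (q r - l * ip r r)"
      by (simp add: algebra_simps)
  qed
  then have "r = 0" using rW ip_eq_0 by (auto simp: W_def)
  then have "ap f = fun_scale l f" by (simp add: r_def)
  then show ?thesis using that[of f l] fW by (auto simp: eigspace_def W_def)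
qed

lemma orthonormal_combination:
  assumes "finite T" "\<And>v. v \<in> T \<Longrightarrow> ip v v = 1" "\<And>u v. u \<in> T \<Longrightarrow> v \<in> T \<Longrightarrow> u \<noteq> v \<Longrightarrow> ip u v = 0" "u \<in> T"
  shows "ip u (\<Sum>v\<in>T. fun_scale (c v) v) = c u"
proof -
  have "ip u (\<Sum>v\<in>T. fun_scale (c v) v) = (\<Sum>v\<in>T. if v = u then c v else 0)"
    unfolding ip_sum_right using assms by (intro sum.cong) auto
  then show ?thesis using assms by simp
qed

lemma orthonormal_eigs_independent:
  assumes S: "orthonormal_eigs S"
  shows "fs.independent S"
proof
  assume "fs.dependent S"
  then obtain T u v where T: "finite T" "T \<subseteq> S" "v \<in> T" "u v \<noteq> 0" "(\<Sum>v\<in>T. fun_scale (u v) v) = 0"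
    by (auto simp: fs.dependent_explicit)
  have "ip v (\<Sum>w\<in>T. fun_scale (u w) w) = u v"
    using S T by (intro orthonormal_combination) (auto simp: orthonormal_eigs_def subset_iff)
  with T show False by simp
qed

lemma orthonormal_eigs_subset_supp: "orthonormal_eigs S \<Longrightarrow> S \<subseteq> supp"
  by (auto simp: orthonormal_eigs_def eigspace_def)

lemma orthonormal_eigs_finite:
  assumes S: "orthonormal_eigs S"
  shows "finite S" "card S \<le> card B"
proof -
  have "S \<subseteq> fs.span (delta ` B)"
    using orthonormal_eigs_subset_supp[OF S] by (simp add: span_delta[OF fin] supp_def)
  then have "finite S \<and> card S \<le> card (delta ` B)"
    by (intro fs.independent_span_bound) (use orthonormal_eigs_independent[OF S] fin in auto)
  then show "finite S" "card S \<le> card B"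
    by (simp_all add: card_image inj_on_subset[OF inj_delta])
qed

text \<open>A maximal orthonormal set of eigenvectors is a basis: a nonzero residual of some
  expansion would be orthogonal to \<open>S\<close>, and the invariant complement would then contain
  one more unit eigenvector. A set of maximal cardinality exists because all cardinalities are
  bounded by \<open>card B\<close>.\<close>

lemma ex_eigenbasis:
  obtains S where "orthonormal_eigs S" "\<And>f. f \<in> supp \<Longrightarrow> f = (\<Sum>v\<in>S. fun_scale (ip v f) v)"
proof -
  have "orthonormal_eigs {}" by (simp add: orthonormal_eigs_def)
  moreover have "\<forall>T. orthonormal_eigs T \<longrightarrow> card T \<le> card B"
    using orthonormal_eigs_finite(2) by blast
  ultimately have "\<exists>S. orthonormal_eigs S \<and> (\<forall>T. orthonormal_eigs T \<longrightarrow> card T \<le> card S)"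
    by (intro ex_has_greatest_nat[where b = "Suc (card B)"]) (auto simp: less_Suc_eq_le)
  then obtain S where S: "orthonormal_eigs S" "\<forall>T. orthonormal_eigs T \<longrightarrow> card T \<le> card S"
    by blast
  have finS: "finite S" using S orthonormal_eigs_finite by auto
  show ?thesis
  proof (rule that[OF S(1)])
    fix f assume f: "f \<in> supp"
    define g where "g = f - (\<Sum>v\<in>S. fun_scale (ip v f) v)"
    have gs: "g \<in> supp"
      unfolding g_def using f orthonormal_eigs_subset_supp[OF S(1)] by (auto intro!: supp_sum)
    have go: "ip v g = 0" if "v \<in> S" for v
      using orthonormal_combination[OF finS, of v "\<lambda>v. ip v f"] that S(1)
      by (auto simp: g_def orthonormal_eigs_def)
    have "g = 0"
    proof (rule ccontr)
      assume "g \<noteq> 0"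
      then obtain h l where h: "h \<in> eigspace l" "ip h h = 1" "\<And>v. v \<in> S \<Longrightarrow> ip v h = 0"
        using ex_eigenvector_orthogonal[of S g] gs go S(1) by (auto simp: orthonormal_eigs_def)
      have "h \<notin> S" using h by fastforce
      moreover have "ip h v = 0" if "v \<in> S" for v
        using h(3)[OF that] ip_commute[of h v] by simp
      then have "orthonormal_eigs (insert h S)"
        using S(1) h by (auto simp: orthonormal_eigs_def)
      ultimately show False using S(2)[rule_format, of "insert h S"] finS by auto
    qed
    then show "f = (\<Sum>v\<in>S. fun_scale (ip v f) v)" by (simp add: g_def)
  qed
qed

text \<open>Built exactly like \<open>dirichlet_eigenvalues\<close>, so that once the eigenspaces
  are identified the two lists agree by unfolding.\<close>

definition eiglist :: "real list" where
  "eiglist = concat (map (\<lambda>l. replicate (fs.dim (eigspace l)) l)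
     (sorted_list_of_set {l. \<exists>f\<in>eigspace l. f \<noteq> (\<lambda>x. 0)}))"

definition eigval :: "('b \<Rightarrow> real) \<Rightarrow> real" where
  "eigval v = (THE l. v \<in> eigspace l)"

lemma eigval_eqI:
  assumes "v \<in> eigspace l" "v \<noteq> 0"
  shows "eigval v = l"
  unfolding eigval_def
proof (rule the_equality)
  fix m assume "v \<in> eigspace m"
  then have "fun_scale m v = fun_scale l v"
    using assms by (simp add: eigspace_def)
  then have "m * ip v v = l * ip v v"
    using ip_simps(6)[of v] by metis
  then show "m = l" using ip_pos[of v] assms by (simp add: eigspace_def)
qed fact

end

section \<open>Counting eigenvalues through an orthonormal eigenbasis\<close>

locale symmetric_matrix_eigenbasis = symmetric_matrix +
  fixes S
  assumes orthonormal: "orthonormal_eigs S"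
    and expansion: "\<And>f. f \<in> supp \<Longrightarrow> f = (\<Sum>v\<in>S. fun_scale (ip v f) v)"
begin

lemma finite_S: "finite S"
  using orthonormal_eigs_finite orthonormal by auto

lemma ip_S: "v \<in> S \<Longrightarrow> ip v v = 1" "u \<in> S \<Longrightarrow> v \<in> S \<Longrightarrow> u \<noteq> v \<Longrightarrow> ip u v = 0"
  using orthonormal by (auto simp: orthonormal_eigs_def)

lemma S_nonzero: "v \<in> S \<Longrightarrow> v \<noteq> 0"
  using ip_S(1) by fastforce

lemma S_supp: "v \<in> S \<Longrightarrow> v \<in> supp"
  using orthonormal_eigs_subset_supp[OF orthonormal] by auto

lemma eigval_S: "v \<in> S \<Longrightarrow> v \<in> eigspace (eigval v)"
  using orthonormal eigval_eqI S_nonzero by (metis orthonormal_eigs_def)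

lemma card_S: "card S = card B"
proof (rule antisym)
  show "card S \<le> card B" using orthonormal_eigs_finite orthonormal by auto
  have "delta ` B \<subseteq> fs.span S"
  proof safe
    fix x assume "x \<in> B"
    then have "delta x \<in> supp" by (auto simp: supp_def delta_def)
    then have "delta x = (\<Sum>v\<in>S. fun_scale (ip v (delta x)) v)" by (rule expansion)
    also have "\<dots> \<in> fs.span S"
      by (intro fs.span_sum fs.span_scale fs.span_base)
    finally show "delta x \<in> fs.span S" .
  qed
  then have "card (delta ` B) \<le> card S"
    using fs.independent_span_bound[OF finite_S independent_delta[OF fin]] by auto
  then show "card B \<le> card S" by (simp add: card_image inj_on_subset[OF inj_delta])
qed

text \<open>A vector in the eigenspace of \<open>l\<close> is orthogonal to the basis vectors with
  other eigenvalues, so its expansion uses only those with eigenvalue \<open>l\<close>.\<close>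

lemma dim_eigspace: "fs.dim (eigspace l) = card {v \<in> S. eigval v = l}"
proof (rule fs.dim_unique)
  show "{v \<in> S. eigval v = l} \<subseteq> eigspace l" using eigval_S by auto
  show "fs.independent {v \<in> S. eigval v = l}"
    using orthonormal_eigs_independent[OF orthonormal] by (rule fs.independent_mono) auto
  show "eigspace l \<subseteq> fs.span {v \<in> S. eigval v = l}"
  proof
    fix f assume f: "f \<in> eigspace l"
    have "ip v f = 0" if "v \<in> S" "eigval v \<noteq> l" for v
      using eigspace_orthogonal[OF eigval_S f] that by auto
    moreover have "f = (\<Sum>v\<in>S. fun_scale (ip v f) v)"
      using f by (intro expansion) (auto simp: eigspace_def)
    ultimately have "f = (\<Sum>v\<in>{v \<in> S. eigval v = l}. fun_scale (ip v f) v)"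
      using finite_S by (subst sum.mono_neutral_left[where T = S]) (auto simp: fun_scale_def fun_eq_iff)
    also have "\<dots> \<in> fs.span {v \<in> S. eigval v = l}"
      by (intro fs.span_sum fs.span_scale fs.span_base) auto
    finally show "f \<in> fs.span {v \<in> S. eigval v = l}" .
  qed
qed simp

lemma spectrum_eq: "{l. \<exists>f\<in>eigspace l. f \<noteq> (\<lambda>x. 0)} = eigval ` S"
proof (intro equalityI subsetI)
  fix l assume "l \<in> eigval ` S"
  then obtain v where v: "v \<in> S" "l = eigval v" by auto
  then show "l \<in> {l. \<exists>f\<in>eigspace l. f \<noteq> (\<lambda>x. 0)}"
    using eigval_S[of v] S_nonzero[of v] by (auto simp: zero_fun_def)
next
  fix l assume "l \<in> {l. \<exists>f\<in>eigspace l. f \<noteq> (\<lambda>x. 0)}"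
  then obtain f where f: "f \<in> eigspace l" "f \<noteq> 0" by (auto simp: zero_fun_def)
  show "l \<in> eigval ` S"
  proof (rule ccontr)
    assume "l \<notin> eigval ` S"
    then have "ip v f = 0" if "v \<in> S" for v
      using eigspace_orthogonal[OF eigval_S f(1)] that by auto
    moreover have "f = (\<Sum>v\<in>S. fun_scale (ip v f) v)"
      using f by (intro expansion) (auto simp: eigspace_def)
    ultimately have "f = 0" by (simp add: fun_scale_def fun_eq_iff sum_fun_apply)
    with f show False by simp
  qed
qed

lemma length_filter_eiglist: "length (filter P eiglist) = card {v \<in> S. P (eigval v)}"
proof -
  have "length (filter P eiglist) = (\<Sum>l | l \<in> eigval ` S \<and> P l. card {v \<in> S. eigval v = l})"
    unfolding eiglist_def spectrum_eq
    by (subst length_filter_concat_replicate) (simp_all add: dim_eigspace finite_S)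
  also have "\<dots> = card (\<Union>l\<in>{l. l \<in> eigval ` S \<and> P l}. {v \<in> S. eigval v = l})"
    by (rule card_UN_disjoint[symmetric]) (auto simp: finite_S)
  also have "(\<Union>l\<in>{l. l \<in> eigval ` S \<and> P l}. {v \<in> S. eigval v = l}) = {v \<in> S. P (eigval v)}"
    by auto
  finally show ?thesis .
qed

text \<open>The bridge from the list with multiplicities to the eigenbasis: every bound on an entry
  of the list becomes a bound on the number of basis vectors with small eigenvalue.\<close>

lemma eiglist_le_iff:
  assumes "1 \<le> k" "k \<le> card B"
  shows "eiglist ! (k - 1) \<le> c \<longleftrightarrow> k \<le> card {v \<in> S. eigval v \<le> c}"
proof -
  have "sorted eiglist" unfolding eiglist_def by (intro sorted_concat_replicate) simp
  moreover have "length eiglist = card B"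
    using length_filter_eiglist[of "\<lambda>_. True"] by (simp add: card_S)
  ultimately show ?thesis
    using sorted_nth_le_iff[of eiglist "k - 1" c] assms by (auto simp: length_filter_eiglist)
qed

lemma parseval:
  assumes "f \<in> supp"
  shows "ip f f = (\<Sum>v\<in>S. (ip v f)\<^sup>2)" "ip f (ap f) = (\<Sum>v\<in>S. eigval v * (ip v f)\<^sup>2)"
proof -
  have "ip f f = ip f (\<Sum>v\<in>S. fun_scale (ip v f) v)"
    using expansion[OF assms] by simp
  also have "\<dots> = (\<Sum>v\<in>S. (ip v f)\<^sup>2)"
    by (simp add: ip_sum_right ip_commute[of f] power2_eq_square)
  finally show "ip f f = (\<Sum>v\<in>S. (ip v f)\<^sup>2)" .
  have "ip f (ap f) = ip f (ap (\<Sum>v\<in>S. fun_scale (ip v f) v))"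
    using expansion[OF assms] by simp
  also have "\<dots> = (\<Sum>v\<in>S. ip v f * ip f (ap v))"
    by (simp add: ap_sum ip_sum_right)
  also have "\<dots> = (\<Sum>v\<in>S. eigval v * (ip v f)\<^sup>2)"
    using eigval_S by (intro sum.cong) (auto simp: eigspace_def ip_commute[of f] power2_eq_square)
  finally show "ip f (ap f) = (\<Sum>v\<in>S. eigval v * (ip v f)\<^sup>2)" .
qed

end

section \<open>Minimax bounds for the entries of the spectrum\<close>

context symmetric_matrix
begin

text \<open>If fewer than \<open>k\<close> basis vectors had eigenvalue at most \<open>c\<close>,
  some nonzero combination of the \<open>k\<close> trial vectors would be orthogonal to all of them,
  and its Rayleigh quotient would exceed \<open>c\<close>.\<close>

lemma eiglist_leI:
  assumes I: "finite I" "card I = k" "1 \<le> k" "k \<le> card B"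
    and u: "\<And>i. i \<in> I \<Longrightarrow> u i \<in> supp"
    and indep: "\<And>b. (\<Sum>i\<in>I. fun_scale (b i) (u i)) = 0 \<Longrightarrow> \<forall>i\<in>I. b i = 0"
    and le: "\<And>b f. f = (\<Sum>i\<in>I. fun_scale (b i) (u i)) \<Longrightarrow> ip f (ap f) \<le> c * ip f f"
  shows "eiglist ! (k - 1) \<le> c"
proof -
  obtain S where S: "orthonormal_eigs S" "\<And>f. f \<in> supp \<Longrightarrow> f = (\<Sum>v\<in>S. fun_scale (ip v f) v)"
    using ex_eigenbasis by blast
  interpret symmetric_matrix_eigenbasis B a S by unfold_locales (use S in auto)
  define J where "J = {v \<in> S. eigval v \<le> c}"
  have "finite J" using finite_S by (simp add: J_def)
  have "k \<le> card J"
  proof (rule ccontr)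
    assume "\<not> k \<le> card J"
    then obtain b where b: "\<exists>i\<in>I. b i \<noteq> 0" "\<And>v. v \<in> J \<Longrightarrow> (\<Sum>i\<in>I. b i * ip v (u i)) = 0"
      using nontrivial_solution[OF I(1) \<open>finite J\<close>, of "\<lambda>i v. ip v (u i)"] I(2) by (metis not_le)
    define f where "f = (\<Sum>i\<in>I. fun_scale (b i) (u i))"
    have f: "f \<in> supp" unfolding f_def using u by (intro supp_sum) auto
    have "f \<noteq> 0" using indep[of b] b(1) by (auto simp: f_def)
    have orth: "ip v f = 0" if "v \<in> J" for v
      using b(2)[OF that] by (simp add: f_def ip_sum_right)
    have "\<exists>v\<in>S. ip v f \<noteq> 0"
    proof (rule ccontr)
      assume "\<not> ?thesis"
      then have "ip f f = 0" by (simp add: parseval(1)[OF f])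
      with ip_pos[OF f \<open>f \<noteq> 0\<close>] show False by simp
    qed
    then obtain v where v: "v \<in> S" "ip v f \<noteq> 0" by blast
    have "(\<Sum>v\<in>S. c * (ip v f)\<^sup>2) < (\<Sum>v\<in>S. eigval v * (ip v f)\<^sup>2)"
    proof (rule sum_strict_mono_ex1)
      show "\<forall>v\<in>S. c * (ip v f)\<^sup>2 \<le> eigval v * (ip v f)\<^sup>2"
      proof
        fix v assume "v \<in> S"
        then show "c * (ip v f)\<^sup>2 \<le> eigval v * (ip v f)\<^sup>2"
          using orth[of v] by (cases "v \<in> J") (auto simp: J_def intro!: mult_right_mono)
      qed
      show "\<exists>v\<in>S. c * (ip v f)\<^sup>2 < eigval v * (ip v f)\<^sup>2"
        using v orth[of v] by (intro bexI[of _ v]) (auto simp: J_def not_le[symmetric])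
    qed (rule finite_S)
    then have "c * ip f f < ip f (ap f)"
      by (simp add: parseval[OF f] sum_distrib_left)
    with le[OF f_def] show False by simp
  qed
  then show ?thesis using eiglist_le_iff[of k c] I by (simp add: J_def)
qed

text \<open>The dual count: if \<open>k\<close> basis vectors had eigenvalue at most
  \<open>c\<close>, the fewer than \<open>k\<close> linear conditions at the points of
  \<open>Z\<close> would leave a nonzero combination of them, and its Rayleigh quotient would be at
  most \<open>c\<close>.\<close>

lemma eiglist_gtI:
  assumes Z: "finite Z" "card Z < k" "k \<le> card B"
    and less: "\<And>f. f \<in> supp \<Longrightarrow> f \<noteq> 0 \<Longrightarrow> (\<And>z. z \<in> Z \<Longrightarrow> f z = 0) \<Longrightarrow> c * ip f f < ip f (ap f)"
  shows "c < eiglist ! (k - 1)"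
proof -
  obtain S where S: "orthonormal_eigs S" "\<And>f. f \<in> supp \<Longrightarrow> f = (\<Sum>v\<in>S. fun_scale (ip v f) v)"
    using ex_eigenbasis by blast
  interpret symmetric_matrix_eigenbasis B a S by unfold_locales (use S in auto)
  define J where "J = {v \<in> S. eigval v \<le> c}"
  have J: "finite J" "J \<subseteq> S" using finite_S by (auto simp: J_def)
  have "\<not> k \<le> card J"
  proof
    assume "k \<le> card J"
    then obtain b where b: "\<exists>v\<in>J. b v \<noteq> 0" "\<And>z. z \<in> Z \<Longrightarrow> (\<Sum>v\<in>J. b v * v z) = 0"
      using nontrivial_solution[OF J(1) Z(1), of "\<lambda>v z. v z"] Z(2) by (metis less_le_trans)
    define f where "f = (\<Sum>v\<in>J. fun_scale (b v) v)"
    have f: "f \<in> supp" unfolding f_def using J S_supp by (intro supp_sum) auto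
    have coeff: "ip v f = b v" if "v \<in> J" for v
      unfolding f_def using J that by (intro orthonormal_combination) (auto intro: ip_S)
    have zero: "ip v f = 0" if "v \<in> S" "v \<notin> J" for v
      unfolding f_def ip_sum_right using J that by (intro sum.neutral) (auto intro!: ip_S(2))
    obtain v where "v \<in> J" "b v \<noteq> 0" using b(1) by blast
    then have "f \<noteq> 0" using coeff[of v] by auto
    moreover have "f z = 0" if "z \<in> Z" for z
      using b(2)[OF that] by (simp add: f_def sum_fun_apply fun_scale_def)
    ultimately have "c * ip f f < ip f (ap f)" using less f by blast
    moreover have "(\<Sum>v\<in>S. eigval v * (ip v f)\<^sup>2) \<le> (\<Sum>v\<in>S. c * (ip v f)\<^sup>2)"
    proof (rule sum_mono)
      fix v assume "v \<in> S"
      then show "eigval v * (ip v f)\<^sup>2 \<le> c * (ip v f)\<^sup>2"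
        using zero[of v] by (cases "v \<in> J") (auto simp: J_def intro!: mult_right_mono)
    qed
    ultimately show False by (simp add: parseval[OF f] sum_distrib_left)
  qed
  then show ?thesis using eiglist_le_iff[of k c] Z by (simp add: J_def not_le)
qed

text \<open>The trial space bound is attained by eigenvectors of the \<open>k\<close> lowest
  eigenvalues. They later serve as trial vectors for a nearby matrix.\<close>

lemma eiglist_minimax:
  assumes k: "1 \<le> k" "k \<le> card B"
  obtains T where "finite T" "card T = k" "T \<subseteq> supp"
    "\<And>b. (\<Sum>v\<in>T. fun_scale (b v) v) = 0 \<Longrightarrow> \<forall>v\<in>T. b v = 0"
    "\<And>b f. f = (\<Sum>v\<in>T. fun_scale (b v) v) \<Longrightarrow> ip f (ap f) \<le> eiglist ! (k - 1) * ip f f"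
proof -
  obtain S where S: "orthonormal_eigs S" "\<And>f. f \<in> supp \<Longrightarrow> f = (\<Sum>v\<in>S. fun_scale (ip v f) v)"
    using ex_eigenbasis by blast
  interpret symmetric_matrix_eigenbasis B a S by unfold_locales (use S in auto)
  let ?c = "eiglist ! (k - 1)"
  have "k \<le> card {v \<in> S. eigval v \<le> ?c}"
    using eiglist_le_iff[OF k, of ?c] by simp
  then obtain T where T: "T \<subseteq> {v \<in> S. eigval v \<le> ?c}" "card T = k" "finite T"
    by (rule obtain_subset_with_card_n)
  have coeff: "ip u (\<Sum>v\<in>T. fun_scale (b v) v) = b u" if "u \<in> T" for u b
    using T that by (intro orthonormal_combination) (auto intro: ip_S)
  show ?thesis
  proof (rule that[of T])
    show "\<forall>v\<in>T. b v = 0" if "(\<Sum>v\<in>T. fun_scale (b v) v) = 0" for b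
      using coeff[of _ b] that by simp
    show "T \<subseteq> supp" using T S_supp by auto
    fix b f assume f_def: "f = (\<Sum>v\<in>T. fun_scale (b v) v)"
    have f: "f \<in> supp" unfolding f_def using T S_supp by (intro supp_sum) auto
    have zero: "ip v f = 0" if "v \<in> S" "v \<notin> T" for v
      unfolding f_def ip_sum_right using T that by (intro sum.neutral) (auto intro!: ip_S(2))
    have "(\<Sum>v\<in>S. eigval v * (ip v f)\<^sup>2) \<le> (\<Sum>v\<in>S. ?c * (ip v f)\<^sup>2)"
    proof (rule sum_mono)
      fix v assume "v \<in> S"
      then show "eigval v * (ip v f)\<^sup>2 \<le> ?c * (ip v f)\<^sup>2"
        using zero[of v] T(1) by (cases "v \<in> T") (auto intro!: mult_right_mono)
    qed
    then show "ip f (ap f) \<le> ?c * ip f f" by (simp add: parseval[OF f] sum_distrib_left)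
  qed (use T in auto)
qed

end

section \<open>Dirichlet eigenvalues of the box\<close>

lemma adjacent_commute: "adjacent x y \<longleftrightarrow> adjacent y x"
  by (simp add: adjacent_def abs_minus_commute)

lemma adjacent_irrefl [simp]: "\<not> adjacent x x"
  by (simp add: adjacent_def)

lemma adjacent_component_le:
  assumes "adjacent x y"
  shows "\<bar>x $ i - y $ i\<bar> \<le> 1"
proof -
  have "\<bar>x $ i - y $ i\<bar> \<le> (\<Sum>i\<in>UNIV. \<bar>x $ i - y $ i\<bar>)"
    by (rule member_le_sum) auto
  then show ?thesis using assms by (simp add: adjacent_def)
qed

lemma finite_int_vec_bounded: "finite {x :: int ^ 'd::finite. \<forall>i. x $ i \<in> {f i..g i}}"
proof -
  have "inj_on vec_nth {x :: int ^ 'd. \<forall>i. x $ i \<in> {f i..g i}}"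
    by (simp add: inj_on_def vec_eq_iff)
  moreover have "vec_nth ` {x :: int ^ 'd. \<forall>i. x $ i \<in> {f i..g i}} \<subseteq> PiE UNIV (\<lambda>i. {f i..g i})"
    by auto
  moreover have "finite (PiE UNIV (\<lambda>i :: 'd. {f i..g i}))"
    by (intro finite_PiE) auto
  ultimately show ?thesis by (meson finite_imageD finite_subset)
qed

lemma finite_lattice_box [simp]: "finite (lattice_box n)"
  unfolding lattice_box_def by (rule finite_int_vec_bounded)

lemma card_lattice_box: "card (lattice_box n :: (int ^ 'd::finite) set) = (2 * n + 1) ^ CARD('d)"
proof -
  have "bij_betw vec_nth (lattice_box n :: (int ^ 'd) set) (PiE UNIV (\<lambda>i. {- int n..int n}))"
    by (rule bij_betwI[where g = vec_lambda]) (auto simp: lattice_box_def)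
  then have "card (lattice_box n :: (int ^ 'd) set) = card (PiE (UNIV :: 'd set) (\<lambda>i. {- int n..int n}))"
    by (rule bij_betw_same_card)
  also have "\<dots> = (2 * n + 1) ^ CARD('d)"
    by (simp add: card_PiE nat_add_distrib nat_mult_distrib)
  finally show ?thesis .
qed

lemma finite_adjacent [simp]: "finite {y :: int ^ 'd::finite. adjacent y x}"
proof (rule finite_subset)
  show "{y. adjacent y x} \<subseteq> {y. \<forall>i. y $ i \<in> {x $ i - 1..x $ i + 1}}"
  proof safe
    fix y i assume "adjacent y x"
    from adjacent_component_le[OF this, of i] show "y $ i \<in> {x $ i - 1..x $ i + 1}" by auto
  qed
qed (rule finite_int_vec_bounded)

lemma edge_in_edges [simp]: "{x, y} \<in> edges \<longleftrightarrow> adjacent x y"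
  by (auto simp: edges_def doubleton_eq_iff adjacent_commute)

text \<open>The diagonal entry includes the edges that leave the box. They carry the Dirichlet
  condition: mass crossing them is lost.\<close>

definition dirichlet_matrix ::
  "((int ^ 'd::finite) set \<Rightarrow> real) \<Rightarrow> int ^ 'd \<Rightarrow> int ^ 'd \<Rightarrow> real" where
  "dirichlet_matrix c x y =
     (if x = y then vertex_conductance c x else if adjacent y x then - c {x, y} else 0)"

lemma symmetric_dirichlet_matrix: "symmetric_matrix (lattice_box n) (dirichlet_matrix c)"
  by unfold_locales (auto simp: dirichlet_matrix_def adjacent_commute insert_commute)

lemma laplacian_eq_matrix:
  assumes f: "\<And>x. x \<notin> lattice_box n \<Longrightarrow> f x = 0"
    and x: "x \<in> lattice_box n"
  shows "laplacian c f x = - (\<Sum>y\<in>lattice_box n. dirichlet_matrix c x y * f y)"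
proof -
  have "(\<Sum>y\<in>lattice_box n. dirichlet_matrix c x y * f y) =
      vertex_conductance c x * f x + (\<Sum>y\<in>lattice_box n - {x}. dirichlet_matrix c x y * f y)"
    using x by (subst sum.remove[of _ x]) (auto simp: dirichlet_matrix_def)
  also have "(\<Sum>y\<in>lattice_box n - {x}. dirichlet_matrix c x y * f y) = (\<Sum>y | adjacent y x. - c {x, y} * f y)"
    using f by (intro sum.mono_neutral_cong) (auto simp: dirichlet_matrix_def)
  also have "vertex_conductance c x * f x = (\<Sum>y | adjacent y x. c {x, y} * f x)"
    by (simp add: vertex_conductance_def sum_distrib_right insert_commute)
  finally show ?thesis
    by (simp add: laplacian_def sum_negf sum_subtractf algebra_simps)
qed

lemma dirichlet_eigenspace_eq:
  "dirichlet_eigenspace c n l = symmetric_matrix.eigspace (lattice_box n) (dirichlet_matrix c) l"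
proof -
  interpret symmetric_matrix "lattice_box n" "dirichlet_matrix c"
    by (rule symmetric_dirichlet_matrix)
  have "(\<forall>x\<in>lattice_box n. - laplacian c f x = l * f x) \<longleftrightarrow> ap f = fun_scale l f"
    if "\<forall>x. x \<notin> lattice_box n \<longrightarrow> f x = 0" for f
    using laplacian_eq_matrix[of n f _ c] that by (auto simp: ap_def fun_scale_def fun_eq_iff)
  then show ?thesis
    by (auto simp: dirichlet_eigenspace_def eigspace_def supp_def)
qed

lemma dirichlet_eigenvalues_eq:
  "dirichlet_eigenvalues c n = symmetric_matrix.eiglist (lattice_box n) (dirichlet_matrix c)"
  unfolding dirichlet_eigenvalues_def eigenvalue_multiplicity_def dirichlet_eigenspace_eq
    symmetric_matrix.eiglist_def[OF symmetric_dirichlet_matrix] ..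

text \<open>Every edge contributes to the local energies of both endpoints, so the local energies sum to
  twice the energy.\<close>

definition local_energy ::
  "((int ^ 'd) set \<Rightarrow> real) \<Rightarrow> (int ^ 'd \<Rightarrow> real) \<Rightarrow> int ^ 'd::finite \<Rightarrow> real" where
  "local_energy c f z = (\<Sum>y | adjacent y z. c {z, y} * (f z - f y)\<^sup>2)"

definition energy ::
  "((int ^ 'd) set \<Rightarrow> real) \<Rightarrow> nat \<Rightarrow> (int ^ 'd::finite \<Rightarrow> real) \<Rightarrow> real" where
  "energy c n f = (\<Sum>x\<in>lattice_box n. f x * (- laplacian c f x))"

lemma lattice_box_mono: "m \<le> n \<Longrightarrow> lattice_box m \<subseteq> lattice_box n"
proof
  fix x :: "int ^ 'a" assume "m \<le> n" "x \<in> lattice_box m"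
  then have "- int n \<le> x $ i \<and> x $ i \<le> int n" for i
    unfolding lattice_box_def by (auto dest!: spec[of _ i])
  then show "x \<in> lattice_box n" by (simp add: lattice_box_def)
qed

lemma adjacent_lattice_box:
  assumes "adjacent x y" "x \<in> lattice_box n"
  shows "y \<in> lattice_box (Suc n)"
  unfolding lattice_box_def
proof safe
  fix i
  have "\<bar>x $ i - y $ i\<bar> \<le> 1" using assms(1) by (rule adjacent_component_le)
  moreover have "\<bar>x $ i\<bar> \<le> int n" using assms(2) by (simp add: lattice_box_def abs_le_iff minus_le_iff)
  ultimately show "y $ i \<in> {- int (Suc n)..int (Suc n)}" by auto
qed

text \<open>\<open>n < m\<close> leaves one layer around the box, so both ends of every edge with
  \<open>f\<close> nonzero at some end are summed over. The sums run over ordered pairs, where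
  exchanging the two ends is a bijection.\<close>

lemma sum_local_energy:
  fixes f :: "int ^ 'd::finite \<Rightarrow> real"
  assumes f: "\<And>x. x \<notin> lattice_box n \<Longrightarrow> f x = 0" and m: "n < m"
  shows "(\<Sum>z\<in>lattice_box m. local_energy c f z) = 2 * energy c n f"
proof -
  define P where "P = (SIGMA x:(lattice_box m :: (int ^ 'd) set). {y \<in> lattice_box m. adjacent y x})"
  have finP: "finite P" unfolding P_def by (rule finite_SigmaI) auto
  have outside: "y \<notin> lattice_box n" if "adjacent y x" "y \<notin> lattice_box m" for x y
    using lattice_box_mono[of n m] m that by auto
  have outside': "x \<notin> lattice_box n" if "adjacent y x" "y \<notin> lattice_box m" for x y
    using lattice_box_mono[of "Suc n" m] m that adjacent_lattice_box[of x y n] by (auto simp: adjacent_commute)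
  have sum_P: "(\<Sum>z\<in>lattice_box m. \<Sum>y | adjacent y z. g z y) = (\<Sum>(z, y)\<in>P. g z y)"
    if "\<And>z y. z \<notin> lattice_box n \<Longrightarrow> y \<notin> lattice_box n \<Longrightarrow> g z y = 0" for g :: "int ^ 'd \<Rightarrow> int ^ 'd \<Rightarrow> real"
  proof -
    have "(\<Sum>z\<in>lattice_box m. \<Sum>y | adjacent y z. g z y) = (\<Sum>z\<in>lattice_box m. \<Sum>y\<in>{y \<in> lattice_box m. adjacent y z}. g z y)"
    proof (rule sum.cong[OF refl], rule sum.mono_neutral_right)
      fix z :: "int ^ 'd"
      show "\<forall>y\<in>{y. adjacent y z} - {y \<in> lattice_box m. adjacent y z}. g z y = 0"
      proof
        fix y assume "y \<in> {y. adjacent y z} - {y \<in> lattice_box m. adjacent y z}"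
        then show "g z y = 0" by (intro that outside[of y z] outside'[of y z]) auto
      qed
    qed auto
    also have "\<dots> = (\<Sum>(z, y)\<in>P. g z y)" unfolding P_def by (rule sum.Sigma) auto
    finally show ?thesis .
  qed
  have swap: "(\<Sum>(z, y)\<in>P. g z y) = (\<Sum>(z, y)\<in>P. g y z)" for g :: "int ^ 'd \<Rightarrow> int ^ 'd \<Rightarrow> real"
    by (rule sum.reindex_bij_witness[of _ prod.swap prod.swap]) (auto simp: P_def adjacent_commute)
  have "energy c n f = (\<Sum>x\<in>lattice_box m. f x * (- laplacian c f x))"
    unfolding energy_def using f m lattice_box_mono[of n m] by (intro sum.mono_neutral_left) auto
  also have "\<dots> = (\<Sum>x\<in>lattice_box m. \<Sum>y | adjacent y x. c {x, y} * (f x * (f x - f y)))"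
    by (simp add: laplacian_def sum_distrib_left sum_negf[symmetric] algebra_simps)
  also have "\<dots> = (\<Sum>(x, y)\<in>P. c {x, y} * (f x * (f x - f y)))"
    using f by (intro sum_P) auto
  finally have E: "energy c n f = (\<Sum>(x, y)\<in>P. c {x, y} * (f x * (f x - f y)))" .
  also have "\<dots> = (\<Sum>(x, y)\<in>P. c {x, y} * (f y * (f y - f x)))"
    by (subst swap) (simp add: insert_commute)
  finally have E': "energy c n f = (\<Sum>(x, y)\<in>P. c {x, y} * (f y * (f y - f x)))" .
  have "(\<Sum>z\<in>lattice_box m. local_energy c f z) = (\<Sum>(x, y)\<in>P. c {x, y} * (f x - f y)\<^sup>2)"
    unfolding local_energy_def using f by (intro sum_P) auto
  \<comment> \<open>Pair by pair this is \<open>(u - v)\<^sup>2 = u * (u - v) + v * (v - u)\<close>,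
    with the energy written once from each end of the edge.\<close>
  also have "\<dots> = (\<Sum>(x, y)\<in>P. c {x, y} * (f x * (f x - f y))) + (\<Sum>(x, y)\<in>P. c {x, y} * (f y * (f y - f x)))"
    unfolding sum.distrib[symmetric] by (rule sum.cong) (auto simp: power2_eq_square algebra_simps)
  also have "\<dots> = energy c n f + energy c n f"
    using E E' by simp
  finally show ?thesis by simp
qed

lemma dirichlet_eigenvalue_gtI:
  fixes c :: "(int ^ 'd::finite) set \<Rightarrow> real"
  assumes "finite Z" "card Z < k" "k \<le> card (lattice_box n :: (int ^ 'd) set)"
    and less: "\<And>f. (\<And>x. x \<notin> lattice_box n \<Longrightarrow> f x = 0) \<Longrightarrow> f \<noteq> (\<lambda>x. 0) \<Longrightarrow> (\<And>z. z \<in> Z \<Longrightarrow> f z = 0) \<Longrightarrow>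
      l * (\<Sum>x\<in>lattice_box n. (f x)\<^sup>2) < energy c n f"
  shows "l < dirichlet_eigenvalue c n k"
proof -
  interpret symmetric_matrix "lattice_box n" "dirichlet_matrix c"
    by (rule symmetric_dirichlet_matrix)
  show ?thesis unfolding dirichlet_eigenvalue_def dirichlet_eigenvalues_eq
  proof (rule eiglist_gtI[OF assms(1-3)])
    fix f assume f: "f \<in> supp" "f \<noteq> 0" "\<And>z. z \<in> Z \<Longrightarrow> f z = 0"
    have "ip f (ap f) = energy c n f"
      using f(1) unfolding ip_def energy_def ap_def
      by (intro sum.cong refl) (simp add: laplacian_eq_matrix[of n f _ c] supp_def)
    moreover have "ip f f = (\<Sum>x\<in>lattice_box n. (f x)\<^sup>2)" by (simp add: ip_def power2_eq_square)
    ultimately show "l * ip f f < ip f (ap f)"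
      using less[of f] f by (simp add: supp_def zero_fun_def)
  qed
qed

lemma dirichlet_eigenvalue_leI:
  fixes c :: "(int ^ 'd::finite) set \<Rightarrow> real"
  assumes Z: "Z \<subseteq> lattice_box n" "card Z = k" "1 \<le> k"
    and nonadj: "\<And>x y. x \<in> Z \<Longrightarrow> y \<in> Z \<Longrightarrow> \<not> adjacent x y"
    and le: "\<And>z. z \<in> Z \<Longrightarrow> vertex_conductance c z \<le> l"
  shows "dirichlet_eigenvalue c n k \<le> l"
proof -
  interpret symmetric_matrix "lattice_box n" "dirichlet_matrix c"
    by (rule symmetric_dirichlet_matrix)
  have finZ: "finite Z" using Z(1) by (rule finite_subset) simp
  have comb: "(\<Sum>z\<in>Z. fun_scale (b z) (delta z)) = (\<lambda>y. if y \<in> Z then b y else 0)" for b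
    by (rule sum_scale_delta[OF finZ])
  show ?thesis unfolding dirichlet_eigenvalue_def dirichlet_eigenvalues_eq
  proof (rule eiglist_leI[of Z k delta])
    show "k \<le> card (lattice_box n :: (int ^ 'd) set)" using Z card_mono[of "lattice_box n" Z] by simp
    show "delta z \<in> supp" if "z \<in> Z" for z using that Z by (auto simp: supp_def delta_def)
    show "\<forall>z\<in>Z. b z = 0" if "(\<Sum>z\<in>Z. fun_scale (b z) (delta z)) = 0" for b
      using that unfolding comb by (auto simp: fun_eq_iff split: if_splits)
    fix b f assume f: "f = (\<Sum>z\<in>Z. fun_scale (b z) (delta z))"
    have f': "f = (\<lambda>y. if y \<in> Z then b y else 0)" unfolding f comb ..
    have apf: "ap f x = vertex_conductance c x * f x" if "x \<in> Z" for x
    proof -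
      have "ap f x = (\<Sum>y\<in>lattice_box n. dirichlet_matrix c x y * f y)"
        using that Z by (auto simp: ap_def)
      also have "\<dots> = (\<Sum>y\<in>{x}. dirichlet_matrix c x y * f y)"
        using that Z nonadj by (intro sum.mono_neutral_right) (auto simp: f' dirichlet_matrix_def)
      finally show ?thesis by (simp add: dirichlet_matrix_def)
    qed
    have "ip f (ap f) = (\<Sum>x\<in>Z. vertex_conductance c x * (f x)\<^sup>2)"
      unfolding ip_def using Z apf
      by (intro sum.mono_neutral_cong_right) (auto simp: f' power2_eq_square)
    also have "\<dots> \<le> (\<Sum>x\<in>Z. l * (f x)\<^sup>2)"
      using le by (intro sum_mono mult_right_mono) auto
    also have "\<dots> = l * ip f f"
      unfolding ip_def sum_distrib_left using Z
      by (intro sum.mono_neutral_cong_left) (auto simp: f' power2_eq_square)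
    finally show "ip f (ap f) \<le> l * ip f f" .
  qed (use Z finZ in auto)
qed

section \<open>Continuity and measurability of the eigenvalues\<close>

lemma (in symmetric_matrix) eiglist_perturb:
  assumes a': "symmetric_matrix B a'"
    and close: "\<And>x y. x \<in> B \<Longrightarrow> y \<in> B \<Longrightarrow> \<bar>a' x y - a x y\<bar> \<le> \<delta>"
    and k: "1 \<le> k" "k \<le> card B"
  shows "symmetric_matrix.eiglist B a' ! (k - 1) \<le> eiglist ! (k - 1) + \<delta> * card B"
proof -
  interpret A': symmetric_matrix B a' by fact
  obtain T where T: "finite T" "card T = k" "T \<subseteq> supp"
    "\<And>b. (\<Sum>v\<in>T. fun_scale (b v) v) = 0 \<Longrightarrow> \<forall>v\<in>T. b v = 0"
    "\<And>b f. f = (\<Sum>v\<in>T. fun_scale (b v) v) \<Longrightarrow> ip f (ap f) \<le> eiglist ! (k - 1) * ip f f"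
    using eiglist_minimax[OF k] by blast
  have "B \<noteq> {}" using k by auto
  then have "\<delta> \<ge> 0" using close by fastforce
  show ?thesis
  proof (rule A'.eiglist_leI[OF T(1,2) k, of "\<lambda>v. v"])
    show "v \<in> A'.supp" if "v \<in> T" for v
      using T(3) that by auto
    fix b f assume f: "f = (\<Sum>v\<in>T. fun_scale (b v) v)"
    have "ip f (A'.ap f) - ip f (ap f) = (\<Sum>x\<in>B. \<Sum>y\<in>B. (a' x y - a x y) * (f x * f y))"
      by (simp add: ip_def ap_def A'.ap_def sum_distrib_left sum_subtractf[symmetric] algebra_simps)
    \<comment> \<open>Entrywise closeness passes to the quadratic forms through
      \<open>2 * \<bar>u * v\<bar> \<le> u\<^sup>2 + v\<^sup>2\<close>; summing over both indices
      produces the factor \<open>card B\<close>.\<close>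
    also have "\<dots> \<le> (\<Sum>x\<in>B. \<Sum>y\<in>B. \<delta> * (((f x)\<^sup>2 + (f y)\<^sup>2) / 2))"
    proof (intro sum_mono)
      fix x y assume xy: "x \<in> B" "y \<in> B"
      have "(a' x y - a x y) * (f x * f y) \<le> \<bar>a' x y - a x y\<bar> * \<bar>f x * f y\<bar>"
        by (metis abs_ge_self abs_mult)
      also have "\<dots> \<le> \<delta> * (((f x)\<^sup>2 + (f y)\<^sup>2) / 2)"
      proof (intro mult_mono close xy \<open>\<delta> \<ge> 0\<close>)
        have "0 \<le> (\<bar>f x\<bar> - \<bar>f y\<bar>)\<^sup>2" by simp
        then show "\<bar>f x * f y\<bar> \<le> ((f x)\<^sup>2 + (f y)\<^sup>2) / 2"
          by (simp add: power2_diff abs_mult)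
      qed simp
      finally show "(a' x y - a x y) * (f x * f y) \<le> \<delta> * (((f x)\<^sup>2 + (f y)\<^sup>2) / 2)" .
    qed
    also have "\<dots> = \<delta> * card B * ip f f"
    proof -
      have "(\<Sum>x\<in>B. \<Sum>y\<in>B. ((f x)\<^sup>2 + (f y)\<^sup>2) / 2) = card B * ip f f"
        by (simp add: ip_def power2_eq_square sum.distrib sum_divide_distrib[symmetric] sum_distrib_left[symmetric])
      then show ?thesis by (simp only: sum_distrib_left[symmetric] mult.assoc)
    qed
    finally show "A'.ip f (A'.ap f) \<le> (eiglist ! (k - 1) + \<delta> * card B) * A'.ip f f"
      using T(5)[OF f] by (simp add: algebra_simps)
  qed (use T in auto)
qed

lemma dirichlet_matrix_cong:
  assumes "\<And>e. e \<in> edges \<Longrightarrow> c e = c' e"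
  shows "dirichlet_matrix c = dirichlet_matrix c'"
  using assms by (auto simp: dirichlet_matrix_def vertex_conductance_def fun_eq_iff adjacent_commute)

text \<open>Ordered pairs of lattice points form a countable type, unlike sets of lattice points, so
  a random function of pairs is Borel measurable as soon as its coordinates are. The choice operator
  picks one orientation of the edge.\<close>

definition pair_conductance :: "((int ^ 'd::finite) \<times> (int ^ 'd) \<Rightarrow> real) \<Rightarrow> (int ^ 'd) set \<Rightarrow> real" where
  "pair_conductance m e = m (SOME p. e = {fst p, snd p})"

text \<open>The matrix entries are continuous in \<open>m\<close>, and the perturbation bound then
  makes the eigenvalue upper semicontinuous, so that its strict sublevel sets are open.\<close>

lemma borel_measurable_dirichlet_eigenvalue_pair:
  assumes k: "1 \<le> k" "k \<le> card (lattice_box n :: (int ^ 'd::finite) set)"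
  shows "(\<lambda>m :: (int ^ 'd) \<times> (int ^ 'd) \<Rightarrow> real. dirichlet_eigenvalue (pair_conductance m) n k) \<in> borel_measurable borel"
proof (rule borel_measurableI_less)
  fix t :: real
  let ?B = "lattice_box n :: (int ^ 'd) set"
  let ?l = "\<lambda>m :: (int ^ 'd) \<times> (int ^ 'd) \<Rightarrow> real. dirichlet_eigenvalue (pair_conductance m) n k"
  let ?a = "\<lambda>m. dirichlet_matrix (pair_conductance m)"
  have cont: "continuous_on UNIV (\<lambda>m. ?a m x y)" for x y
    unfolding dirichlet_matrix_def vertex_conductance_def pair_conductance_def
    by (cases "x = y"; cases "adjacent y x") (auto intro!: continuous_intros)
  have "open {m. ?l m < t}"
  proof (subst open_subopen, safe)
    fix m0 assume m0: "?l m0 < t"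
    define \<delta> where "\<delta> = (t - ?l m0) / (2 * card ?B)"
    have card: "card ?B \<noteq> 0" using k by linarith
    have \<delta>: "\<delta> > 0" unfolding \<delta>_def using m0 card by (intro divide_pos_pos) auto
    define U where "U = (\<Inter>x\<in>?B. \<Inter>y\<in>?B. {m. \<bar>?a m x y - ?a m0 x y\<bar> < \<delta>})"
    have "open U" unfolding U_def
      by (intro open_INT ballI finite_lattice_box open_Collect_less continuous_intros cont)
    moreover have "m0 \<in> U" using \<delta> by (simp add: U_def)
    moreover have "U \<subseteq> {m. ?l m < t}"
    proof safe
      fix m assume m: "m \<in> U"
      have "?l m \<le> ?l m0 + \<delta> * card ?B"
        unfolding dirichlet_eigenvalue_def dirichlet_eigenvalues_eq
        using m by (intro symmetric_matrix.eiglist_perturb symmetric_dirichlet_matrix k)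
          (auto simp: U_def intro: less_imp_le)
      also have "\<delta> * card ?B = (t - ?l m0) / 2" using card by (simp add: \<delta>_def del: card_0_eq)
      also have "?l m0 + (t - ?l m0) / 2 < t" using m0 by (simp add: field_simps)
      finally show "?l m < t" .
    qed
    ultimately show "\<exists>T. open T \<and> m0 \<in> T \<and> T \<subseteq> {m. ?l m < t}" by blast
  qed
  then show "{m \<in> space borel. ?l m < t} \<in> sets borel" by simp
qed

lemma borel_measurable_dirichlet_eigenvalue:
  fixes w :: "(int ^ 'd::finite) set \<Rightarrow> 'a \<Rightarrow> real"
  assumes w: "\<And>e. e \<in> edges \<Longrightarrow> w e \<in> borel_measurable M"
    and k: "1 \<le> k" "k \<le> card (lattice_box n :: (int ^ 'd) set)"
  shows "(\<lambda>\<omega>. dirichlet_eigenvalue (\<lambda>e. w e \<omega>) n k) \<in> borel_measurable M"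
proof -
  \<comment> \<open>The value 0 off the edges is needed because \<open>w\<close> is measurable only
    on \<open>edges\<close>.\<close>
  define m where "m \<omega> p = (if adjacent (fst p) (snd p) then w {fst p, snd p} \<omega> else 0)" for \<omega> p
  have "(\<lambda>\<omega>. m \<omega> p) \<in> borel_measurable M" for p
    using w by (cases "adjacent (fst p) (snd p)") (simp_all add: m_def)
  then have "m \<in> borel_measurable M"
    by (rule measurable_coordinatewise_then_product)
  from measurable_compose[OF this borel_measurable_dirichlet_eigenvalue_pair[OF k]]
  have "(\<lambda>\<omega>. dirichlet_eigenvalue (pair_conductance (m \<omega>)) n k) \<in> borel_measurable M" .
  moreover have "dirichlet_eigenvalue (pair_conductance (m \<omega>)) n k = dirichlet_eigenvalue (\<lambda>e. w e \<omega>) n k" for \<omega>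
  proof -
    have "pair_conductance (m \<omega>) e = w e \<omega>" if "e \<in> edges" for e
    proof -
      define p where "p = (SOME p. e = {fst p, snd p})"
      have "\<exists>p. e = {fst p, snd p}" using that by (auto simp: edges_def)
      then have e: "e = {fst p, snd p}" unfolding p_def by (rule someI_ex)
      have "pair_conductance (m \<omega>) e = m \<omega> p" by (simp add: pair_conductance_def p_def)
      also have "\<dots> = w {fst p, snd p} \<omega>" using that e by (simp add: m_def)
      finally show ?thesis using e by simp
    qed
    then have "dirichlet_matrix (pair_conductance (m \<omega>)) = dirichlet_matrix (\<lambda>e. w e \<omega>)"
      by (rule dirichlet_matrix_cong)
    then show ?thesis by (simp add: dirichlet_eigenvalue_def dirichlet_eigenvalues_eq)
  qed
  ultimately show ?thesis by simp
qed

section \<open>The energy of functions without mass on traps\<close>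

lemma mem_lattice_box: "x \<in> lattice_box n \<longleftrightarrow> (\<forall>i. \<bar>x $ i\<bar> \<le> int n)"
  by (auto simp: lattice_box_def abs_le_iff minus_le_iff)

lemma adjacent_add_cancel [simp]: "adjacent (a + x) (a + y) \<longleftrightarrow> adjacent x y"
  by (simp add: adjacent_def)

lemma adjacent_iff_diff: "adjacent x y \<longleftrightarrow> adjacent (x - y) 0"
  by (simp add: adjacent_def)

lemma adjacent_0_iff: "adjacent v 0 \<longleftrightarrow> (\<exists>i. v = axis i 1 \<or> v = axis i (- 1))"
proof
  assume v: "adjacent v 0"
  then have "\<exists>i. v $ i \<noteq> 0" by (rule contrapos_pp) (simp add: adjacent_def)
  then obtain i where i: "v $ i \<noteq> 0" by blast
  have "(\<Sum>j\<in>UNIV. \<bar>v $ j\<bar>) = \<bar>v $ i\<bar> + (\<Sum>j\<in>UNIV - {i}. \<bar>v $ j\<bar>)"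
    by (rule sum.remove) auto
  moreover have "(\<Sum>j\<in>UNIV - {i}. \<bar>v $ j\<bar>) \<ge> 0" by (rule sum_nonneg) auto
  moreover have "(\<Sum>j\<in>UNIV. \<bar>v $ j\<bar>) = 1" using v by (simp add: adjacent_def)
  ultimately have "\<bar>v $ i\<bar> = 1" "(\<Sum>j\<in>UNIV - {i}. \<bar>v $ j\<bar>) = 0" using i by linarith+
  then have "\<forall>j\<in>UNIV - {i}. v $ j = 0" by (simp add: sum_nonneg_eq_0_iff)
  then have "v = axis i (v $ i)" by (auto simp: vec_eq_iff axis_def)
  moreover have "v $ i = 1 \<or> v $ i = - 1" using \<open>\<bar>v $ i\<bar> = 1\<close> by linarith
  ultimately show "\<exists>i. v = axis i 1 \<or> v = axis i (- 1)" by metis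
next
  assume "\<exists>i. v = axis i 1 \<or> v = axis i (- 1)"
  then show "adjacent v 0"
    by (auto simp: adjacent_def axis_def if_distrib cong: if_cong)
qed

lemma card_adjacent_0: "card {v :: int ^ 'd::finite. adjacent v 0} = 2 * CARD('d)"
proof -
  have "{v :: int ^ 'd. adjacent v 0} = (\<lambda>i. axis i 1) ` UNIV \<union> (\<lambda>i. axis i (- 1)) ` UNIV"
    by (auto simp: adjacent_0_iff)
  moreover have "inj (\<lambda>i :: 'd. axis i (1 :: int))" "inj (\<lambda>i :: 'd. axis i (- 1 :: int))"
    by (auto simp: inj_on_def axis_eq_axis)
  moreover have "range (\<lambda>i :: 'd. axis i (1 :: int)) \<inter> range (\<lambda>i. axis i (- 1)) = {}"
    by (auto simp: axis_eq_axis)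
  ultimately show ?thesis by (simp add: card_Un_disjoint card_image)
qed

lemma bij_betw_adjacent: "bij_betw (\<lambda>v. v + x) {v. adjacent v 0} {y. adjacent y x}"
  by (rule bij_betwI[where g = "\<lambda>y. y - x"]) (auto simp: adjacent_iff_diff[of _ x])

lemma card_adjacent: "card {y :: int ^ 'd::finite. adjacent y x} = 2 * CARD('d)"
  using bij_betw_same_card[OF bij_betw_adjacent[of x]] by (simp add: card_adjacent_0)

definition star :: "int ^ 'd::finite \<Rightarrow> (int ^ 'd) set set" where
  "star z = (\<lambda>x. {x, z}) ` {x. adjacent x z}"

lemma star_subset_edges: "star z \<subseteq> edges"
  by (auto simp: star_def)

lemma finite_star [simp]: "finite (star z)"
  by (simp add: star_def)

lemma inj_on_star: "inj_on (\<lambda>x. {x, z}) A"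
  by (auto simp: inj_on_def doubleton_eq_iff)

lemma card_star: "card (star z :: (int ^ 'd::finite) set set) = 2 * CARD('d)"
  by (simp add: star_def card_image[OF inj_on_star] card_adjacent)

lemma vertex_conductance_eq_star: "vertex_conductance c z = (\<Sum>e\<in>star z. c e)"
  by (simp add: vertex_conductance_def star_def sum.reindex[OF inj_on_star])

lemma star_disjoint: "y \<noteq> z \<Longrightarrow> \<not> adjacent y z \<Longrightarrow> star z \<inter> star y = {}"
  by (auto simp: star_def doubleton_eq_iff adjacent_commute)

lemma card_star_Un:
  fixes x y :: "int ^ 'd::finite"
  assumes "adjacent x y"
  shows "card (star x \<union> star y) = 4 * CARD('d) - 1"
proof -
  have "star x \<inter> star y = {{x, y}}"
    using assms by (auto simp: star_def doubleton_eq_iff adjacent_commute)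
  then show ?thesis using card_Un_Int[of "star x" "star y"] by (simp add: card_star)
qed

lemma ex_avoiding_family:
  assumes "finite C" "finite I" "card C < card I"
    and disj: "\<And>i j. i \<in> I \<Longrightarrow> j \<in> I \<Longrightarrow> i \<noteq> j \<Longrightarrow> A i \<inter> A j = {}"
  shows "\<exists>i\<in>I. A i \<inter> C = {}"
proof (rule ccontr)
  assume "\<not> ?thesis"
  then have "\<forall>i\<in>I. \<exists>e. e \<in> A i \<inter> C" by blast
  then obtain g where g: "\<And>i. i \<in> I \<Longrightarrow> g i \<in> A i \<inter> C" by metis
  have "inj_on g I"
    using g disj by (intro inj_onI) (metis IntD1 IntI empty_iff)
  then have "card I \<le> card C" using g assms by (intro card_inj_on_le[of g]) auto
  with assms show False by simp
qed

definition pt :: "int ^ 'd \<Rightarrow> int ^ 'd \<Rightarrow> nat \<Rightarrow> int ^ 'd" where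
  "pt p v j = p + int j *s v"

lemma pt_nth [simp]: "pt p v j $ i = p $ i + int j * v $ i"
  by (simp add: pt_def)

lemma pt_0 [simp]: "pt p v 0 = p"
  by (simp add: vec_eq_iff)

lemma adjacent_pt: "adjacent v 0 \<Longrightarrow> adjacent (pt p v j) (pt p v (Suc j))"
proof -
  assume v: "adjacent v 0"
  have "pt p v (Suc j) = pt p v j + v" by (simp add: vec_eq_iff algebra_simps)
  then show ?thesis
    using v adjacent_add_cancel[of "pt p v j" 0 v] by (simp add: adjacent_commute)
qed

lemma unit_multiple:
  assumes "adjacent v 0" "adjacent w 0" "w = k *s v"
  shows "k = 1 \<or> k = - 1"
proof -
  have "(\<Sum>i\<in>UNIV. \<bar>w $ i\<bar>) = \<bar>k\<bar> * (\<Sum>i\<in>UNIV. \<bar>v $ i\<bar>)"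
    by (simp add: assms(3) abs_mult sum_distrib_left)
  then have "\<bar>k\<bar> = 1" using assms(1,2) by (simp add: adjacent_def)
  then show ?thesis by linarith
qed

text \<open>A common edge forces equal or opposite directions and makes \<open>p' - p\<close> an
  integer multiple of \<open>v\<close>. For a common start this is impossible when the directions
  differ. For neighbouring starts the multiple is 1 or -1, and one of the rays would start along the
  edge between them, which \<open>diff\<close> forbids.\<close>

lemma ray_edges_distinct:
  assumes v: "adjacent v 0" "adjacent v' 0"
    and same: "p = p' \<Longrightarrow> v \<noteq> v'"
    and diff: "p \<noteq> p' \<Longrightarrow> adjacent p' p \<and> v \<noteq> p' - p \<and> v' \<noteq> p - p'"
  shows "{pt p v j, pt p v (Suc j)} \<noteq> {pt p' v' j', pt p' v' (Suc j')}"
proof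
  assume eq: "{pt p v j, pt p v (Suc j)} = {pt p' v' j', pt p' v' (Suc j')}"
  have step: "pt p v (Suc j) - pt p v j = v" "pt p' v' (Suc j') - pt p' v' j' = v'"
    by (simp_all add: vec_eq_iff algebra_simps)
  have v0: "v \<noteq> 0" using v by auto
  from eq consider (forward) "pt p v j = pt p' v' j'" "pt p v (Suc j) = pt p' v' (Suc j')"
    | (backward) "pt p v j = pt p' v' (Suc j')" "pt p v (Suc j) = pt p' v' j'"
    by (auto simp: doubleton_eq_iff)
  then show False
  proof cases
    case forward
    then have vv: "v' = v" using step by simp
    then have pp: "p \<noteq> p'" using same by auto
    have "p' - p = (int j - int j') *s v"
      using forward(1) by (auto simp: vec_eq_iff vv algebra_simps)
    moreover have "adjacent (p' - p) 0" using diff[OF pp] adjacent_iff_diff[of p' p] by simp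
    ultimately have "int j - int j' = 1 \<or> int j - int j' = - 1" using unit_multiple[OF v(1)] by blast
    with \<open>p' - p = (int j - int j') *s v\<close> have "v = p' - p \<or> v = p - p'"
      by (elim disjE) (simp_all only: vec_eq_iff, auto simp: algebra_simps)
    then show False using diff[OF pp] vv by auto
  next
    case backward
    have "v' = - v" using step backward by (metis minus_diff_eq)
    then have eq': "p' - p = int (j + j' + 1) *s v"
      using backward(1) by (auto simp: vec_eq_iff algebra_simps)
    moreover have "p \<noteq> p'"
    proof
      assume "p = p'"
      then have "int (j + j' + 1) *s v = 0" using eq' by simp
      moreover obtain i where "v $ i \<noteq> 0" using v0 by (auto simp: vec_eq_iff)
      ultimately have "int (j + j' + 1) = 0" unfolding vec_eq_iff by (simp only: vector_smult_component zero_index mult_eq_0_iff) blast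
      then show False by simp
    qed
    moreover from this have "adjacent (p' - p) 0" "v \<noteq> p' - p"
      using diff adjacent_iff_diff[of p' p] by auto
    ultimately have "int (j + j' + 1) = 1"
      using unit_multiple[OF v(1), of "p' - p" "int (j + j' + 1)"] by linarith
    with eq' have "p' - p = v" by (simp only: vector_smult_lid)
    with \<open>v \<noteq> p' - p\<close> show False by simp
  qed
qed

text \<open>The deterministic estimate in one environment. The threshold \<open>t\<close> defines
  the long-range network and \<open>s\<close> the local connections. The coordinates
  \<open>i1\<close> and \<open>i2\<close> span the planes in which the network is built. Radius
  \<open>6 * n\<close> leaves room for everything: the telescoping lines start within radius
  \<open>2 * n\<close> and make at most \<open>3 * n + 1\<close> steps, and a block reaches less
  than \<open>n\<close> further.\<close>

locale conductance_geometry =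
  fixes c :: "(int ^ 'd::finite) set \<Rightarrow> real" and n K :: nat and s t :: real and i1 i2 :: 'd
    and f :: "int ^ 'd \<Rightarrow> real"
  assumes i12: "i1 \<noteq> i2"
    and nonneg: "\<And>e. e \<in> edges \<Longrightarrow> 0 \<le> c e"
    and s: "0 < s" "s \<le> t"
    and large: "2 * K + 3 \<le> n"
    and few_t: "\<And>x. x \<in> lattice_box (6 * n) \<Longrightarrow>
      card {e \<in> edges. e \<subseteq> (+) x ` lattice_box (2 * K + 2) \<and> c e \<le> t} < K"
    and few_s: "\<And>x. x \<in> lattice_box (6 * n) \<Longrightarrow>
      card {e \<in> edges. e \<subseteq> (+) x ` lattice_box (2 * K + 2) \<and> c e \<le> s} < 4 * CARD('d) - 2"
    and f_outside: "\<And>x. x \<notin> lattice_box n \<Longrightarrow> f x = 0"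
begin

abbreviation nbhd :: "int ^ 'd \<Rightarrow> (int ^ 'd) set" where
  "nbhd x \<equiv> (+) x ` lattice_box (2 * K + 2)"

definition closed_edges :: "real \<Rightarrow> int ^ 'd \<Rightarrow> (int ^ 'd) set set" where
  "closed_edges r x = {e \<in> edges. e \<subseteq> nbhd x \<and> c e \<le> r}"

definition block_energy :: "int ^ 'd \<Rightarrow> real" where
  "block_energy x = (\<Sum>v\<in>lattice_box (2 * K + 2). local_energy c f (x + v))"

text \<open>The bound on the change of \<open>f\<close> across an edge that starts in the block of
  \<open>x\<close> and has conductance above \<open>r\<close>: such an edge contributes at least
  \<open>r\<close> times the squared change to the block energy.\<close>

definition osc :: "int ^ 'd \<Rightarrow> real \<Rightarrow> real" where
  "osc x r = sqrt (block_energy x / r)"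

definition open_segment :: "real \<Rightarrow> int ^ 'd \<Rightarrow> int ^ 'd \<Rightarrow> bool" where
  "open_segment r p v \<longleftrightarrow> (\<forall>j<K. r < c {pt p v j, pt p v (Suc j)})"

lemma mem_nbhd: "y \<in> nbhd x \<longleftrightarrow> (\<forall>i. \<bar>y $ i - x $ i\<bar> \<le> 2 * int K + 2)"
proof
  assume "\<forall>i. \<bar>y $ i - x $ i\<bar> \<le> 2 * int K + 2"
  then have "y - x \<in> lattice_box (2 * K + 2)" by (simp add: mem_lattice_box add.commute)
  then show "y \<in> nbhd x" by (intro image_eqI[of _ _ "y - x"]) auto
qed (auto simp: mem_lattice_box add.commute)

lemma finite_closed_edges: "finite (closed_edges r x)"
  by (rule finite_subset[of _ "Pow (nbhd x)"]) (auto simp: closed_edges_def)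

lemma local_energy_nonneg: "0 \<le> local_energy c f x"
  unfolding local_energy_def
  by (intro sum_nonneg mult_nonneg_nonneg nonneg) (auto simp: adjacent_commute)

lemma block_energy_nonneg: "0 \<le> block_energy x"
  unfolding block_energy_def by (intro sum_nonneg local_energy_nonneg)

lemma osc_nonneg: "0 < r \<Longrightarrow> 0 \<le> osc x r"
  using block_energy_nonneg by (simp add: osc_def)

lemma osc_t_le_s: "osc x t \<le> osc x s"
  unfolding osc_def using block_energy_nonneg s by (intro real_sqrt_le_mono divide_left_mono) auto

lemma edge_oscillation:
  assumes a: "a \<in> nbhd x" and adj: "adjacent a b" and r: "r < c {a, b}" "0 < r"
  shows "\<bar>f a - f b\<bar> \<le> osc x r"
proof -
  have "c {a, b} * (f a - f b)\<^sup>2 \<le> local_energy c f a"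
    unfolding local_energy_def
  proof (rule member_le_sum[of b])
    show "0 \<le> c {a, y} * (f a - f y)\<^sup>2" if "y \<in> {y. adjacent y a} - {b}" for y
      using that by (intro mult_nonneg_nonneg nonneg) (auto simp: adjacent_commute)
  qed (use adj in \<open>auto simp: adjacent_commute\<close>)
  also have "\<dots> \<le> block_energy x"
  proof -
    obtain v where v: "v \<in> lattice_box (2 * K + 2)" "a = x + v" using a by auto
    show ?thesis unfolding block_energy_def v(2)
      using v(1) by (intro member_le_sum[of v "lattice_box (2 * K + 2)" "\<lambda>v. local_energy c f (x + v)"])
        (auto intro: local_energy_nonneg)
  qed
  finally have "c {a, b} * (f a - f b)\<^sup>2 \<le> block_energy x" .
  moreover have "r * (f a - f b)\<^sup>2 \<le> c {a, b} * (f a - f b)\<^sup>2"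
    using r by (intro mult_right_mono) auto
  ultimately have "(f a - f b)\<^sup>2 \<le> block_energy x / r"
    using r by (simp add: field_simps)
  then show ?thesis unfolding osc_def by (rule real_le_rsqrt[of "\<bar>f a - f b\<bar>", simplified])
qed

lemma segment_oscillation:
  assumes v: "adjacent v 0" and r: "0 < r" and op: "open_segment r p v"
    and nb: "\<And>j. j \<le> K \<Longrightarrow> pt p v j \<in> nbhd x"
    and ab: "a \<le> K" "b \<le> K"
  shows "\<bar>f (pt p v a) - f (pt p v b)\<bar> \<le> K * osc x r"
proof -
  have *: "\<bar>f (pt p v a) - f (pt p v (a + k))\<bar> \<le> k * osc x r" if "a + k \<le> K" for a k
    using that
  proof (induction k)
    case (Suc k)
    have "\<bar>f (pt p v (a + k)) - f (pt p v (Suc (a + k)))\<bar> \<le> osc x r"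
      using Suc.prems v r op nb by (intro edge_oscillation adjacent_pt) (auto simp: open_segment_def)
    moreover have "\<bar>f (pt p v a) - f (pt p v (a + k))\<bar> \<le> k * osc x r" using Suc by simp
    ultimately show ?case by (simp add: algebra_simps)
  qed simp
  have "\<bar>f (pt p v a) - f (pt p v b)\<bar> \<le> K * osc x r" if "a \<le> b" "b \<le> K" for a b
  proof -
    have "\<bar>f (pt p v a) - f (pt p v b)\<bar> \<le> (b - a) * osc x r" using *[of a "b - a"] that by simp
    also have "\<dots> \<le> K * osc x r" using that osc_nonneg[OF r] by (intro mult_right_mono) auto
    finally show ?thesis .
  qed
  from this[of a b] this[of b a] show ?thesis using ab by (cases "a \<le> b") (auto simp: abs_minus_commute)
qed

lemma ex_open_segment:
  assumes few: "card (closed_edges r x) < card I" "finite I"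
    and v: "\<And>i. i \<in> I \<Longrightarrow> adjacent (dir i) 0"
    and nb: "\<And>i j. i \<in> I \<Longrightarrow> j \<le> K \<Longrightarrow> pt (base i) (dir i) j \<in> nbhd x"
    and disj: "\<And>i i' j j'. i \<in> I \<Longrightarrow> i' \<in> I \<Longrightarrow> i \<noteq> i' \<Longrightarrow> j < K \<Longrightarrow> j' < K \<Longrightarrow>
      {pt (base i) (dir i) j, pt (base i) (dir i) (Suc j)} \<noteq>
      {pt (base i') (dir i') j', pt (base i') (dir i') (Suc j')}"
  obtains i where "i \<in> I" "open_segment r (base i) (dir i)"
proof -
  define A where "A i = {{pt (base i) (dir i) j, pt (base i) (dir i) (Suc j)} | j. j < K}" for i
  have "\<exists>i\<in>I. A i \<inter> closed_edges r x = {}"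
  proof (rule ex_avoiding_family[OF finite_closed_edges few(2,1)])
    fix i i' assume "i \<in> I" "i' \<in> I" "i \<noteq> i'"
    from disj[OF this] show "A i \<inter> A i' = {}" unfolding A_def by blast
  qed
  then obtain i where i: "i \<in> I" "A i \<inter> closed_edges r x = {}" by blast
  have "open_segment r (base i) (dir i)"
    unfolding open_segment_def
  proof safe
    fix j assume j: "j < K"
    let ?e = "{pt (base i) (dir i) j, pt (base i) (dir i) (Suc j)}"
    have "?e \<in> A i" using j by (auto simp: A_def)
    then have "?e \<notin> closed_edges r x" using i by auto
    moreover have "?e \<in> edges" using adjacent_pt v i by auto
    moreover have "?e \<subseteq> nbhd x" using nb[OF i(1)] j by auto
    ultimately show "r < c ?e" unfolding closed_edges_def by auto
  qed
  with i that show ?thesis by blast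
qed

text \<open>Coordinate \<open>i\<close> is constant along each segment and differs between segments,
  so the segments are edge disjoint. Fewer than \<open>K\<close> edges of the block are at most
  \<open>t\<close>, so they cannot spoil \<open>K\<close> segments.\<close>

lemma ex_open_parallel_segment:
  assumes x: "x \<in> lattice_box (6 * n)" and J: "finite J" "K \<le> card J"
    and v: "adjacent v 0" and u: "u $ i \<noteq> 0" "v $ i = 0"
    and nb: "\<And>a j. a \<in> J \<Longrightarrow> j \<le> K \<Longrightarrow> pt (pt p u a) v j \<in> nbhd x"
  obtains a where "a \<in> J" "open_segment t (pt p u a) v"
proof (rule ex_open_segment[of t x J "\<lambda>_. v" "\<lambda>a. pt p u a"])
  show "card (closed_edges t x) < card J" using few_t[OF x] J by (simp add: closed_edges_def)
  fix a a' j j' :: nat assume "a \<noteq> a'"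
  have "y $ i = p $ i + int a * u $ i" if "y \<in> {pt (pt p u a) v j, pt (pt p u a) v (Suc j)}" for y and a j :: nat
    using that u by auto
  then show "{pt (pt p u a) v j, pt (pt p u a) v (Suc j)} \<noteq> {pt (pt p u a') v j', pt (pt p u a') v (Suc j')}"
    using \<open>a \<noteq> a'\<close> u(1) by (metis add_left_cancel insertI1 mult_cancel_right of_nat_eq_iff)
qed (use assms that in auto)

section \<open>Open crosses in planar squares\<close>

definition e1 :: "int ^ 'd" where "e1 = axis i1 1"
definition e2 :: "int ^ 'd" where "e2 = axis i2 1"

lemma e12 [simp]: "adjacent e1 0" "adjacent e2 0" "e1 $ i1 = 1" "e2 $ i2 = 1" "e1 $ i2 = 0" "e2 $ i1 = 0"
  "\<bar>e1 $ i\<bar> \<le> 1" "\<bar>e2 $ i\<bar> \<le> 1" "0 \<le> e1 $ i" "0 \<le> e2 $ i" "e1 $ i \<le> 1" "e2 $ i \<le> 1" "e1 $ i + e2 $ i \<le> 1"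
  using i12 by (auto simp: e1_def e2_def adjacent_0_iff axis_def)

definition sq :: "int ^ 'd \<Rightarrow> nat \<Rightarrow> nat \<Rightarrow> int ^ 'd" where
  "sq x a b = x + int a *s e1 + int b *s e2"

lemma sq_eq_pt: "sq x a b = pt (pt x e1 a) e2 b" "sq x a b = pt (pt x e2 b) e1 a"
  by (simp_all add: sq_def vec_eq_iff algebra_simps)

abbreviation row_open :: "int ^ 'd \<Rightarrow> nat \<Rightarrow> bool" where
  "row_open x b \<equiv> open_segment t (pt x e2 b) e1"

abbreviation col_open :: "int ^ 'd \<Rightarrow> nat \<Rightarrow> bool" where
  "col_open x a \<equiv> open_segment t (pt x e1 a) e2"

definition cross_col :: "int ^ 'd \<Rightarrow> nat" where "cross_col x = (SOME a. a \<le> K \<and> col_open x a)"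
definition cross_row :: "int ^ 'd \<Rightarrow> nat" where "cross_row x = (SOME b. b \<le> K \<and> row_open x b)"
text \<open>The value of \<open>f\<close> where one chosen open column meets one chosen open row of
  the square with corner \<open>x\<close>. It stands for the value of the network near
  \<open>x\<close>, and different choices differ only by multiples of \<open>osc\<close>.\<close>

definition cross_value :: "int ^ 'd \<Rightarrow> real" where "cross_value x = f (sq x (cross_col x) (cross_row x))"

text \<open>Several nearby squares have to be charged to the block energy of one site
  \<open>x0\<close>. A corner within \<open>K + 2\<close> of \<open>x0\<close> and a side
  \<open>K\<close> keep the square inside the block of radius \<open>2 * K + 2\<close>.\<close>

definition fits :: "int ^ 'd \<Rightarrow> int ^ 'd \<Rightarrow> bool" where
  "fits x x0 \<longleftrightarrow> x0 \<in> lattice_box (6 * n) \<and> (\<forall>i. \<bar>x $ i - x0 $ i\<bar> \<le> int K + 2)"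

lemma sq_in_nbhd:
  assumes "fits x x0" "a \<le> K" "b \<le> K"
  shows "sq x a b \<in> nbhd x0"
  unfolding mem_nbhd
proof
  fix i
  define q where "q = int a * e1 $ i + int b * e2 $ i"
  have "0 \<le> q" by (simp add: q_def)
  have "q \<le> int K * e1 $ i + int K * e2 $ i"
    unfolding q_def using assms by (intro add_mono mult_right_mono) auto
  also have "\<dots> = int K * (e1 $ i + e2 $ i)" by (rule distrib_left[symmetric])
  also have "\<dots> \<le> int K * 1" by (intro mult_left_mono) auto
  finally have "q \<le> int K" by simp
  moreover have "\<bar>x $ i - x0 $ i\<bar> \<le> int K + 2" using assms by (simp add: fits_def)
  moreover have "sq x a b $ i = x $ i + q" by (simp add: sq_def q_def)
  ultimately show "\<bar>sq x a b $ i - x0 $ i\<bar> \<le> 2 * int K + 2"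
    using \<open>0 \<le> q\<close> by linarith
qed

lemma ex_row_open:
  assumes "fits x x0"
  obtains b where "b \<le> K" "row_open x b"
proof (rule ex_open_parallel_segment[of x0 "{..K}" e1 e2 i2 x])
  show "pt (pt x e2 a) e1 j \<in> nbhd x0" if "a \<in> {..K}" "j \<le> K" for a j
    using sq_in_nbhd[OF assms, of j a] that by (simp add: sq_eq_pt(2))
qed (use assms that in \<open>auto simp: fits_def\<close>)

text \<open>Column 0 is left out, so that the column found also belongs to the square shifted by
  \<open>e1\<close>. The remaining \<open>K\<close> columns still outnumber the closed
  edges.\<close>

lemma ex_col_open:
  assumes "fits x x0"
  obtains a where "1 \<le> a" "a \<le> K" "col_open x a"
proof (rule ex_open_parallel_segment[of x0 "{1..K}" e2 e1 i1 x])
  show "pt (pt x e1 a) e2 j \<in> nbhd x0" if "a \<in> {1..K}" "j \<le> K" for a j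
    using sq_in_nbhd[OF assms, of a j] that by (simp add: sq_eq_pt(1))
qed (use assms that in \<open>auto simp: fits_def\<close>)

lemma cross:
  assumes "fits x x0"
  shows "cross_col x \<le> K" "col_open x (cross_col x)" "cross_row x \<le> K" "row_open x (cross_row x)"
proof -
  have "\<exists>a. a \<le> K \<and> col_open x a" using ex_col_open[OF assms] by metis
  from someI_ex[OF this] show "cross_col x \<le> K" "col_open x (cross_col x)"
    by (auto simp: cross_col_def)
  have "\<exists>b. b \<le> K \<and> row_open x b" using ex_row_open[OF assms] by metis
  from someI_ex[OF this] show "cross_row x \<le> K" "row_open x (cross_row x)"
    by (auto simp: cross_row_def)
qed

lemma move_row:
  assumes "fits x x0" "row_open x b" "a \<le> K" "a' \<le> K" "b \<le> K"
  shows "\<bar>f (sq x a b) - f (sq x a' b)\<bar> \<le> K * osc x0 t"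
  unfolding sq_eq_pt(2)
  using assms s sq_in_nbhd[OF assms(1)] by (intro segment_oscillation) (auto simp: sq_eq_pt(2))

lemma move_col:
  assumes "fits x x0" "col_open x a" "b \<le> K" "b' \<le> K" "a \<le> K"
  shows "\<bar>f (sq x a b) - f (sq x a b')\<bar> \<le> K * osc x0 t"
  unfolding sq_eq_pt(1)
  using assms s sq_in_nbhd[OF assms(1)] by (intro segment_oscillation) (auto simp: sq_eq_pt(1))

text \<open>Along the open column to the chosen open row, then along that row to the crossing: two
  segments of at most \<open>K\<close> edges each.\<close>

lemma to_cross_col:
  assumes "fits x x0" "col_open x a" "a \<le> K" "b \<le> K"
  shows "\<bar>f (sq x a b) - cross_value x\<bar> \<le> 2 * K * osc x0 t"
  using move_col[OF assms(1,2,4) cross(3)[OF assms(1)] assms(3)]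
    move_row[OF assms(1) cross(4)[OF assms(1)] assms(3) cross(1)[OF assms(1)] cross(3)[OF assms(1)]]
  unfolding cross_value_def by linarith

lemma to_cross_row:
  assumes "fits x x0" "row_open x b" "a \<le> K" "b \<le> K"
  shows "\<bar>f (sq x a b) - cross_value x\<bar> \<le> 2 * K * osc x0 t"
  using move_row[OF assms(1,2,3) cross(1)[OF assms(1)] assms(4)]
    move_col[OF assms(1) cross(2)[OF assms(1)] assms(4) cross(3)[OF assms(1)] cross(1)[OF assms(1)]]
  unfolding cross_value_def by linarith

text \<open>Neighbouring squares share an open column.\<close>

lemma cross_value_step:
  assumes x: "x \<in> lattice_box (6 * n)"
  shows "\<bar>cross_value x - cross_value (x + e1)\<bar> \<le> 4 * K * osc x t"
proof -
  have fits: "fits x x" "fits (x + e1) x" using x by (auto simp: fits_def intro: order_trans[of _ 1])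
  obtain a where a: "1 \<le> a" "a \<le> K" "col_open x a" using ex_col_open[OF fits(1)] by blast
  \<comment> \<open>Column \<open>a\<close> of the square at \<open>x\<close> is column
    \<open>a - 1\<close> of the square at \<open>x + e1\<close>; here \<open>1 \<le> a\<close>
    matters.\<close>
  have pt: "pt (x + e1) e1 (a - 1) = pt x e1 a"
    using a by (simp add: vec_eq_iff algebra_simps of_nat_diff)
  have "\<bar>f (sq x a 0) - cross_value x\<bar> \<le> 2 * K * osc x t"
    using a by (intro to_cross_col fits) auto
  moreover have "\<bar>f (sq (x + e1) (a - 1) 0) - cross_value (x + e1)\<bar> \<le> 2 * K * osc x t"
    using a pt by (intro to_cross_col fits) auto
  moreover have "f (sq (x + e1) (a - 1) 0) = f (sq x a 0)" by (simp only: sq_eq_pt(1) pt)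
  moreover have "4 * K * osc x t = 2 * (2 * K * osc x t)" by simp
  ultimately show ?thesis by linarith
qed

text \<open>The square extends from its corner only in the positive directions, so its crossing lies
  outside the support of \<open>f\<close> whatever the choice operators return.\<close>

lemma cross_value_outside: "int n < x $ i1 \<Longrightarrow> cross_value x = 0"
  unfolding cross_value_def
  by (rule f_outside) (auto simp: mem_lattice_box sq_def intro!: exI[of _ i1])

text \<open>Each site lies in at most as many blocks as a block has sites, and the local energies
  sum to twice the energy.\<close>

lemma sum_block_energy:
  assumes "X \<subseteq> lattice_box (5 * n)"
  shows "(\<Sum>x\<in>X. block_energy x) \<le> card (lattice_box (2 * K + 2) :: (int ^ 'd) set) * (2 * energy c n f)"
proof -
  have "(\<Sum>x\<in>X. block_energy x) = (\<Sum>v\<in>lattice_box (2 * K + 2). \<Sum>x\<in>X. local_energy c f (x + v))"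
    unfolding block_energy_def by (rule sum.swap)
  also have "\<dots> \<le> (\<Sum>v\<in>(lattice_box (2 * K + 2) :: (int ^ 'd) set). 2 * energy c n f)"
  proof (rule sum_mono)
    fix v :: "int ^ 'd" assume v: "v \<in> lattice_box (2 * K + 2)"
    have "(\<Sum>x\<in>X. local_energy c f (x + v)) = (\<Sum>z\<in>(\<lambda>x. x + v) ` X. local_energy c f z)"
      by (simp add: sum.reindex)
    also have "\<dots> \<le> (\<Sum>z\<in>lattice_box (6 * n). local_energy c f z)"
    proof (rule sum_mono2)
      show "(\<lambda>x. x + v) ` X \<subseteq> lattice_box (6 * n)"
      proof (clarsimp simp: mem_lattice_box)
        fix x i assume "x \<in> X"
        then have "\<bar>x $ i\<bar> \<le> 5 * int n" using assms by (auto simp: mem_lattice_box)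
        moreover have "\<bar>v $ i\<bar> \<le> 2 * int K + 2" using v by (simp add: mem_lattice_box add.commute)
        ultimately show "\<bar>x $ i + v $ i\<bar> \<le> 6 * int n" using large by linarith
      qed
    qed (auto intro: local_energy_nonneg)
    also have "\<dots> = 2 * energy c n f" using large by (intro sum_local_energy f_outside) auto
    finally show "(\<Sum>x\<in>X. local_energy c f (x + v)) \<le> 2 * energy c n f" .
  qed
  finally show ?thesis by simp
qed

lemma energy_nonneg: "0 \<le> energy c n f"
  using sum_local_energy[of n f "Suc n" c] f_outside
    sum_nonneg[of "lattice_box (Suc n)" "local_energy c f"] local_energy_nonneg by simp

text \<open>One-dimensional Poincare inequality along \<open>e1\<close>: \<open>cross_value\<close>
  telescopes to zero in \<open>L\<close> steps, Cauchy-Schwarz costs one factor \<open>L\<close>,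
  and each increment is used by at most \<open>L\<close> starting points, which costs the
  other.\<close>

lemma poincare_cross_value:
  "(\<Sum>x\<in>lattice_box (2 * n). (cross_value x)\<^sup>2) \<le>
     (4 * real n)\<^sup>2 * (16 * (real K)\<^sup>2 / t * (card (lattice_box (2 * K + 2) :: (int ^ 'd) set) * (2 * energy c n f)))"
proof -
  define D where "D x = (cross_value x - cross_value (x + e1))\<^sup>2" for x
  \<comment> \<open>From a coordinate at least \<open>- 2 * n\<close> this many steps lead just
    beyond \<open>n\<close>.\<close>
  define L where "L = 3 * n + 1"
  have t: "t > 0" using s by linarith
  have D_le: "D x \<le> 16 * (real K)\<^sup>2 / t * block_energy x" if "x \<in> lattice_box (5 * n)" for x
  proof -
    have "x \<in> lattice_box (6 * n)" using that lattice_box_mono[of "5 * n" "6 * n"] by auto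
    from power_mono[OF cross_value_step[OF this], of 2]
    have "D x \<le> (4 * K * osc x t)\<^sup>2" by (simp add: D_def)
    also have "\<dots> = 16 * (real K)\<^sup>2 / t * block_energy x"
      using t block_energy_nonneg[of x] by (simp add: osc_def power_mult_distrib)
    finally show ?thesis .
  qed
  have pointwise: "(cross_value x)\<^sup>2 \<le> L * (\<Sum>j<L. D (pt x e1 j))" if x: "x \<in> lattice_box (2 * n)" for x
  proof -
    have "\<bar>x $ i1\<bar> \<le> 2 * int n" using x by (auto simp: mem_lattice_box)
    then have "cross_value (pt x e1 L) = 0"
      by (intro cross_value_outside) (auto simp: L_def)
    moreover have "pt x e1 (Suc j) = pt x e1 j + e1" for j by (simp add: vec_eq_iff algebra_simps)
    moreover have "(\<Sum>j<L. cross_value (pt x e1 j) - cross_value (pt x e1 (Suc j))) = cross_value (pt x e1 0) - cross_value (pt x e1 L)"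
      by (rule sum_lessThan_telescope')
    ultimately have "cross_value x = (\<Sum>j<L. cross_value (pt x e1 j) - cross_value (pt x e1 j + e1))"
      by simp
    also have "\<dots>\<^sup>2 \<le> (\<Sum>j<L. (cross_value (pt x e1 j) - cross_value (pt x e1 j + e1))\<^sup>2) * (\<Sum>j<L. 1\<^sup>2)"
      using Cauchy_Schwarz_ineq_sum[of "\<lambda>j. cross_value (pt x e1 j) - cross_value (pt x e1 j + e1)" "\<lambda>_. 1" "{..<L}"] by simp
    finally show ?thesis by (simp add: D_def mult.commute)
  qed
  have "(\<Sum>x\<in>lattice_box (2 * n). (cross_value x)\<^sup>2) \<le> (\<Sum>x\<in>lattice_box (2 * n). L * (\<Sum>j<L. D (pt x e1 j)))"
    by (rule sum_mono) (rule pointwise)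
  also have "\<dots> = L * (\<Sum>j<L. \<Sum>x\<in>lattice_box (2 * n). D (pt x e1 j))"
    unfolding sum_distrib_left[symmetric] by (subst sum.swap) simp
  also have "\<dots> \<le> L * (\<Sum>j<L. \<Sum>y\<in>lattice_box (5 * n). D y)"
  proof (intro mult_left_mono sum_mono)
    fix j assume j: "j \<in> {..<L}"
    have "(\<Sum>x\<in>lattice_box (2 * n). D (pt x e1 j)) = (\<Sum>y\<in>(\<lambda>x. pt x e1 j) ` lattice_box (2 * n). D y)"
      by (subst sum.reindex) (auto simp: inj_on_def vec_eq_iff)
    also have "\<dots> \<le> (\<Sum>y\<in>lattice_box (5 * n). D y)"
    proof (rule sum_mono2)
      show "(\<lambda>x. pt x e1 j) ` lattice_box (2 * n) \<subseteq> lattice_box (5 * n)"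
      proof (clarsimp simp: mem_lattice_box)
        fix x :: "int ^ 'd" and i assume "\<forall>i. \<bar>x $ i\<bar> \<le> 2 * int n"
        moreover have "\<bar>int j * e1 $ i\<bar> \<le> int j * 1" unfolding abs_mult by (intro mult_mono) auto
        moreover have "int j \<le> 3 * int n" using j by (auto simp: L_def)
        ultimately show "\<bar>x $ i + int j * e1 $ i\<bar> \<le> 5 * int n" by (smt (verit))
      qed
    qed (auto simp: D_def)
    finally show "(\<Sum>x\<in>lattice_box (2 * n). D (pt x e1 j)) \<le> (\<Sum>y\<in>lattice_box (5 * n). D y)" .
  qed simp
  also have "\<dots> = (real L)\<^sup>2 * (\<Sum>y\<in>lattice_box (5 * n). D y)" by (simp add: power2_eq_square)
  also have "\<dots> \<le> (4 * real n)\<^sup>2 * (16 * (real K)\<^sup>2 / t * (card (lattice_box (2 * K + 2) :: (int ^ 'd) set) * (2 * energy c n f)))"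
  proof (intro mult_mono power_mono)
    have "(\<Sum>y\<in>lattice_box (5 * n). D y) \<le> (\<Sum>y\<in>lattice_box (5 * n). 16 * (real K)\<^sup>2 / t * block_energy y)"
      by (intro sum_mono D_le)
    also have "\<dots> \<le> 16 * (real K)\<^sup>2 / t * (card (lattice_box (2 * K + 2) :: (int ^ 'd) set) * (2 * energy c n f))"
      unfolding sum_distrib_left[symmetric] using t
      by (intro mult_left_mono sum_block_energy) auto
    finally show "(\<Sum>y\<in>lattice_box (5 * n). D y) \<le> \<dots>" .
    show "real L \<le> 4 * real n" using large by (simp add: L_def)
  qed (auto simp: D_def intro: sum_nonneg)
  finally show ?thesis by simp
qed

text \<open>The \<open>4 * CARD('d) - 2\<close> straight rays that leave a pair of neighbours without using the edge
  between them are edge disjoint, so one of them is open.\<close>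

lemma ex_open_ray:
  assumes x: "x \<in> lattice_box (6 * n)" and xy: "adjacent x y"
  obtains p v where "p \<in> {x, y}" "adjacent v 0" "open_segment s p v"
proof -
  define U where "U = {v :: int ^ 'd. adjacent v 0}"
  define I where "I = {x} \<times> (U - {y - x}) \<union> {y} \<times> (U - {x - y})"
  have finU: "finite U" by (simp add: U_def)
  have d: "CARD('d) \<ge> 1" using finite_UNIV_card_ge_0[where 'a = 'd] by simp
  have U: "y - x \<in> U" "x - y \<in> U" "x \<noteq> y"
    using xy adjacent_iff_diff[of x y] adjacent_iff_diff[of y x] by (auto simp: U_def adjacent_commute)
  have "card I = card ({x} \<times> (U - {y - x})) + card ({y} \<times> (U - {x - y}))"
    unfolding I_def using U finU by (intro card_Un_disjoint) auto
  also have "\<dots> = 4 * CARD('d) - 2"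
    using U d card_adjacent_0[where 'd = 'd] by (simp add: card_cartesian_product U_def)
  finally have cardI: "card I = 4 * CARD('d) - 2" .
  have near: "\<bar>p $ i - x $ i\<bar> \<le> 1" if "p \<in> {x, y}" for p i
    using that adjacent_component_le[OF xy, of i] by auto
  have "\<exists>i\<in>I. open_segment s (fst i) (snd i)"
  proof (rule ex_open_segment[of s x I snd fst])
    show "card (closed_edges s x) < card I" using few_s[OF x] by (simp add: cardI closed_edges_def)
    show "finite I" using finU by (simp add: I_def)
    show "adjacent (snd i) 0" if "i \<in> I" for i using that by (auto simp: I_def U_def)
    show "pt (fst i) (snd i) j \<in> nbhd x" if i: "i \<in> I" "j \<le> K" for i j
      unfolding mem_nbhd
    proof
      fix l
      have "adjacent (snd i) 0" using i by (auto simp: I_def U_def)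
      from adjacent_component_le[OF this, of l] have "\<bar>snd i $ l\<bar> \<le> 1" by simp
      then have "\<bar>int j * snd i $ l\<bar> \<le> int K * 1" unfolding abs_mult using i by (intro mult_mono) auto
      moreover have "\<bar>fst i $ l - x $ l\<bar> \<le> 1" using i by (intro near) (auto simp: I_def)
      ultimately show "\<bar>pt (fst i) (snd i) j $ l - x $ l\<bar> \<le> 2 * int K + 2"
        unfolding pt_nth by linarith
    qed
    fix i i' :: "(int ^ 'd) \<times> (int ^ 'd)" and j j' :: nat
    assume "i \<in> I" "i' \<in> I" "i \<noteq> i'"
    then show "{pt (fst i) (snd i) j, pt (fst i) (snd i) (Suc j)} \<noteq> {pt (fst i') (snd i') j', pt (fst i') (snd i') (Suc j')}"
      using xy by (intro ray_edges_distinct) (auto simp: I_def U_def adjacent_commute)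
  qed blast
  then obtain i where "i \<in> I" "open_segment s (fst i) (snd i)" by blast
  then show ?thesis using that[of "fst i" "snd i"] by (auto simp: I_def U_def)
qed

text \<open>From the \<open>K + 1\<close> points of a ray run parallel transversal segments, along
  \<open>e1\<close> if the ray is perpendicular to it and along \<open>e2\<close> otherwise. One of
  them is \<open>t\<close>-open, and its starting point lies on an open row or column of the square
  with that corner.\<close>

lemma ray_meets_cross:
  assumes x: "x \<in> lattice_box (6 * n)" and v: "adjacent v 0"
    and p: "\<And>i. \<bar>p $ i - x $ i\<bar> \<le> 1"
  obtains j where "j \<le> K" "\<bar>f (pt p v j) - cross_value (pt p v j)\<bar> \<le> 2 * K * osc x t"
proof -
  have fits: "fits (pt p v j) x" if j: "j \<le> K" for j
    unfolding fits_def
  proof (intro conjI allI x)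
    fix i
    have "\<bar>v $ i\<bar> \<le> 1" using adjacent_component_le[OF v, of i] by simp
    then have "\<bar>int j * v $ i\<bar> \<le> int K * 1" unfolding abs_mult using j by (intro mult_mono) auto
    then show "\<bar>pt p v j $ i - x $ i\<bar> \<le> int K + 2" using p[of i] unfolding pt_nth by linarith
  qed
  have sq0: "sq z 0 0 = z" for z by (simp add: sq_eq_pt)
  show ?thesis
  proof (cases "v $ i1 = 0")
    case True
    obtain i where i: "v $ i \<noteq> 0" using v by (auto simp: adjacent_0_iff axis_def)
    with True have "e1 $ i = 0" by (auto simp: e1_def axis_def)
    have nb: "pt (pt p v a) e1 j \<in> nbhd x" if "a \<in> {..K}" "j \<le> K" for a j
      using sq_in_nbhd[OF fits, of a j 0] that by (simp add: sq_eq_pt(2))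
    obtain a where a: "a \<in> {..K}" "open_segment t (pt p v a) e1"
      by (rule ex_open_parallel_segment[where J = "{..K}", OF x _ _ e12(1) i \<open>e1 $ i = 0\<close> nb]) auto
    then have "\<bar>f (sq (pt p v a) 0 0) - cross_value (pt p v a)\<bar> \<le> 2 * K * osc x t"
      by (intro to_cross_row fits) auto
    then show ?thesis using that[of a] a by (simp add: sq0)
  next
    case False
    have nb: "pt (pt p v a) e2 j \<in> nbhd x" if "a \<in> {..K}" "j \<le> K" for a j
      using sq_in_nbhd[OF fits, of a 0 j] that by (simp add: sq_eq_pt(1))
    obtain a where a: "a \<in> {..K}" "open_segment t (pt p v a) e2"
      by (rule ex_open_parallel_segment[where J = "{..K}", OF x _ _ e12(2) False e12(6) nb]) auto
    then have "\<bar>f (sq (pt p v a) 0 0) - cross_value (pt p v a)\<bar> \<le> 2 * K * osc x t"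
      by (intro to_cross_col fits) auto
    then show ?thesis using that[of a] a by (simp add: sq0)
  qed
qed

text \<open>At most one edge from \<open>x\<close> to the start of an \<open>s\<close>-open ray, at
  most \<open>K\<close> edges along it, and \<open>2 * K\<close> edges to a crossing:
  \<open>3 * K + 1\<close> in total, the last part measured with the better threshold
  \<open>t\<close>.\<close>

lemma site_oscillation:
  assumes x: "x \<in> lattice_box n" and xy: "adjacent x y" "s < c {x, y}"
  obtains u where "u \<in> lattice_box (2 * K + 2)" "\<bar>f x - cross_value (x + u)\<bar> \<le> (3 * K + 1) * osc x s"
proof -
  have x6: "x \<in> lattice_box (6 * n)" using x lattice_box_mono[of n "6 * n"] by auto
  obtain p v where pv: "p \<in> {x, y}" "adjacent v 0" "open_segment s p v"
    using ex_open_ray[OF x6 xy(1)] by blast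
  have p: "\<bar>p $ i - x $ i\<bar> \<le> 1" for i
    using pv(1) adjacent_component_le[OF xy(1), of i] by auto
  obtain j where j: "j \<le> K" "\<bar>f (pt p v j) - cross_value (pt p v j)\<bar> \<le> 2 * K * osc x t"
    using ray_meets_cross[OF x6 pv(2) p] by blast
  have nb: "pt p v j \<in> nbhd x" if j: "j \<le> K" for j
    unfolding mem_nbhd
  proof
    fix i
    have "\<bar>v $ i\<bar> \<le> 1" using adjacent_component_le[OF pv(2), of i] by simp
    then have "\<bar>int j * v $ i\<bar> \<le> int K * 1" unfolding abs_mult using j by (intro mult_mono) auto
    then show "\<bar>pt p v j $ i - x $ i\<bar> \<le> 2 * int K + 2" using p[of i] unfolding pt_nth by linarith
  qed
  have "x \<in> nbhd x" unfolding mem_nbhd by simp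
  then have 1: "\<bar>f x - f p\<bar> \<le> osc x s"
    using pv(1) edge_oscillation[of x x y s] xy s osc_nonneg[of s x] by auto
  have 2: "\<bar>f p - f (pt p v j)\<bar> \<le> K * osc x s"
    using segment_oscillation[OF pv(2) s(1) pv(3) nb, of 0 j] j by simp
  have 3: "2 * K * osc x t \<le> 2 * K * osc x s"
    using osc_t_le_s[of x] by (intro mult_left_mono) auto
  have "\<bar>f x - cross_value (pt p v j)\<bar> \<le> osc x s + K * osc x s + 2 * K * osc x s"
    using 1 2 3 j(2) by linarith
  also have "\<dots> = (3 * K + 1) * osc x s" by (simp add: algebra_simps)
  finally have le: "\<bar>f x - cross_value (pt p v j)\<bar> \<le> (3 * K + 1) * osc x s" .
  obtain u where u: "u \<in> lattice_box (2 * K + 2)" "pt p v j = x + u" using nb[OF j(1)] by auto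
  show ?thesis using that[OF u(1)] le u(2) by simp
qed

text \<open>Split \<open>f x\<close> into its distance from a nearby \<open>cross_value\<close> and
  that value. The first part costs \<open>1 / s\<close> times the local energy, the second the
  Poincare bound with \<open>n\<^sup>2 / t\<close>. The offset \<open>u\<close> depends on
  \<open>x\<close> and is replaced by a sum over all offsets. The constant 1024 is 2 * 16 * 16 * 2
  from the Poincare term.\<close>

lemma sum_connected_sites:
  "(\<Sum>x | x \<in> lattice_box n \<and> (\<exists>y. adjacent x y \<and> s < c {x, y}). (f x)\<^sup>2) \<le>
     1024 * (real K + 1)\<^sup>2 * (real (card (lattice_box (2 * K + 2) :: (int ^ 'd) set)))\<^sup>2 *
     (1 / s + (real n)\<^sup>2 / t) * energy c n f"
proof -
  let ?N = "real (card (lattice_box (2 * K + 2) :: (int ^ 'd) set))"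
  let ?X = "{x \<in> lattice_box n. \<exists>y. adjacent x y \<and> s < c {x, y}}"
  let ?E = "energy c n f"
  have t: "t > 0" using s by linarith
  have N: "?N \<ge> 1" by (simp add: card_lattice_box)
  have box: "x + u \<in> lattice_box (2 * n)" if "x \<in> lattice_box n" "u \<in> lattice_box (2 * K + 2)" for x u
    unfolding mem_lattice_box
  proof
    fix i
    have "\<bar>x $ i\<bar> \<le> int n" "\<bar>u $ i\<bar> \<le> 2 * int K + 2" using that by (auto simp: mem_lattice_box add.commute)
    then show "\<bar>(x + u) $ i\<bar> \<le> int (2 * n)" using large
      unfolding vector_add_component of_nat_mult by linarith
  qed
  have pointwise: "(f x)\<^sup>2 \<le> 2 * (3 * real K + 1)\<^sup>2 / s * block_energy x + 2 * (\<Sum>u\<in>lattice_box (2 * K + 2). (cross_value (x + u))\<^sup>2)"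
    if "x \<in> ?X" for x
  proof -
    from that obtain y where y: "x \<in> lattice_box n" "adjacent x y" "s < c {x, y}" by blast
    obtain u where u: "u \<in> lattice_box (2 * K + 2)" "\<bar>f x - cross_value (x + u)\<bar> \<le> (3 * K + 1) * osc x s"
      using site_oscillation[OF y] by blast
    have "(f x)\<^sup>2 \<le> 2 * (f x - cross_value (x + u))\<^sup>2 + 2 * (cross_value (x + u))\<^sup>2"
      using zero_le_power2[of "f x - 2 * cross_value (x + u)"] by (simp add: power2_eq_square algebra_simps)
    moreover have "(f x - cross_value (x + u))\<^sup>2 \<le> ((3 * K + 1) * osc x s)\<^sup>2"
      using power_mono[OF u(2), of 2] by simp
    moreover have "((3 * K + 1) * osc x s)\<^sup>2 = (3 * real K + 1)\<^sup>2 / s * block_energy x"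
      using s block_energy_nonneg[of x] by (simp add: osc_def power_mult_distrib add.commute)
    moreover have "(cross_value (x + u))\<^sup>2 \<le> (\<Sum>u\<in>lattice_box (2 * K + 2). (cross_value (x + u))\<^sup>2)"
      using u(1) by (intro member_le_sum) auto
    ultimately show ?thesis by simp
  qed
  have X: "?X \<subseteq> lattice_box n" "finite ?X" by auto
  have "(\<Sum>x\<in>?X. (f x)\<^sup>2) \<le> (\<Sum>x\<in>?X. 2 * (3 * real K + 1)\<^sup>2 / s * block_energy x + 2 * (\<Sum>u\<in>lattice_box (2 * K + 2). (cross_value (x + u))\<^sup>2))"
    by (rule sum_mono) (rule pointwise)
  also have "\<dots> = 2 * (3 * real K + 1)\<^sup>2 / s * (\<Sum>x\<in>?X. block_energy x) +
      2 * (\<Sum>u\<in>lattice_box (2 * K + 2). \<Sum>x\<in>?X. (cross_value (x + u))\<^sup>2)"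
    unfolding sum.distrib sum_distrib_left[symmetric]
    by (subst sum.swap[of _ "lattice_box (2 * K + 2)" ?X]) (rule refl)
  also have "\<dots> \<le> 2 * (3 * real K + 1)\<^sup>2 / s * (?N * (2 * ?E)) +
      2 * (\<Sum>u\<in>(lattice_box (2 * K + 2) :: (int ^ 'd) set). \<Sum>x\<in>lattice_box (2 * n). (cross_value x)\<^sup>2)"
  proof (intro add_mono mult_left_mono sum_mono sum_block_energy)
    show "?X \<subseteq> lattice_box (5 * n)" using X lattice_box_mono[of n "5 * n"] by auto
    fix u :: "int ^ 'd" assume u: "u \<in> lattice_box (2 * K + 2)"
    have "(\<Sum>x\<in>?X. (cross_value (x + u))\<^sup>2) = (\<Sum>z\<in>(\<lambda>x. x + u) ` ?X. (cross_value z)\<^sup>2)"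
      by (simp add: sum.reindex)
    also have "\<dots> \<le> (\<Sum>x\<in>lattice_box (2 * n). (cross_value x)\<^sup>2)"
      using box[OF _ u] by (intro sum_mono2) auto
    finally show "(\<Sum>x\<in>?X. (cross_value (x + u))\<^sup>2) \<le> (\<Sum>x\<in>lattice_box (2 * n). (cross_value x)\<^sup>2)" .
  qed (use s in auto)
  also have "\<dots> \<le> 2 * (3 * real K + 1)\<^sup>2 / s * (?N * (2 * ?E)) +
      2 * (?N * ((4 * real n)\<^sup>2 * (16 * (real K)\<^sup>2 / t * (?N * (2 * ?E)))))"
    unfolding sum_constant by (intro add_left_mono mult_left_mono poincare_cross_value) auto
  also have "\<dots> = (4 * (3 * real K + 1)\<^sup>2 * ?N) * (1 / s) * ?E + (1024 * (real K)\<^sup>2 * ?N\<^sup>2) * ((real n)\<^sup>2 / t) * ?E"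
    using s t by (simp add: field_simps power2_eq_square)
  also have "\<dots> \<le> (1024 * (real K + 1)\<^sup>2 * ?N\<^sup>2) * (1 / s) * ?E + (1024 * (real K + 1)\<^sup>2 * ?N\<^sup>2) * ((real n)\<^sup>2 / t) * ?E"
  proof (intro add_mono mult_right_mono)
    have A: "4 * (3 * real K + 1)\<^sup>2 \<le> 1024 * (real K + 1)\<^sup>2" by (simp add: power2_eq_square algebra_simps)
    have B: "?N \<le> ?N\<^sup>2" using N by (simp add: power2_eq_square)
    show "4 * (3 * real K + 1)\<^sup>2 * ?N \<le> 1024 * (real K + 1)\<^sup>2 * ?N\<^sup>2"
      by (rule mult_mono[OF A B]) simp_all
  qed (use s t energy_nonneg in \<open>auto intro!: mult_mono power_mono\<close>)
  finally show ?thesis by (simp add: algebra_simps)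
qed

section \<open>Isolated sites and the sharp energy bound\<close>

definition isolated :: "(int ^ 'd) set" where
  "isolated = {x \<in> lattice_box n. \<forall>y. adjacent x y \<longrightarrow> c {x, y} \<le> s}"

text \<open>Two adjacent isolated sites would put the \<open>4 * CARD('d) - 1\<close> edges of both
  stars below \<open>s\<close> into one block, more than \<open>few_s\<close> allows.\<close>

lemma isolated_not_adjacent:
  assumes x: "x \<in> isolated" and y: "y \<in> isolated"
  shows "\<not> adjacent x y"
proof
  assume xy: "adjacent x y"
  define T where "T = star x \<union> star y"
  have "card T = 4 * CARD('d) - 1" using card_star_Un[OF xy] by (simp add: T_def)
  moreover have "T \<subseteq> closed_edges s x"
  proof
    fix e assume "e \<in> T"
    then obtain a z where az: "a \<in> {x, y}" "adjacent z a" "e = {a, z}" by (auto simp: T_def star_def)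
    have "c {a, z} \<le> s" using x y az by (auto simp: isolated_def adjacent_commute)
    moreover have "{a, z} \<subseteq> nbhd x"
    proof -
      have "\<bar>a $ i - x $ i\<bar> \<le> 2 * int K + 2 \<and> \<bar>z $ i - x $ i\<bar> \<le> 2 * int K + 2" for i
      proof -
        have "\<bar>a $ i - x $ i\<bar> \<le> 1" using az(1) adjacent_component_le[OF xy, of i] by auto
        moreover have "\<bar>z $ i - a $ i\<bar> \<le> 1" using az(2) by (rule adjacent_component_le)
        ultimately show ?thesis by linarith
      qed
      then have "a \<in> nbhd x" "z \<in> nbhd x" unfolding mem_nbhd by auto
      then show ?thesis by blast
    qed
    ultimately show "e \<in> closed_edges s x"
      using az by (simp add: closed_edges_def adjacent_commute)
  qed
  then have "card T \<le> card (closed_edges s x)" by (intro card_mono finite_closed_edges)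
  moreover have "x \<in> lattice_box (6 * n)" using x lattice_box_mono[of n "6 * n"] by (auto simp: isolated_def)
  ultimately show False using few_s[of x] unfolding closed_edges_def[symmetric] by linarith
qed

text \<open>Neighbours of isolated sites are never isolated and lie in the box enlarged by one
  layer, so the sum over edges at \<open>J\<close> can be arranged by the other endpoint.\<close>

lemma isolated_swap:
  fixes g :: "int ^ 'd \<Rightarrow> int ^ 'd \<Rightarrow> real"
  assumes J: "J \<subseteq> isolated"
  shows "(\<Sum>x\<in>J. \<Sum>y | adjacent y x. g x y) = (\<Sum>y\<in>lattice_box (Suc n) - isolated. \<Sum>x | x \<in> J \<and> adjacent y x. g x y)"
proof -
  have fin: "finite J" using J finite_subset[OF _ finite_lattice_box[of n]] by (auto simp: isolated_def)
  have "(\<Sum>x\<in>J. \<Sum>y | adjacent y x. g x y) = (\<Sum>x\<in>J. \<Sum>y | y \<in> lattice_box (Suc n) - isolated \<and> adjacent y x. g x y)"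
  proof (rule sum.cong[OF refl])
    fix x assume "x \<in> J"
    then have x: "x \<in> isolated" "x \<in> lattice_box n" using J by (auto simp: isolated_def)
    have "{y. adjacent y x} = {y. y \<in> lattice_box (Suc n) - isolated \<and> adjacent y x}"
      using adjacent_lattice_box[OF _ x(2)] isolated_not_adjacent[OF x(1)] adjacent_commute[of x] by blast
    then show "(\<Sum>y | adjacent y x. g x y) = (\<Sum>y | y \<in> lattice_box (Suc n) - isolated \<and> adjacent y x. g x y)"
      by simp
  qed
  also have "\<dots> = (\<Sum>y\<in>lattice_box (Suc n) - isolated. \<Sum>x | x \<in> J \<and> adjacent y x. g x y)"
    by (rule sum.swap_restrict[OF fin]) simp
  finally show ?thesis .
qed

text \<open>Every edge at \<open>J\<close> is counted again at its other end, which lies outside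
  \<open>J\<close>, so at most half of the total \<open>2 * energy c n f\<close> sits on
  \<open>J\<close>. The constant one instead of two makes the final lower bound sharp.\<close>

lemma sum_local_energy_isolated:
  assumes J: "J \<subseteq> isolated"
  shows "(\<Sum>x\<in>J. local_energy c f x) \<le> energy c n f"
proof -
  have Jbox: "J \<subseteq> lattice_box (Suc n)" using J lattice_box_mono[of n "Suc n"] by (auto simp: isolated_def)
  have "(\<Sum>x\<in>J. local_energy c f x) = (\<Sum>y\<in>lattice_box (Suc n) - isolated. \<Sum>x | x \<in> J \<and> adjacent y x. c {x, y} * (f x - f y)\<^sup>2)"
    unfolding local_energy_def by (rule isolated_swap[OF J])
  also have "\<dots> \<le> (\<Sum>y\<in>lattice_box (Suc n) - isolated. local_energy c f y)"
    unfolding local_energy_def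
  proof (rule sum_mono)
    fix y :: "int ^ 'd"
    have "(\<Sum>x | x \<in> J \<and> adjacent y x. c {x, y} * (f x - f y)\<^sup>2) = (\<Sum>x | x \<in> J \<and> adjacent y x. c {y, x} * (f y - f x)\<^sup>2)"
      by (intro sum.cong refl) (simp add: insert_commute power2_commute)
    also have "\<dots> \<le> (\<Sum>x | adjacent x y. c {y, x} * (f y - f x)\<^sup>2)"
      by (rule sum_mono2) (auto simp: adjacent_commute intro!: mult_nonneg_nonneg nonneg)
    finally show "(\<Sum>x | x \<in> J \<and> adjacent y x. c {x, y} * (f x - f y)\<^sup>2) \<le> \<dots>" .
  qed
  also have "\<dots> \<le> (\<Sum>y\<in>lattice_box (Suc n) - J. local_energy c f y)"
    using J by (intro sum_mono2) (auto intro: local_energy_nonneg)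
  also have "\<dots> = (\<Sum>y\<in>lattice_box (Suc n). local_energy c f y) - (\<Sum>x\<in>J. local_energy c f x)"
    using Jbox by (subst sum_diff) auto
  also have "(\<Sum>y\<in>lattice_box (Suc n). local_energy c f y) = 2 * energy c n f"
    by (intro sum_local_energy f_outside) auto
  finally show ?thesis by simp
qed

lemma sum_isolated_neighbours:
  assumes J: "J \<subseteq> isolated"
  shows "(\<Sum>x\<in>J. \<Sum>y | adjacent y x. (f y)\<^sup>2) \<le> 2 * CARD('d) * (\<Sum>y\<in>lattice_box n - isolated. (f y)\<^sup>2)"
proof -
  have "(\<Sum>x\<in>J. \<Sum>y | adjacent y x. (f y)\<^sup>2) = (\<Sum>y\<in>lattice_box (Suc n) - isolated. \<Sum>x | x \<in> J \<and> adjacent y x. (f y)\<^sup>2)"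
    by (rule isolated_swap[OF J])
  also have "\<dots> \<le> (\<Sum>y\<in>lattice_box (Suc n) - isolated. 2 * CARD('d) * (f y)\<^sup>2)"
  proof (rule sum_mono)
    fix y :: "int ^ 'd"
    have "card {x. x \<in> J \<and> adjacent y x} \<le> card {x. adjacent x y}"
      by (rule card_mono) (auto simp: adjacent_commute)
    then have "card {x. x \<in> J \<and> adjacent y x} \<le> 2 * CARD('d)" by (simp add: card_adjacent)
    then have "real (card {x. x \<in> J \<and> adjacent y x}) \<le> real (2 * CARD('d))" by (simp only: of_nat_le_iff)
    then show "(\<Sum>x | x \<in> J \<and> adjacent y x. (f y)\<^sup>2) \<le> 2 * CARD('d) * (f y)\<^sup>2"
      unfolding sum_constant by (intro mult_right_mono) auto
  qed
  also have "\<dots> = (\<Sum>y\<in>lattice_box n - isolated. 2 * CARD('d) * (f y)\<^sup>2)"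
    using lattice_box_mono[of n "Suc n"] f_outside by (intro sum.mono_neutral_right) auto
  finally show ?thesis by (simp add: sum_distrib_left)
qed

lemma square_le_weighted:
  fixes a b e :: real
  assumes "0 < e"
  shows "a\<^sup>2 \<le> (1 + e) * (a - b)\<^sup>2 + (1 + 1 / e) * b\<^sup>2"
proof -
  have "0 \<le> (e * (a - b) - b)\<^sup>2 / e" using assms by simp
  also have "\<dots> = (1 + e) * (a - b)\<^sup>2 + (1 + 1 / e) * b\<^sup>2 - a\<^sup>2"
    using assms by (simp add: power2_eq_square field_simps)
  finally show ?thesis by simp
qed

text \<open>Each term of the star is expanded around the neighbour's value with weight
  \<open>e\<close>. Around an isolated \<open>x\<close> the neighbours are connected sites, whose
  squares are already controlled, so a large factor \<open>1 / e\<close> in front of them is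
  harmless.\<close>

lemma vertex_conductance_bound:
  assumes e: "0 < e" and q: "\<And>y. adjacent y x \<Longrightarrow> c {y, x} \<le> q"
  shows "vertex_conductance c x * (f x)\<^sup>2 \<le> (1 + e) * local_energy c f x + (1 + 1 / e) * (q * (\<Sum>y | adjacent y x. (f y)\<^sup>2))"
proof -
  have "vertex_conductance c x * (f x)\<^sup>2 = (\<Sum>y | adjacent y x. c {y, x} * (f x)\<^sup>2)"
    by (simp add: vertex_conductance_def sum_distrib_right)
  also have "\<dots> \<le> (\<Sum>y | adjacent y x. (1 + e) * (c {x, y} * (f x - f y)\<^sup>2) + (1 + 1 / e) * (q * (f y)\<^sup>2))"
  proof (rule sum_mono)
    fix y assume "y \<in> {y. adjacent y x}"
    then have y: "0 \<le> c {y, x}" "c {y, x} \<le> q" using nonneg q by auto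
    have "c {y, x} * (f x)\<^sup>2 \<le> c {y, x} * ((1 + e) * (f x - f y)\<^sup>2 + (1 + 1 / e) * (f y)\<^sup>2)"
      using square_le_weighted[OF e] y by (intro mult_left_mono) auto
    also have "\<dots> = (1 + e) * (c {x, y} * (f x - f y)\<^sup>2) + (1 + 1 / e) * (c {y, x} * (f y)\<^sup>2)"
      by (simp add: insert_commute algebra_simps)
    also have "\<dots> \<le> (1 + e) * (c {x, y} * (f x - f y)\<^sup>2) + (1 + 1 / e) * (q * (f y)\<^sup>2)"
      using y e by (intro add_left_mono mult_left_mono mult_right_mono) auto
    finally show "c {y, x} * (f x)\<^sup>2 \<le> \<dots>" .
  qed
  also have "\<dots> = (1 + e) * local_energy c f x + (1 + 1 / e) * (q * (\<Sum>y | adjacent y x. (f y)\<^sup>2))"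
    by (simp add: local_energy_def sum.distrib sum_distrib_left)
  finally show ?thesis .
qed

lemma conductance_le_vertex:
  assumes "adjacent y x"
  shows "c {y, x} \<le> vertex_conductance c x"
  unfolding vertex_conductance_def
  using assms nonneg by (intro member_le_sum[of y _ "\<lambda>y. c {y, x}"]) auto

text \<open>Three groups of sites: the connected ones cost \<open>W\<close>; isolated ones with
  conductance between \<open>b\<close> and \<open>\<theta>\<close> get the sharp coefficient
  \<open>(1 + e) / b\<close>, with \<open>\<theta>\<close> bounding the edges to their neighbours;
  isolated ones above \<open>\<theta>\<close> are treated with weight one, and their coefficient
  \<open>2 / \<theta>\<close> is small for large \<open>\<theta>\<close>. Sites at most
  \<open>b\<close> drop out because \<open>f\<close> vanishes there.\<close>

lemma sum_squares_le_energy: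
  assumes b: "0 < b" and th: "0 < \<theta>" and e: "0 < e"
    and zero: "\<And>x. x \<in> lattice_box n \<Longrightarrow> vertex_conductance c x \<le> b \<Longrightarrow> f x = 0"
    and W: "W = 1024 * (real K + 1)\<^sup>2 * (real (card (lattice_box (2 * K + 2) :: (int ^ 'd) set)))\<^sup>2 *
      (1 / s + (real n)\<^sup>2 / t)"
  shows "(\<Sum>x\<in>lattice_box n. (f x)\<^sup>2) \<le>
    ((1 + e) / b + 2 / \<theta> + (1 + 4 * CARD('d) + 2 * CARD('d) * ((1 + 1 / e) * \<theta> / b)) * W) * energy c n f"
proof -
  let ?E = "energy c n f"
  define N where "N x = (\<Sum>y | adjacent y x. (f y)\<^sup>2)" for x
  define I1 where "I1 = {x \<in> isolated. b < vertex_conductance c x \<and> vertex_conductance c x \<le> \<theta>}"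
  define I2 where "I2 = {x \<in> isolated. \<theta> < vertex_conductance c x}"
  have N: "0 \<le> N x" for x by (auto simp: N_def intro: sum_nonneg)
  have finI: "finite isolated" by (simp add: isolated_def)
  have conn: "(\<Sum>x\<in>lattice_box n - isolated. (f x)\<^sup>2) \<le> W * ?E"
  proof -
    have "lattice_box n - isolated = {x \<in> lattice_box n. \<exists>y. adjacent x y \<and> s < c {x, y}}"
      by (auto simp: isolated_def not_le)
    then show ?thesis using sum_connected_sites by (simp add: W)
  qed
  have neigh: "(\<Sum>x\<in>J. N x) \<le> 2 * CARD('d) * (W * ?E)" if "J \<subseteq> isolated" for J
    unfolding N_def by (rule order_trans[OF sum_isolated_neighbours[OF that]]) (intro mult_left_mono conn, simp)
  have I1: "(\<Sum>x\<in>I1. (f x)\<^sup>2) \<le> (1 + e) / b * ?E + (1 + 1 / e) * \<theta> / b * (2 * CARD('d) * (W * ?E))"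
  proof -
    have "(\<Sum>x\<in>I1. (f x)\<^sup>2) \<le> (\<Sum>x\<in>I1. (1 + e) / b * local_energy c f x + (1 + 1 / e) * \<theta> / b * N x)"
    proof (rule sum_mono)
      fix x assume "x \<in> I1"
      then have x: "b < vertex_conductance c x" "vertex_conductance c x \<le> \<theta>" by (auto simp: I1_def)
      have "b * (f x)\<^sup>2 \<le> vertex_conductance c x * (f x)\<^sup>2" using x by (intro mult_right_mono) auto
      also have "\<dots> \<le> (1 + e) * local_energy c f x + (1 + 1 / e) * (\<theta> * N x)"
        unfolding N_def using conductance_le_vertex x(2)
        by (intro vertex_conductance_bound[OF e]) (meson order_trans)
      also have "\<dots> = b * ((1 + e) / b * local_energy c f x + (1 + 1 / e) * \<theta> / b * N x)"
        using b by (simp add: distrib_left)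
      finally show "(f x)\<^sup>2 \<le> (1 + e) / b * local_energy c f x + (1 + 1 / e) * \<theta> / b * N x"
        using b by (simp only: mult_le_cancel_left_pos)
    qed
    also have "\<dots> = (1 + e) / b * (\<Sum>x\<in>I1. local_energy c f x) + (1 + 1 / e) * \<theta> / b * (\<Sum>x\<in>I1. N x)"
      by (simp add: sum.distrib sum_distrib_left)
    also have "\<dots> \<le> (1 + e) / b * ?E + (1 + 1 / e) * \<theta> / b * (2 * CARD('d) * (W * ?E))"
      using b e th by (intro add_mono mult_left_mono sum_local_energy_isolated neigh) (auto simp: I1_def)
    finally show ?thesis .
  qed
  have I2: "(\<Sum>x\<in>I2. (f x)\<^sup>2) \<le> 2 / \<theta> * ?E + 2 * (2 * CARD('d) * (W * ?E))"
  proof -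
    have "(\<Sum>x\<in>I2. (f x)\<^sup>2) \<le> (\<Sum>x\<in>I2. 2 / \<theta> * local_energy c f x + 2 * N x)"
    proof (rule sum_mono)
      fix x assume "x \<in> I2"
      then have x: "\<theta> < vertex_conductance c x" by (auto simp: I2_def)
      let ?p = "vertex_conductance c x"
      have "?p * (f x)\<^sup>2 \<le> (1 + 1) * local_energy c f x + (1 + 1 / 1) * (?p * N x)"
        unfolding N_def by (intro vertex_conductance_bound conductance_le_vertex) auto
      then have "(f x)\<^sup>2 \<le> 2 / ?p * local_energy c f x + 2 * N x"
        using x th by (simp add: field_simps)
      also have "2 / ?p * local_energy c f x \<le> 2 / \<theta> * local_energy c f x"
        using x th local_energy_nonneg by (intro mult_right_mono divide_left_mono) auto
      finally show "(f x)\<^sup>2 \<le> 2 / \<theta> * local_energy c f x + 2 * N x" by simp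
    qed
    also have "\<dots> = 2 / \<theta> * (\<Sum>x\<in>I2. local_energy c f x) + 2 * (\<Sum>x\<in>I2. N x)"
      by (simp add: sum.distrib sum_distrib_left)
    also have "\<dots> \<le> 2 / \<theta> * ?E + 2 * (2 * CARD('d) * (W * ?E))"
      using th by (intro add_mono mult_left_mono sum_local_energy_isolated neigh) (auto simp: I2_def)
    finally show ?thesis .
  qed
  have "(\<Sum>x\<in>lattice_box n. (f x)\<^sup>2) = (\<Sum>x\<in>lattice_box n - isolated. (f x)\<^sup>2) + (\<Sum>x\<in>isolated. (f x)\<^sup>2)"
    by (rule sum.subset_diff) (auto simp: isolated_def)
  also have "(\<Sum>x\<in>isolated. (f x)\<^sup>2) = (\<Sum>x\<in>I1 \<union> I2. (f x)\<^sup>2)"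
  proof (rule sum.mono_neutral_right[OF finI])
    show "\<forall>x\<in>isolated - (I1 \<union> I2). (f x)\<^sup>2 = 0"
    proof
      fix x assume "x \<in> isolated - (I1 \<union> I2)"
      then have "x \<in> lattice_box n" "vertex_conductance c x \<le> b"
        by (auto simp: I1_def I2_def isolated_def)
      from zero[OF this] show "(f x)\<^sup>2 = 0" by simp
    qed
  qed (auto simp: I1_def I2_def)
  also have "(\<Sum>x\<in>I1 \<union> I2. (f x)\<^sup>2) = (\<Sum>x\<in>I1. (f x)\<^sup>2) + (\<Sum>x\<in>I2. (f x)\<^sup>2)"
    using finI by (intro sum.union_disjoint) (auto simp: I1_def I2_def)
  finally show ?thesis using conn I1 I2 by (simp add: algebra_simps)
qed

end

section \<open>Small sums of positive random variables with regularly varying law\<close>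

text \<open>The limit is the supremum of the \<open>a N\<close>. Each \<open>a N\<close> is a lower
  bound for the limit inferior, while the upper bounds \<open>a (N + m) * r N\<close> are at most
  the supremum times \<open>r N\<close>, and \<open>r N\<close> tends to 1. No limit of
  \<open>a\<close> itself has to be known.\<close>

lemma squeeze_families:
  fixes g :: "real \<Rightarrow> real" and l u :: "nat \<Rightarrow> real \<Rightarrow> real" and a r :: "nat \<Rightarrow> real"
  assumes F: "\<F> \<noteq> bot"
    and l: "\<And>N. 1 \<le> N \<Longrightarrow> (l N \<longlongrightarrow> a N) \<F>" "\<And>N. 1 \<le> N \<Longrightarrow> \<forall>\<^sub>F t in \<F>. l N t \<le> g t"
    and u: "\<And>N. 1 \<le> N \<Longrightarrow> (u N \<longlongrightarrow> a (N + m) * r N) \<F>" "\<And>N. 1 \<le> N \<Longrightarrow> \<forall>\<^sub>F t in \<F>. g t \<le> u N t"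
    and r: "r \<longlonglongrightarrow> 1" "\<And>N. 0 \<le> r N"
    and pos: "1 \<le> N0" "0 < a N0"
  obtains c where "0 < c" "(g \<longlongrightarrow> c) \<F>"
proof -
  define c where "c = (SUP N\<in>{1..}. a N)"
  have bound: "a N \<le> a (1 + m) * r 1" if "1 \<le> N" for N
  proof (rule tendsto_le[OF F u(1)[of 1] l(1)[OF that]])
    show "\<forall>\<^sub>F t in \<F>. l N t \<le> u 1 t"
      using l(2)[OF that] u(2)[OF order_refl] by eventually_elim auto
  qed auto
  then have bdd: "bdd_above (a ` {1..})" by (auto simp: bdd_above_def)
  have le_c: "a N \<le> c" if "1 \<le> N" for N
    unfolding c_def using that bdd by (intro cSUP_upper) auto
  have "0 < c" using le_c[OF pos(1)] pos(2) by linarith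
  moreover have "(g \<longlongrightarrow> c) \<F>"
  proof (rule order_tendstoI)
    fix y assume "y < c"
    then obtain N where N: "1 \<le> N" "y < a N"
      unfolding c_def using bdd by (subst (asm) less_cSUP_iff) auto
    show "\<forall>\<^sub>F t in \<F>. y < g t"
      using order_tendstoD(1)[OF l(1)[OF N(1)] N(2)] l(2)[OF N(1)] by eventually_elim auto
  next
    fix y assume y: "c < y"
    have "(\<lambda>N. c * r N) \<longlonglongrightarrow> c * 1" by (intro tendsto_intros r)
    then have "\<forall>\<^sub>F N in sequentially. c * r N < y \<and> 1 \<le> N"
      using y by (intro eventually_conj order_tendstoD eventually_ge_at_top) auto
    then obtain N where N: "c * r N < y" "1 \<le> N" by (auto dest: eventually_happens)
    have "a (N + m) * r N \<le> c * r N" using N r le_c by (intro mult_right_mono) auto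
    with N have "a (N + m) * r N < y" by linarith
    from order_tendstoD(2)[OF u(1)[OF N(2)] this] u(2)[OF N(2)]
    show "\<forall>\<^sub>F t in \<F>. g t < y" by eventually_elim auto
  qed
  ultimately show ?thesis by (rule that)
qed

text \<open>Regular variation with \<open>s = 1\<close> says that \<open>F t / F t\<close> tends to
  1. Since a quotient by zero is zero, \<open>F\<close> is nonzero at points arbitrarily close to 0,
  and monotonicity spreads positivity.\<close>

lemma regularly_varying_imp_pos:
  fixes F :: "real \<Rightarrow> real"
  assumes rv: "regularly_varying_at_zero F \<rho>" and mono: "mono F" and nonneg: "\<And>x. 0 \<le> F x" and t: "0 < t"
  shows "0 < F t"
proof -
  have "((\<lambda>t. F (t * 1) / F t) \<longlongrightarrow> 1 powr \<rho>) (at_right 0)"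
    using rv unfolding regularly_varying_def by (metis zero_less_one)
  then have "\<forall>\<^sub>F t in at_right 0. F (t * 1) / F t > 0" by (rule order_tendstoD) simp
  then have "\<forall>\<^sub>F x in at_right 0. F x \<noteq> 0" by eventually_elim auto
  then have "\<forall>\<^sub>F x in at_right 0. F x \<noteq> 0 \<and> x \<in> {0<..<t}"
    by (intro eventually_conj eventually_at_right_real t)
  then obtain x where "F x \<noteq> 0" "0 < x" "x < t" by (auto dest: eventually_happens)
  then show ?thesis using nonneg[of x] monoD[OF mono, of x t] by (simp add: less_le)
qed

text \<open>Near zero one doubling of the argument multiplies \<open>F\<close> by at most
  \<open>2 powr \<rho>\<close>, because \<rho> exceeds the index. Iteration from \<open>a\<close> up
  to \<open>b\<close> gives the power of \<open>b / a\<close>; the extra factor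
  \<open>2 powr \<rho>\<close> pays for the last incomplete doubling.\<close>

lemma potter_bound:
  fixes F :: "real \<Rightarrow> real"
  assumes rv: "regularly_varying_at_zero F \<gamma>" and mono: "mono F" and nonneg: "\<And>x. 0 \<le> F x"
    and \<rho>: "\<gamma> < \<rho>" "0 < \<rho>"
  obtains a0 where "0 < a0" "\<And>a b. 0 < a \<Longrightarrow> a \<le> b \<Longrightarrow> b \<le> a0 \<Longrightarrow> F b \<le> 2 powr \<rho> * (b / a) powr \<rho> * F a"
proof -
  have pos: "0 < F t" if "0 < t" for t by (rule regularly_varying_imp_pos[OF rv mono nonneg that])
  have "((\<lambda>t. F (t * 2) / F t) \<longlongrightarrow> 2 powr \<gamma>) (at_right 0)"
    using rv unfolding regularly_varying_def by simp
  then have "\<forall>\<^sub>F t in at_right 0. F (t * 2) / F t < 2 powr \<rho>"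
    by (rule order_tendstoD) (use \<rho> in simp)
  then obtain a0 where a0: "0 < a0" "\<And>t. 0 < t \<Longrightarrow> t < a0 \<Longrightarrow> F (t * 2) / F t < 2 powr \<rho>"
    by (auto simp: eventually_at_right_field)
  have double: "F (2 * t) \<le> 2 powr \<rho> * F t" if "0 < t" "t < a0" for t
    using a0(2)[OF that] pos[OF that(1)] by (simp add: field_simps less_imp_le)
  have *: "F b \<le> 2 powr \<rho> * (b / a) powr \<rho> * F a" if "0 < a" "a \<le> b" "b < a0" "b \<le> 2 ^ j * a" for a b j
    using that
  proof (induction j arbitrary: a)
    case 0
    then have "b = a" by simp
    moreover have "1 \<le> (2 :: real) powr \<rho>" using \<rho> by (simp add: ge_one_powr_ge_zero)
    ultimately show ?case using 0 pos[of a] by simp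
  next
    case (Suc j)
    show ?case
    proof (cases "b \<le> 2 * a")
      case True
      then have "F b \<le> F (2 * a)" by (rule monoD[OF mono])
      also have "\<dots> \<le> 2 powr \<rho> * F a" using Suc.prems by (intro double) auto
      also have "\<dots> \<le> 2 powr \<rho> * (b / a) powr \<rho> * F a"
        using Suc.prems \<rho> nonneg[of a] by (intro mult_right_mono) (auto intro!: ge_one_powr_ge_zero)
      finally show ?thesis .
    next
      case False
      have "F b \<le> 2 powr \<rho> * (b / (2 * a)) powr \<rho> * F (2 * a)"
        using Suc.prems False by (intro Suc.IH) (auto simp: algebra_simps)
      also have "\<dots> \<le> 2 powr \<rho> * (b / (2 * a)) powr \<rho> * (2 powr \<rho> * F a)"
        using Suc.prems False by (intro mult_left_mono double) auto
      also have "\<dots> = 2 powr \<rho> * ((b / (2 * a)) * 2) powr \<rho> * F a"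
        using Suc.prems by (subst powr_mult) auto
      also have "(b / (2 * a)) * 2 = b / a" by simp
      finally show ?thesis .
    qed
  qed
  show ?thesis
  proof (rule that[of "a0 / 2"])
    fix a b :: real assume ab: "0 < a" "a \<le> b" "b \<le> a0 / 2"
    obtain j where "b / a < 2 ^ j" using real_arch_pow[of 2 "b / a"] by auto
    then have "b \<le> 2 ^ j * a" using ab by (simp add: field_simps)
    with ab a0(1) show "F b \<le> 2 powr \<rho> * (b / a) powr \<rho> * F a" by (intro *) auto
  qed (use a0 in simp)
qed

section \<open>Sums of independent copies\<close>

locale iid_positive = prob_space M for M :: "'a measure" +
  fixes X :: "'i \<Rightarrow> 'a \<Rightarrow> real" and I :: "'i set" and \<mu> :: "real measure"
  assumes indep: "indep_vars (\<lambda>_. borel) X I"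
    and ident: "\<And>i. i \<in> I \<Longrightarrow> distr M borel (X i) = \<mu>"
    and pos: "\<And>i. i \<in> I \<Longrightarrow> AE \<omega> in M. 0 < X i \<omega>"
    and nonempty: "I \<noteq> {}"
begin

definition F :: "real \<Rightarrow> real" where "F = cdf \<mu>"

lemma measurable_X [measurable]: "i \<in> I \<Longrightarrow> X i \<in> borel_measurable M"
  using indep by (auto simp: indep_vars_def)

lemma real_distribution_\<mu>: "real_distribution \<mu>"
  using nonempty ident measurable_X by (metis all_not_in_conv real_distribution_distr)

lemma F_eq: "i \<in> I \<Longrightarrow> F a = prob {\<omega> \<in> space M. X i \<omega> \<le> a}"
proof -
  assume i: "i \<in> I"
  have "cdf (distr M borel (X i)) a = prob {\<omega> \<in> space M. X i \<omega> \<le> a}"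
    unfolding cdf_def using i by (subst measure_distr) (auto intro!: arg_cong[where f = prob])
  then show ?thesis by (simp add: F_def ident[OF i])
qed

lemma F_mono: "mono F"
  unfolding F_def using real_distribution_\<mu>
  by (intro monoI finite_borel_measure.cdf_nondecreasing real_distribution.finite_borel_measure_M)

lemma F_nonneg: "0 \<le> F a"
  using nonempty F_eq by (metis all_not_in_conv measure_nonneg)

lemma F_nonpos: "a \<le> 0 \<Longrightarrow> F a = 0"
proof -
  assume "a \<le> 0"
  obtain i where i: "i \<in> I" using nonempty by blast
  have "AE \<omega> in M. \<not> X i \<omega> \<le> a" using pos[OF i] by eventually_elim (use \<open>a \<le> 0\<close> in auto)
  then have "prob {\<omega> \<in> space M. X i \<omega> \<le> a} = 0"
    using i by (subst prob_eq_0) auto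
  then show ?thesis by (simp add: F_eq[OF i])
qed

lemma prob_rectangle:
  assumes T: "finite T" "T \<subseteq> I" and le: "\<And>i. i \<in> T \<Longrightarrow> l i \<le> u i"
  shows "prob {\<omega> \<in> space M. \<forall>i\<in>T. l i < X i \<omega> \<and> X i \<omega> \<le> u i} = (\<Prod>i\<in>T. F (u i) - F (l i))"
proof (cases "T = {}")
  case False
  have "{\<omega> \<in> space M. \<forall>i\<in>T. l i < X i \<omega> \<and> X i \<omega> \<le> u i} = (\<Inter>i\<in>T. X i -` {l i<..u i} \<inter> space M)"
    using False by auto
  then have "prob {\<omega> \<in> space M. \<forall>i\<in>T. l i < X i \<omega> \<and> X i \<omega> \<le> u i} = (\<Prod>i\<in>T. prob (X i -` {l i<..u i} \<inter> space M))"
    using indep_varsD[OF indep False T] by simp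
  also have "\<dots> = (\<Prod>i\<in>T. F (u i) - F (l i))"
  proof (rule prod.cong[OF refl])
    fix i assume i: "i \<in> T"
    then have iI: "i \<in> I" using T by auto
    have "X i -` {l i<..u i} \<inter> space M = {\<omega> \<in> space M. X i \<omega> \<le> u i} - {\<omega> \<in> space M. X i \<omega> \<le> l i}" by auto
    also have "prob \<dots> = F (u i) - F (l i)"
      unfolding F_eq[OF iI] using iI le[OF i] by (intro finite_measure_Diff) auto
    finally show "prob (X i -` {l i<..u i} \<inter> space M) = F (u i) - F (l i)" .
  qed
  finally show ?thesis .
qed (simp add: prob_space)

lemma prob_all_le:
  assumes T: "finite T" "T \<subseteq> I"
  shows "prob {\<omega> \<in> space M. \<forall>i\<in>T. X i \<omega> \<le> a} = F a ^ card T"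
proof (cases "T = {}")
  case False
  have "{\<omega> \<in> space M. \<forall>i\<in>T. X i \<omega> \<le> a} = (\<Inter>i\<in>T. X i -` {..a} \<inter> space M)"
    using False by auto
  then have "prob {\<omega> \<in> space M. \<forall>i\<in>T. X i \<omega> \<le> a} = (\<Prod>i\<in>T. prob (X i -` {..a} \<inter> space M))"
    using indep_varsD[OF indep False T] by simp
  also have "\<dots> = (\<Prod>i\<in>T. F a)"
  proof (rule prod.cong[OF refl])
    fix i assume "i \<in> T"
    then have i: "i \<in> I" using T by auto
    show "prob (X i -` {..a} \<inter> space M) = F a"
      unfolding F_eq[OF i] by (rule arg_cong[where f = prob]) auto
  qed
  finally show ?thesis by simp
qed (simp add: prob_space)

definition total :: "'i set \<Rightarrow> 'a \<Rightarrow> real" where "total T \<omega> = (\<Sum>i\<in>T. X i \<omega>)"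

lemma measurable_total [measurable]: "T \<subseteq> I \<Longrightarrow> total T \<in> borel_measurable M"
  unfolding total_def[abs_def] by (intro borel_measurable_sum) auto

lemma total_independent:
  assumes "finite T" "T \<subseteq> I" "i \<in> I" "i \<notin> T"
  shows "indep_var borel (X i) borel (total T)"
  unfolding total_def[abs_def] using assms
  by (intro indep_vars_sum indep_vars_subset[OF indep]) auto

lemma total_insert: "finite T \<Longrightarrow> i \<notin> T \<Longrightarrow> total (insert i T) = (\<lambda>\<omega>. X i \<omega> + total T \<omega>)"
  by (auto simp: total_def)

text \<open>The law of a sum is a convolution power and depends only on the number of summands. This
  is why all stars have the law of the star at the origin.\<close>

lemma distr_total:
  assumes "finite T" "T \<subseteq> I"
  shows "distr M borel (total T) = ((\<lambda>\<nu>. convolution \<mu> \<nu>) ^^ card T) (distr M borel (\<lambda>_. 0))"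
  using assms
proof (induction T)
  case empty
  then show ?case by (simp add: total_def[abs_def])
next
  case (insert i T)
  have "distr M borel (total (insert i T)) = convolution (distr M borel (X i)) (distr M borel (total T))"
    unfolding total_insert[OF insert(1,2)] using insert
    by (intro sum_indep_random_variable total_independent) auto
  then show ?case using insert by (simp add: ident)
qed

lemma cdf_total_eq: "T \<subseteq> I \<Longrightarrow> cdf (distr M borel (total T)) a = prob {\<omega> \<in> space M. total T \<omega> \<le> a}"
  unfolding cdf_def by (subst measure_distr) (auto intro!: arg_cong[where f = prob])

lemma prob_total_cong:
  assumes "finite T" "T \<subseteq> I" "finite T'" "T' \<subseteq> I" "card T = card T'"
  shows "prob {\<omega> \<in> space M. total T \<omega> \<le> a} = prob {\<omega> \<in> space M. total T' \<omega> \<le> a}"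
  using assms by (simp add: cdf_total_eq[symmetric] distr_total)

text \<open>By Fubini, with all summands but one fixed, the remaining one has to hit a single point,
  which continuity of \<open>F\<close> makes a null event.\<close>

lemma prob_total_point:
  assumes cont: "continuous_on UNIV F" and T: "finite T" "T \<subseteq> I" "T \<noteq> {}"
  shows "prob {\<omega> \<in> space M. total T \<omega> = a} = 0"
proof -
  obtain i where i: "i \<in> T" using T by blast
  define S where "S = T - {i}"
  have S: "finite S" "S \<subseteq> I" "i \<in> I" "i \<notin> S" "T = insert i S" using T i by (auto simp: S_def)
  interpret \<mu>: real_distribution \<mu> by (rule real_distribution_\<mu>)
  have atom: "emeasure \<mu> {x} = 0" for x
  proof -
    have "isCont (cdf \<mu>) x" using cont by (simp add: F_def continuous_on_eq_continuous_at)
    then show ?thesis by (simp add: \<mu>.isCont_cdf \<mu>.emeasure_eq_measure)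
  qed
  let ?Y = "total S" let ?N = "distr M borel (total S)"
  interpret Y: prob_space ?N using S by (intro prob_space_distr) auto
  interpret pair_sigma_finite \<mu> ?N ..
  have ind: "distr M borel (X i) \<Otimes>\<^sub>M ?N = distr M (borel \<Otimes>\<^sub>M borel) (\<lambda>\<omega>. (X i \<omega>, ?Y \<omega>))"
    using total_independent[OF S(1-4)] by (simp add: indep_var_distribution_eq)
  define A where "A = {p :: real \<times> real. fst p + snd p = a}"
  have A: "A \<in> sets (borel \<Otimes>\<^sub>M borel)"
  proof -
    have "{p \<in> space (borel \<Otimes>\<^sub>M borel). fst p + snd p = a} \<in> sets (borel \<Otimes>\<^sub>M (borel :: real measure))"
      by measurable
    then show ?thesis by (simp add: A_def space_pair_measure)
  qed
  have "emeasure M {\<omega> \<in> space M. total T \<omega> = a} = emeasure (distr M (borel \<Otimes>\<^sub>M borel) (\<lambda>\<omega>. (X i \<omega>, ?Y \<omega>))) A"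
    using S A by (subst emeasure_distr) (auto simp: A_def total_insert intro!: arg_cong[where f = "emeasure M"])
  also have "\<dots> = emeasure (\<mu> \<Otimes>\<^sub>M ?N) A" unfolding ind[symmetric] using S by (simp add: ident)
  also have "\<dots> = (\<integral>\<^sup>+y. emeasure \<mu> ((\<lambda>x. (x, y)) -` A) \<partial>?N)"
  proof (rule emeasure_pair_measure_alt2)
    have "sets (\<mu> \<Otimes>\<^sub>M ?N) = sets (borel \<Otimes>\<^sub>M borel)" by (intro sets_pair_measure_cong) auto
    with A show "A \<in> sets (\<mu> \<Otimes>\<^sub>M ?N)" by simp
  qed
  also have "\<dots> = (\<integral>\<^sup>+y. 0 \<partial>?N)"
  proof (rule nn_integral_cong)
    fix y
    have "(\<lambda>x. (x, y)) -` A = {a - y}" by (auto simp: A_def)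
    then show "emeasure \<mu> ((\<lambda>x. (x, y)) -` A) = 0" by (simp add: atom)
  qed
  finally show ?thesis by (simp add: measure_def)
qed

lemma continuous_cdf_total:
  assumes cont: "continuous_on UNIV F" and T: "finite T" "T \<subseteq> I" "T \<noteq> {}"
  shows "continuous_on UNIV (cdf (distr M borel (total T)))"
proof -
  interpret N: real_distribution "distr M borel (total T)"
    using T by (intro real_distribution_distr) auto
  have "measure (distr M borel (total T)) {a} = 0" for a
    using prob_total_point[OF assms, of a] T by (subst measure_distr) (auto simp: vimage_def Int_def conj_commute)
  then show ?thesis by (simp add: continuous_on_eq_continuous_at N.isCont_cdf)
qed

text \<open>A point of the positive orthant is discretised to the corner \<open>j\<close> of its cell in the grid of
  mesh \<open>\<delta>\<close>.\<close>

definition cells :: "'i set \<Rightarrow> nat \<Rightarrow> ('i \<Rightarrow> nat) set" where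
  "cells T N = {j \<in> PiE T (\<lambda>_. {1..N}). (\<Sum>i\<in>T. j i) \<le> N}"

definition cell_sum :: "'i set \<Rightarrow> nat \<Rightarrow> real \<Rightarrow> real" where
  "cell_sum T N \<delta> = (\<Sum>j\<in>cells T N. \<Prod>i\<in>T. F (real (j i) * \<delta>) - F ((real (j i) - 1) * \<delta>))"

lemma finite_cells: "finite T \<Longrightarrow> finite (cells T N)"
  unfolding cells_def by (rule finite_subset[of _ "PiE T (\<lambda>_. {1..N})"]) (auto intro: finite_PiE)

definition cell_event :: "'i set \<Rightarrow> real \<Rightarrow> ('i \<Rightarrow> nat) \<Rightarrow> 'a set" where
  "cell_event T \<delta> j = {\<omega> \<in> space M. \<forall>i\<in>T. (real (j i) - 1) * \<delta> < X i \<omega> \<and> X i \<omega> \<le> real (j i) * \<delta>}"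

lemma cell_event_sets: "finite T \<Longrightarrow> T \<subseteq> I \<Longrightarrow> cell_event T \<delta> j \<in> sets M"
  unfolding cell_event_def by measurable auto

lemma cell_event_unique:
  assumes "0 < \<delta>" "\<omega> \<in> cell_event T \<delta> j" "\<omega> \<in> cell_event T \<delta> j'" "i \<in> T"
  shows "j i = j' i"
proof -
  have "(real (j i) - 1) * \<delta> < real (j' i) * \<delta>" "(real (j' i) - 1) * \<delta> < real (j i) * \<delta>"
    using assms unfolding cell_event_def by (blast intro: less_le_trans)+
  then have "real (j i) - 1 < real (j' i)" "real (j' i) - 1 < real (j i)" using assms(1) by simp_all
  then show ?thesis by linarith
qed

lemma prob_cells:
  assumes T: "finite T" "T \<subseteq> I" and \<delta>: "0 < \<delta>"
  shows "prob (\<Union>j\<in>cells T N. cell_event T \<delta> j) = cell_sum T N \<delta>"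
proof -
  have "prob (\<Union>j\<in>cells T N. cell_event T \<delta> j) = (\<Sum>j\<in>cells T N. prob (cell_event T \<delta> j))"
  proof (rule finite_measure_finite_Union[OF finite_cells[OF T(1)]])
    show "(\<lambda>j. cell_event T \<delta> j) ` cells T N \<subseteq> events" using cell_event_sets[OF T] by auto
    show "disjoint_family_on (\<lambda>j. cell_event T \<delta> j) (cells T N)"
      unfolding disjoint_family_on_def
    proof (intro ballI impI)
      fix j j' assume j: "j \<in> cells T N" "j' \<in> cells T N" "j \<noteq> j'"
      show "cell_event T \<delta> j \<inter> cell_event T \<delta> j' = {}"
      proof (rule ccontr)
        assume "cell_event T \<delta> j \<inter> cell_event T \<delta> j' \<noteq> {}"
        then obtain \<omega> where "\<omega> \<in> cell_event T \<delta> j" "\<omega> \<in> cell_event T \<delta> j'" by blast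
        from cell_event_unique[OF \<delta> this] have "j i = j' i" if "i \<in> T" for i using that by blast
        then have "j = j'" using j by (intro PiE_ext[of j T "\<lambda>_. {1..N}" j']) (auto simp: cells_def)
        with j show False by simp
      qed
    qed
  qed
  also have "\<dots> = cell_sum T N \<delta>"
    unfolding cell_sum_def cell_event_def using T \<delta>
    by (intro sum.cong refl prob_rectangle) auto
  finally show ?thesis .
qed

lemma cell_sum_le:
  assumes T: "finite T" "T \<subseteq> I" and \<delta>: "0 < \<delta>"
  shows "cell_sum T N \<delta> \<le> prob {\<omega> \<in> space M. total T \<omega> \<le> N * \<delta>}"
  unfolding prob_cells[OF assms, symmetric]
proof (rule finite_measure_mono)
  show "(\<Union>j\<in>cells T N. cell_event T \<delta> j) \<subseteq> {\<omega> \<in> space M. total T \<omega> \<le> N * \<delta>}"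
  proof clarify
    fix \<omega> j assume j: "j \<in> cells T N" "\<omega> \<in> cell_event T \<delta> j"
    have "total T \<omega> \<le> (\<Sum>i\<in>T. real (j i) * \<delta>)"
      unfolding total_def using j(2) by (intro sum_mono) (auto simp: cell_event_def)
    also have "\<dots> = real (\<Sum>i\<in>T. j i) * \<delta>" by (simp add: sum_distrib_right)
    also have "\<dots> \<le> N * \<delta>" using j(1) \<delta> by (intro mult_right_mono) (auto simp: cells_def simp del: of_nat_sum)
    finally show "\<omega> \<in> space M \<and> total T \<omega> \<le> N * \<delta>" using j(2) by (simp add: cell_event_def)
  qed
qed (use T in measurable)

text \<open>Rounding up to the corner raises each of the \<open>card T\<close> coordinates by less
  than one mesh, so the corner sum is at most \<open>N + card T\<close>. Almost sure positivity
  makes every corner coordinate at least 1.\<close>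

lemma le_cell_sum:
  assumes T: "finite T" "T \<subseteq> I" and \<delta>: "0 < \<delta>"
  shows "prob {\<omega> \<in> space M. total T \<omega> \<le> N * \<delta>} \<le> cell_sum T (N + card T) \<delta>"
  unfolding prob_cells[OF assms, symmetric]
proof (rule finite_measure_mono_AE)
  have "AE \<omega> in M. \<forall>i\<in>T. 0 < X i \<omega>"
    using T pos by (intro AE_finite_allI) auto
  then show "AE \<omega> in M. \<omega> \<in> {\<omega> \<in> space M. total T \<omega> \<le> N * \<delta>} \<longrightarrow> \<omega> \<in> (\<Union>j\<in>cells T (N + card T). cell_event T \<delta> j)"
  proof eventually_elim
    case (elim \<omega>)
    show ?case
    proof
      assume \<omega>: "\<omega> \<in> {\<omega> \<in> space M. total T \<omega> \<le> N * \<delta>}"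
      define j where "j = restrict (\<lambda>i. nat \<lceil>X i \<omega> / \<delta>\<rceil>) T"
      have ji: "1 \<le> j i" "(real (j i) - 1) * \<delta> < X i \<omega>" "X i \<omega> \<le> real (j i) * \<delta>" if "i \<in> T" for i
      proof -
        have p: "0 < X i \<omega> / \<delta>" using elim that \<delta> by simp
        then have eq: "real (j i) = of_int \<lceil>X i \<omega> / \<delta>\<rceil>" using that by (simp add: j_def)
        have "0 < real (j i)" unfolding eq using p by simp
        then show "1 \<le> j i" by simp
        have "real (j i) - 1 < X i \<omega> / \<delta>" "X i \<omega> / \<delta> \<le> real (j i)"
          unfolding eq by linarith+
        then show "(real (j i) - 1) * \<delta> < X i \<omega>" "X i \<omega> \<le> real (j i) * \<delta>"
          using \<delta> by (simp_all add: field_simps)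
      qed
      have "(\<Sum>i\<in>T. (real (j i) - 1) * \<delta>) \<le> total T \<omega>"
        unfolding total_def using ji(2) by (intro sum_mono) (auto intro: less_imp_le)
      also have "\<dots> \<le> N * \<delta>" using \<omega> by simp
      finally have "(real (\<Sum>i\<in>T. j i) - card T) * \<delta> \<le> N * \<delta>"
        by (simp add: sum_distrib_right[symmetric] sum_subtractf)
      then have "real (\<Sum>i\<in>T. j i) \<le> real (N + card T)" using \<delta> by (simp del: of_nat_sum)
      then have sum: "(\<Sum>i\<in>T. j i) \<le> N + card T" by (simp only: of_nat_le_iff)
      have "j i \<le> N + card T" if "i \<in> T" for i
        using member_le_sum[of i T j] that T(1) sum by auto
      then have "j \<in> cells T (N + card T)"
        using ji(1) sum by (auto simp: cells_def j_def)
      moreover have "\<omega> \<in> cell_event T \<delta> j" using \<omega> ji by (auto simp: cell_event_def)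
      ultimately show "\<omega> \<in> (\<Union>j\<in>cells T (N + card T). cell_event T \<delta> j)" by blast
    qed
  qed
  show "(\<Union>j\<in>cells T (N + card T). cell_event T \<delta> j) \<in> events"
    using finite_cells T cell_event_sets[OF T] by (intro sets.finite_UN) auto
qed

end

locale iid_regularly_varying = iid_positive M X I \<mu>
  for M :: "'a measure" and X :: "'i \<Rightarrow> 'a \<Rightarrow> real" and I \<mu> +
  fixes \<gamma> :: real
  assumes \<gamma>: "0 < \<gamma>" and rv: "regularly_varying_at_zero F \<gamma>"
begin

lemma F_pos: "0 < a \<Longrightarrow> 0 < F a"
  using regularly_varying_imp_pos[OF rv F_mono F_nonneg] .

definition cell_limit :: "'i set \<Rightarrow> nat \<Rightarrow> real" where
  "cell_limit T N = (\<Sum>j\<in>cells T N. \<Prod>i\<in>T. real (j i) powr \<gamma> - (real (j i) - 1) powr \<gamma>)"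

lemma F_ratio_tendsto: "0 \<le> q \<Longrightarrow> ((\<lambda>t. F (q * t) / F t) \<longlongrightarrow> q powr \<gamma>) (at_right 0)"
  using rv F_nonpos[of 0] \<gamma> by (cases "q = 0") (auto simp: regularly_varying_def mult.commute[of q])

lemma cell_sum_tendsto:
  assumes T: "finite T" "T \<subseteq> I" and q: "0 < q"
  shows "((\<lambda>t. cell_sum T N (q * t) / F t ^ card T) \<longlongrightarrow> q powr (\<gamma> * card T) * cell_limit T N) (at_right 0)"
proof -
  have "((\<lambda>t. \<Sum>j\<in>cells T N. \<Prod>i\<in>T. F (real (j i) * q * t) / F t - F ((real (j i) - 1) * q * t) / F t) \<longlongrightarrow>
      (\<Sum>j\<in>cells T N. \<Prod>i\<in>T. (real (j i) * q) powr \<gamma> - ((real (j i) - 1) * q) powr \<gamma>)) (at_right 0)"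
    using q by (intro tendsto_sum tendsto_prod tendsto_diff F_ratio_tendsto) (auto simp: cells_def PiE_def Pi_def)
  moreover have "cell_sum T N (q * t) / F t ^ card T =
      (\<Sum>j\<in>cells T N. \<Prod>i\<in>T. F (real (j i) * q * t) / F t - F ((real (j i) - 1) * q * t) / F t)" for t
    by (simp add: cell_sum_def sum_divide_distrib prod_dividef[symmetric] diff_divide_distrib[symmetric] prod_constant[symmetric] mult.assoc
        del: prod_constant)
  moreover have "(\<Sum>j\<in>cells T N. \<Prod>i\<in>T. (real (j i) * q) powr \<gamma> - ((real (j i) - 1) * q) powr \<gamma>) =
      q powr (\<gamma> * card T) * cell_limit T N"
    unfolding cell_limit_def sum_distrib_left
  proof (rule sum.cong[OF refl])
    fix j assume j: "j \<in> cells T N"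
    have "(\<Prod>i\<in>T. (real (j i) * q) powr \<gamma> - ((real (j i) - 1) * q) powr \<gamma>) =
        (\<Prod>i\<in>T. q powr \<gamma> * (real (j i) powr \<gamma> - (real (j i) - 1) powr \<gamma>))"
    proof (rule prod.cong[OF refl])
      fix i assume "i \<in> T"
      then have "1 \<le> j i" using j by (auto simp: cells_def)
      then show "(real (j i) * q) powr \<gamma> - ((real (j i) - 1) * q) powr \<gamma> = q powr \<gamma> * (real (j i) powr \<gamma> - (real (j i) - 1) powr \<gamma>)"
        by (simp only: powr_mult) (simp only: right_diff_distrib mult.commute)
    qed
    also have "\<dots> = q powr (\<gamma> * card T) * (\<Prod>i\<in>T. real (j i) powr \<gamma> - (real (j i) - 1) powr \<gamma>)"
      using q by (simp add: prod.distrib powr_powr[symmetric] powr_realpow)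
    finally show "(\<Prod>i\<in>T. (real (j i) * q) powr \<gamma> - ((real (j i) - 1) * q) powr \<gamma>) = \<dots>" .
  qed
  ultimately show ?thesis by simp
qed

lemma cell_limit_pos:
  assumes T: "finite T" "T \<noteq> {}"
  shows "0 < cell_limit T (card T)"
  unfolding cell_limit_def
proof (rule sum_pos2[OF finite_cells[OF T(1)]])
  show "restrict (\<lambda>_. 1) T \<in> cells T (card T)" using T by (auto simp: cells_def Suc_le_eq card_gt_0_iff)
  show "0 < (\<Prod>i\<in>T. real (restrict (\<lambda>_. 1) T i) powr \<gamma> - (real (restrict (\<lambda>_. 1) T i) - 1) powr \<gamma>)"
    using \<gamma> by (intro prod_pos) auto
  show "0 \<le> (\<Prod>i\<in>T. real (j i) powr \<gamma> - (real (j i) - 1) powr \<gamma>)" if "j \<in> cells T (card T)" for j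
    using that \<gamma> by (intro prod_nonneg) (auto simp: cells_def PiE_def Pi_def intro!: powr_mono2)
qed

text \<open>With mesh \<open>t / N\<close> the event is enclosed between the cell unions for
  \<open>N\<close> and \<open>N + card T\<close>. Regular variation gives the limit of each finite
  cell sum, and the two bounds differ by a change of mesh of ratio \<open>1 + card T / N\<close>.
  The squeeze yields a constant \<open>c\<close> without evaluating it.\<close>

lemma total_asymptotics:
  assumes T: "finite T" "T \<subseteq> I" "T \<noteq> {}"
  obtains c where "0 < c" "((\<lambda>t. prob {\<omega> \<in> space M. total T \<omega> \<le> t} / F t ^ card T) \<longlongrightarrow> c) (at_right 0)"
proof -
  let ?m = "card T"
  let ?H = "\<lambda>t. prob {\<omega> \<in> space M. total T \<omega> \<le> t}"
  have m: "1 \<le> ?m" using T by (simp add: Suc_le_eq card_gt_0_iff)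
  have ev: "\<forall>\<^sub>F t :: real in at_right 0. 0 < t" by (simp add: eventually_at_right_less)
  show ?thesis
  proof (rule squeeze_families[where
        l = "\<lambda>N t. cell_sum T N (1 / real N * t) / F t ^ ?m" and
        u = "\<lambda>N t. cell_sum T (N + ?m) (1 / real N * t) / F t ^ ?m" and
        a = "\<lambda>N. (1 / real N) powr (\<gamma> * ?m) * cell_limit T N" and
        r = "\<lambda>N. (1 + ?m / real N) powr (\<gamma> * ?m)" and m = ?m and
        g = "\<lambda>t. ?H t / F t ^ ?m" and \<F> = "at_right 0" and ?N0.0 = ?m])
    show "((\<lambda>t. cell_sum T N (1 / real N * t) / F t ^ ?m) \<longlongrightarrow> (1 / real N) powr (\<gamma> * ?m) * cell_limit T N) (at_right 0)"
      if "1 \<le> N" for N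
      using that by (intro cell_sum_tendsto T) auto
    show "((\<lambda>t. cell_sum T (N + ?m) (1 / real N * t) / F t ^ ?m) \<longlongrightarrow>
        (1 / real (N + ?m)) powr (\<gamma> * ?m) * cell_limit T (N + ?m) * (1 + ?m / real N) powr (\<gamma> * ?m)) (at_right 0)"
      if "1 \<le> N" for N
    proof -
      have "1 / real N = 1 / real (N + ?m) * (1 + ?m / real N)" using that by (simp add: field_simps)
      then have "(1 / real N) powr (\<gamma> * ?m) = (1 / real (N + ?m)) powr (\<gamma> * ?m) * (1 + ?m / real N) powr (\<gamma> * ?m)"
        by (metis powr_mult)
      moreover have "((\<lambda>t. cell_sum T (N + ?m) (1 / real N * t) / F t ^ ?m) \<longlongrightarrow>
        (1 / real N) powr (\<gamma> * ?m) * cell_limit T (N + ?m)) (at_right 0)"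
        using that by (intro cell_sum_tendsto T) auto
      ultimately show ?thesis by (simp add: mult_ac)
    qed
    show "\<forall>\<^sub>F t in at_right 0. cell_sum T N (1 / real N * t) / F t ^ ?m \<le> ?H t / F t ^ ?m" if "1 \<le> N" for N
      using ev
    proof eventually_elim
      case (elim t)
      then show ?case
        using cell_sum_le[OF T(1,2), of "1 / real N * t" N] that F_pos[of t]
        by (intro divide_right_mono) auto
    qed
    show "\<forall>\<^sub>F t in at_right 0. ?H t / F t ^ ?m \<le> cell_sum T (N + ?m) (1 / real N * t) / F t ^ ?m" if "1 \<le> N" for N
      using ev
    proof eventually_elim
      case (elim t)
      then show ?case
        using le_cell_sum[OF T(1,2), of "1 / real N * t" N] that F_pos[of t]
        by (intro divide_right_mono) auto
    qed
    have "(\<lambda>N. ?m / real N) \<longlonglongrightarrow> 0" by (rule lim_const_over_n)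
    then have "(\<lambda>N. (1 + ?m / real N) powr (\<gamma> * ?m)) \<longlonglongrightarrow> (1 + 0) powr (\<gamma> * ?m)"
      by (intro tendsto_intros) auto
    then show "(\<lambda>N. (1 + ?m / real N) powr (\<gamma> * ?m)) \<longlonglongrightarrow> 1" by simp
    show "0 < (1 / real ?m) powr (\<gamma> * ?m) * cell_limit T ?m"
      using m cell_limit_pos[OF T(1,3)] by simp
  qed (use m that in auto)
qed

text \<open>Comparison with the power \<open>F t ^ card T\<close> at both \<open>t * s\<close> and
  \<open>t\<close>: the unknown constant cancels.\<close>

lemma total_regularly_varying:
  assumes T: "finite T" "T \<subseteq> I" "T \<noteq> {}"
  shows "regularly_varying_at_zero (\<lambda>t. prob {\<omega> \<in> space M. total T \<omega> \<le> t}) (card T * \<gamma>)"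
  unfolding regularly_varying_def
proof safe
  fix s :: real assume s: "0 < s"
  let ?H = "\<lambda>t. prob {\<omega> \<in> space M. total T \<omega> \<le> t}" and ?m = "card T"
  obtain c where c: "0 < c" "((\<lambda>t. ?H t / F t ^ ?m) \<longlongrightarrow> c) (at_right 0)"
    using total_asymptotics[OF T] by blast
  have scale: "filterlim (\<lambda>t. t * s) (at_right 0) (at_right 0)"
    unfolding filterlim_at
  proof
    show "\<forall>\<^sub>F t in at_right 0. t * s \<in> {0<..} \<and> t * s \<noteq> 0"
      using eventually_at_right_less[of 0] by eventually_elim (use s in auto)
    have "((\<lambda>t. t * s) \<longlongrightarrow> 0 * s) (at_right 0)" by (intro tendsto_intros)
    then show "((\<lambda>t. t * s) \<longlongrightarrow> 0) (at_right 0)" by simp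
  qed
  have "((\<lambda>t. ?H (t * s) / F (t * s) ^ ?m * (F (t * s) / F t) ^ ?m / (?H t / F t ^ ?m)) \<longlongrightarrow> c * (s powr \<gamma>) ^ ?m / c) (at_right 0)"
    using c s rv by (intro tendsto_intros filterlim_compose[OF c(2) scale]) (auto simp: regularly_varying_def)
  also have "c * (s powr \<gamma>) ^ ?m / c = s powr (?m * \<gamma>)"
    using c s by (simp add: powr_powr[symmetric] powr_realpow mult.commute[of _ \<gamma>])
  finally have lim: "((\<lambda>t. ?H (t * s) / F (t * s) ^ ?m * (F (t * s) / F t) ^ ?m / (?H t / F t ^ ?m)) \<longlongrightarrow> s powr (?m * \<gamma>)) (at_right 0)" .
  show "((\<lambda>t. ?H (t * s) / ?H t) \<longlongrightarrow> s powr (?m * \<gamma>)) (at_right 0)"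
  proof (rule Lim_transform_eventually[OF lim])
    show "\<forall>\<^sub>F t in at_right 0. ?H (t * s) / F (t * s) ^ ?m * (F (t * s) / F t) ^ ?m / (?H t / F t ^ ?m) = ?H (t * s) / ?H t"
      using eventually_at_right_less[of 0]
    proof eventually_elim
      case (elim t)
      then show ?case using F_pos[of t] F_pos[of "t * s"] s by (simp add: power_divide)
    qed
  qed
qed

end

section \<open>Poisson approximation for locally dependent events\<close>

definition binomial_weight :: "nat \<Rightarrow> real \<Rightarrow> nat \<Rightarrow> real" where
  "binomial_weight m q j = real (m choose j) * q ^ j * (1 - q) ^ (m - j)"

lemma binomial_weight_Suc:
  "binomial_weight (Suc m) q 0 = (1 - q) * binomial_weight m q 0"
  "binomial_weight (Suc m) q (Suc j) = (1 - q) * binomial_weight m q (Suc j) + q * binomial_weight m q j"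
proof -
  show "binomial_weight (Suc m) q 0 = (1 - q) * binomial_weight m q 0"
    by (simp add: binomial_weight_def)
  show "binomial_weight (Suc m) q (Suc j) = (1 - q) * binomial_weight m q (Suc j) + q * binomial_weight m q j"
  proof (cases "j < m")
    case True
    then have "m - j = Suc (m - Suc j)" by simp
    then show ?thesis by (simp add: binomial_weight_def algebra_simps)
  next
    case False
    then have "m choose Suc j = 0" by simp
    then show ?thesis by (simp add: binomial_weight_def algebra_simps)
  qed
qed

text \<open>The classical Poisson limit. The falling factorial converges factor by factor, and
  \<open>(1 - q) ^ m\<close> is enclosed between exponentials of \<open>- m * q / (1 - q)\<close>
  and \<open>- m * q\<close>.\<close>

lemma binomial_weight_tendsto:
  fixes m :: "nat \<Rightarrow> nat" and q :: "nat \<Rightarrow> real"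
  assumes m: "filterlim m at_top sequentially"
    and q: "\<And>n. 0 \<le> q n"
    and mq: "(\<lambda>n. real (m n) * q n) \<longlonglongrightarrow> l"
  shows "(\<lambda>n. binomial_weight (m n) (q n) j) \<longlonglongrightarrow> exp (- l) * (l ^ j / fact j)"
proof -
  have minf: "filterlim (\<lambda>n. real (m n)) at_infinity sequentially"
    using filterlim_compose[OF filterlim_real_sequentially m]
    by (rule filterlim_at_top_imp_at_infinity)
  have q0: "q \<longlonglongrightarrow> 0"
  proof -
    have "(\<lambda>n. real (m n) * q n / real (m n)) \<longlonglongrightarrow> 0"
      by (rule tendsto_divide_0[OF mq minf])
    moreover have "\<forall>\<^sub>F n in sequentially. 1 \<le> m n" using m by (simp add: filterlim_at_top)
    then have "\<forall>\<^sub>F n in sequentially. real (m n) * q n / real (m n) = q n"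
      by eventually_elim auto
    ultimately show ?thesis by (rule Lim_transform_eventually)
  qed
  have falling: "(\<lambda>n. real (m n choose j) * q n ^ j) \<longlonglongrightarrow> l ^ j / fact j"
  proof -
    have "(\<lambda>n. (\<Prod>i<j. real (m n) * q n - real i * q n) / fact j) \<longlonglongrightarrow> (\<Prod>i<j. l - real i * 0) / fact j"
      by (intro tendsto_intros mq q0) auto
    moreover have "(\<Prod>i<j. real (m n) * q n - real i * q n) / fact j = real (m n choose j) * q n ^ j" for n
    proof -
      have "real (m n choose j) = (\<Prod>i<j. real (m n) - real i) / fact j"
        by (simp add: binomial_gbinomial gbinomial_prod_rev lessThan_atLeast0)
      then show ?thesis
        by (simp add: left_diff_distrib[symmetric] prod.distrib)
    qed
    ultimately show ?thesis by simp
  qed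
  have small: "\<forall>\<^sub>F n in sequentially. q n < 1" using order_tendstoD(2)[OF q0, of 1] by simp
  have power: "(\<lambda>n. (1 - q n) ^ m n) \<longlonglongrightarrow> exp (- l)"
  proof (rule tendsto_sandwich)
    show "\<forall>\<^sub>F n in sequentially. exp (- (real (m n) * q n / (1 - q n))) \<le> (1 - q n) ^ m n"
      using small
    proof eventually_elim
      case (elim n)
      have "1 / (1 - q n) = 1 + q n / (1 - q n)" using elim by (simp add: field_simps)
      also have "\<dots> \<le> exp (q n / (1 - q n))" by (rule exp_ge_add_one_self)
      finally have "exp (- (q n / (1 - q n))) \<le> 1 - q n"
        using elim by (simp add: exp_minus field_simps)
      then have "exp (- (q n / (1 - q n))) ^ m n \<le> (1 - q n) ^ m n" by (rule power_mono) simp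
      then show ?case by (simp add: exp_of_nat_mult[symmetric])
    qed
    show "\<forall>\<^sub>F n in sequentially. (1 - q n) ^ m n \<le> exp (- (real (m n) * q n))"
      using small
    proof eventually_elim
      case (elim n)
      have "1 - q n \<le> exp (- q n)" using exp_ge_add_one_self[of "- q n"] by simp
      then have "(1 - q n) ^ m n \<le> exp (- q n) ^ m n" using elim by (intro power_mono) auto
      then show ?case by (simp add: exp_of_nat_mult[symmetric])
    qed
    have "(\<lambda>n. exp (- (real (m n) * q n / (1 - q n)))) \<longlonglongrightarrow> exp (- (l / (1 - 0)))"
      by (intro tendsto_intros mq q0) auto
    then show "(\<lambda>n. exp (- (real (m n) * q n / (1 - q n)))) \<longlonglongrightarrow> exp (- l)" by simp
    show "(\<lambda>n. exp (- (real (m n) * q n))) \<longlonglongrightarrow> exp (- l)" by (intro tendsto_intros mq)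
  qed
  have "(\<lambda>n. real (m n choose j) * q n ^ j * ((1 - q n) ^ m n / (1 - q n) ^ j)) \<longlonglongrightarrow>
      l ^ j / fact j * (exp (- l) / (1 - 0) ^ j)"
    by (intro tendsto_intros falling power q0) auto
  then have "(\<lambda>n. real (m n choose j) * q n ^ j * ((1 - q n) ^ m n / (1 - q n) ^ j)) \<longlonglongrightarrow>
      exp (- l) * (l ^ j / fact j)" by (simp add: mult.commute)
  moreover have "\<forall>\<^sub>F n in sequentially. j \<le> m n" using m by (simp add: filterlim_at_top)
  with small have "\<forall>\<^sub>F n in sequentially. real (m n choose j) * q n ^ j * ((1 - q n) ^ m n / (1 - q n) ^ j) = binomial_weight (m n) (q n) j"
    by eventually_elim (simp add: binomial_weight_def power_diff)
  ultimately show ?thesis by (rule Lim_transform_eventually)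
qed

context prob_space
begin

text \<open>Revealing the events one at a time, each is independent of the number of earlier ones up to
  the contribution of its neighbours, so the count obeys the binomial recursion up to a small
  error.\<close>

lemma count_close_to_binomial:
  fixes E :: "'z \<Rightarrow> 'a set" and nbr :: "'z \<Rightarrow> 'z \<Rightarrow> bool" and D :: nat and q \<rho> :: real
  defines "N \<equiv> \<lambda>S \<omega>. card {z \<in> S. \<omega> \<in> E z}"
  assumes E: "\<And>z. E z \<in> events" "\<And>z. prob (E z) = q"
    and indep: "\<And>z S j. finite S \<Longrightarrow> z \<notin> S \<Longrightarrow> (\<And>y. y \<in> S \<Longrightarrow> \<not> nbr y z) \<Longrightarrow>
      prob (E z \<inter> {\<omega> \<in> space M. N S \<omega> = j}) = q * prob {\<omega> \<in> space M. N S \<omega> = j}"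
    and \<rho>: "0 \<le> \<rho>"
    and pair: "\<And>y z. nbr y z \<Longrightarrow> prob (E y \<inter> E z) \<le> \<rho>"
    and deg: "\<And>z. finite {y. nbr y z}" "\<And>z. card {y. nbr y z} \<le> D"
    and S: "finite S"
  shows "\<bar>prob {\<omega> \<in> space M. N S \<omega> = j} - binomial_weight (card S) q j\<bar> \<le> card S * (2 * D * (\<rho> + q\<^sup>2))"
  using S
proof (induction S arbitrary: j)
  case empty
  have "{\<omega> \<in> space M. N {} \<omega> = j} = (if j = 0 then space M else {})" by (auto simp: N_def)
  then show ?case by (simp add: binomial_weight_def prob_space)
next
  case (insert z S)
  have q: "0 \<le> q" "q \<le> 1" using E(2)[of z] by (metis measure_nonneg, metis prob_le_1)
  have N_sets: "{\<omega> \<in> space M. N S \<omega> = j} \<in> events" if "finite S" for S j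
  proof -
    have "N S \<omega> = (\<Sum>z\<in>S. indicator (E z) \<omega>)" for \<omega>
      using that by (simp add: N_def indicator_def sum.If_cases Int_def)
    then have "{\<omega> \<in> space M. N S \<omega> = j} = {\<omega> \<in> space M. (\<Sum>z\<in>S. indicator (E z) \<omega> :: real) = real j}"
      by (auto simp: indicator_def of_nat_eq_iff[symmetric, where 'a = real] simp del: of_nat_eq_iff)
    also have "\<dots> \<in> events" using E(1) by measurable
    finally show ?thesis .
  qed
  \<comment> \<open>\<open>Y\<close> collects the revealed neighbours of \<open>z\<close>. The count
    over the rest \<open>S'\<close> is independent of \<open>E z\<close> and differs from the full
    count only if some event of \<open>Y\<close> occurs.\<close>
  define Y where "Y = {y \<in> S. nbr y z}"
  define S' where "S' = S - Y"
  have Y: "finite Y" "card Y \<le> D"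
  proof -
    have "Y \<subseteq> {y. nbr y z}" by (auto simp: Y_def)
    then show "card Y \<le> D" using card_mono[OF deg(1)] deg(2) order_trans by metis
    show "finite Y" using insert by (simp add: Y_def)
  qed
  have finS': "finite S'" using insert by (simp add: S'_def)
  define A where "A S j = {\<omega> \<in> space M. N S \<omega> = j}" for S j
  have A_sets: "A S j \<in> events" "A S' j \<in> events" for j using N_sets insert finS' by (auto simp: A_def)
  have same: "\<omega> \<in> A S j \<longleftrightarrow> \<omega> \<in> A S' j" if "\<omega> \<notin> (\<Union>y\<in>Y. E y)" for \<omega> j
  proof -
    have "{z \<in> S. \<omega> \<in> E z} = {z \<in> S'. \<omega> \<in> E z}" using that by (auto simp: S'_def)
    then show ?thesis by (simp add: A_def N_def)
  qed
  have diff: "\<bar>prob (B \<inter> A S j) - prob (B \<inter> A S' j)\<bar> \<le> (\<Sum>y\<in>Y. prob (E y \<inter> B))" if B: "B \<in> events" for B j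
  proof -
    have "prob U \<le> prob V + (\<Sum>y\<in>Y. prob (E y \<inter> B))"
      if "U \<subseteq> V \<union> (\<Union>y\<in>Y. E y \<inter> B)" "V \<in> events" for U V
    proof -
      have "prob U \<le> prob (V \<union> (\<Union>y\<in>Y. E y \<inter> B))"
        using that B E(1) Y(1) by (intro finite_measure_mono sets.Un sets.finite_UN) auto
      also have "\<dots> \<le> prob V + prob (\<Union>y\<in>Y. E y \<inter> B)"
        using that B E(1) Y(1) by (intro measure_Un_le sets.finite_UN) auto
      also have "prob (\<Union>y\<in>Y. E y \<inter> B) \<le> (\<Sum>y\<in>Y. prob (E y \<inter> B))"
        using B E(1) Y(1) by (intro measure_UNION_le) auto
      finally show ?thesis by simp
    qed
    note bound = this
    have "B \<inter> A S j \<subseteq> B \<inter> A S' j \<union> (\<Union>y\<in>Y. E y \<inter> B)" "B \<inter> A S' j \<subseteq> B \<inter> A S j \<union> (\<Union>y\<in>Y. E y \<inter> B)"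
      using same[of _ j] by blast+
    then have "prob (B \<inter> A S j) \<le> prob (B \<inter> A S' j) + (\<Sum>y\<in>Y. prob (E y \<inter> B))"
      "prob (B \<inter> A S' j) \<le> prob (B \<inter> A S j) + (\<Sum>y\<in>Y. prob (E y \<inter> B))"
      using A_sets B by (auto intro!: bound)
    then show ?thesis by linarith
  qed
  \<comment> \<open>Passing from \<open>S\<close> to \<open>S'\<close> and back costs
    \<open>\<rho>\<close> per neighbour inside \<open>E z\<close> and \<open>q * q\<close> per
    neighbour in the product.\<close>
  have close: "\<bar>prob (E z \<inter> A S j) - q * prob (A S j)\<bar> \<le> D * (\<rho> + q\<^sup>2)" for j
  proof -
    have "\<bar>prob (E z \<inter> A S j) - prob (E z \<inter> A S' j)\<bar> \<le> (\<Sum>y\<in>Y. prob (E y \<inter> E z))"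
      using E(1) by (rule diff)
    also have "\<dots> \<le> (\<Sum>y\<in>Y. \<rho>)" by (intro sum_mono pair) (auto simp: Y_def)
    also have "\<dots> = card Y * \<rho>" by simp
    finally have 1: "\<bar>prob (E z \<inter> A S j) - prob (E z \<inter> A S' j)\<bar> \<le> card Y * \<rho>" .
    have "\<bar>prob (space M \<inter> A S j) - prob (space M \<inter> A S' j)\<bar> \<le> (\<Sum>y\<in>Y. prob (E y \<inter> space M))"
      by (rule diff) simp
    also have "\<dots> = card Y * q" using E sets.sets_into_space by (simp add: Int_absorb2)
    also have "space M \<inter> A S j = A S j" by (auto simp: A_def)
    also have "space M \<inter> A S' j = A S' j" by (auto simp: A_def)
    finally have "q * \<bar>prob (A S j) - prob (A S' j)\<bar> \<le> q * (card Y * q)"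
      using q by (intro mult_left_mono)
    then have 2: "\<bar>q * prob (A S j) - q * prob (A S' j)\<bar> \<le> card Y * q\<^sup>2"
      using q by (simp add: right_diff_distrib[symmetric] abs_mult power2_eq_square mult_ac)
    have 3: "prob (E z \<inter> A S' j) = q * prob (A S' j)"
      unfolding A_def using insert finS' by (intro indep) (auto simp: S'_def Y_def)
    have "\<bar>prob (E z \<inter> A S j) - q * prob (A S j)\<bar> \<le> card Y * (\<rho> + q\<^sup>2)"
      using 1 2 3 by (simp add: algebra_simps)
    also have "\<dots> \<le> D * (\<rho> + q\<^sup>2)"
      using Y \<rho> by (intro mult_right_mono) auto
    finally show ?thesis .
  qed
  have N_insert: "N (insert z S) \<omega> = (if \<omega> \<in> E z then Suc (N S \<omega>) else N S \<omega>)" for \<omega>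
  proof -
    have "{y \<in> insert z S. \<omega> \<in> E y} = (if \<omega> \<in> E z then insert z {y \<in> S. \<omega> \<in> E y} else {y \<in> S. \<omega> \<in> E y})"
      by auto
    then show ?thesis using insert by (simp add: N_def)
  qed
  have out: "prob (A S j - E z) = prob (A S j) - prob (E z \<inter> A S j)" for j
    using A_sets E(1) by (subst finite_measure_Diff') (auto simp: Int_commute)
  show ?case
  proof (cases j)
    case 0
    have "{\<omega> \<in> space M. N (insert z S) \<omega> = j} = A S 0 - E z" by (auto simp: N_insert A_def 0)
    then have "prob {\<omega> \<in> space M. N (insert z S) \<omega> = j} - binomial_weight (card (insert z S)) q j =
        (1 - q) * (prob (A S 0) - binomial_weight (card S) q 0) - (prob (E z \<inter> A S 0) - q * prob (A S 0))"
      using insert by (simp add: out 0 binomial_weight_Suc algebra_simps)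
    moreover have "\<bar>(1 - q) * (prob (A S 0) - binomial_weight (card S) q 0)\<bar> \<le> 1 * (card S * (2 * D * (\<rho> + q\<^sup>2)))"
      unfolding abs_mult using q insert.IH[of 0] by (intro mult_mono) (auto simp: A_def)
    moreover note close[of 0]
    moreover have "0 \<le> D * (\<rho> + q\<^sup>2)" using close[of 0] by linarith
    ultimately have "\<bar>prob {\<omega> \<in> space M. N (insert z S) \<omega> = j} - binomial_weight (card (insert z S)) q j\<bar> \<le>
       card S * (2 * D * (\<rho> + q\<^sup>2)) + 2 * (D * (\<rho> + q\<^sup>2))" by linarith
    then show ?thesis using insert by (simp add: algebra_simps)
  next
    \<comment> \<open>Either \<open>z\<close> fails and the earlier count is \<open>Suc i\<close>,
      or it occurs and the earlier count is \<open>i\<close>. Each alternative brings one error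
      \<open>close\<close>, hence the factor 2 in the bound, while the weights \<open>1 - q\<close>
      and \<open>q\<close> keep the inherited error from growing.\<close>
    case (Suc i)
    have "{\<omega> \<in> space M. N (insert z S) \<omega> = j} = (A S (Suc i) - E z) \<union> (E z \<inter> A S i)"
      by (auto simp: N_insert A_def Suc split: if_splits)
    moreover have "prob ((A S (Suc i) - E z) \<union> (E z \<inter> A S i)) = prob (A S (Suc i) - E z) + prob (E z \<inter> A S i)"
      using A_sets E(1) by (intro finite_measure_Union) auto
    ultimately have "prob {\<omega> \<in> space M. N (insert z S) \<omega> = j} - binomial_weight (card (insert z S)) q j =
        ((1 - q) * (prob (A S (Suc i)) - binomial_weight (card S) q (Suc i)) + q * (prob (A S i) - binomial_weight (card S) q i))
        - (prob (E z \<inter> A S (Suc i)) - q * prob (A S (Suc i))) + (prob (E z \<inter> A S i) - q * prob (A S i))"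
      using insert by (simp add: out Suc binomial_weight_Suc algebra_simps)
    moreover have "\<bar>(1 - q) * (prob (A S (Suc i)) - binomial_weight (card S) q (Suc i))\<bar> \<le> (1 - q) * (card S * (2 * D * (\<rho> + q\<^sup>2)))"
      unfolding abs_mult using q insert.IH[of "Suc i"] by (intro mult_mono) (auto simp: A_def)
    moreover have "\<bar>q * (prob (A S i) - binomial_weight (card S) q i)\<bar> \<le> q * (card S * (2 * D * (\<rho> + q\<^sup>2)))"
      unfolding abs_mult using q insert.IH[of i] by (intro mult_mono) (auto simp: A_def)
    moreover note close[of i] close[of "Suc i"]
    moreover have "(1 - q) * (card S * (2 * D * (\<rho> + q\<^sup>2))) + q * (card S * (2 * D * (\<rho> + q\<^sup>2))) = card S * (2 * D * (\<rho> + q\<^sup>2))"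
      by (simp add: algebra_simps)
    ultimately have "\<bar>prob {\<omega> \<in> space M. N (insert z S) \<omega> = j} - binomial_weight (card (insert z S)) q j\<bar> \<le>
       card S * (2 * D * (\<rho> + q\<^sup>2)) + 2 * (D * (\<rho> + q\<^sup>2))" by linarith
    then show ?thesis using insert by (simp add: algebra_simps)
  qed
qed

end

context iid_positive
begin

text \<open>The index sets used by \<open>S\<close> are disjoint from \<open>T z\<close>, so the two
  blocks of variables are independent. The whole count is a measurable function of the second block,
  which pairwise independence of the events would not give.\<close>

lemma totals_independent:
  assumes S: "finite S" and sub: "T z \<subseteq> I" "\<And>y. y \<in> S \<Longrightarrow> T y \<subseteq> I"
    and fin: "finite (T z)" "\<And>y. y \<in> S \<Longrightarrow> finite (T y)"
    and disj: "\<And>y. y \<in> S \<Longrightarrow> T z \<inter> T y = {}"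
  shows "prob ({\<omega> \<in> space M. total (T z) \<omega> \<le> a} \<inter> {\<omega> \<in> space M. card {y \<in> S. total (T y) \<omega> \<le> a} = j}) =
    prob {\<omega> \<in> space M. total (T z) \<omega> \<le> a} * prob {\<omega> \<in> space M. card {y \<in> S. total (T y) \<omega> \<le> a} = j}"
proof -
  define B where "B = (\<Union>y\<in>S. T y)"
  let ?A = "T z"
  let ?PA = "PiM ?A (\<lambda>_. borel :: real measure)" and ?PB = "PiM B (\<lambda>_. borel :: real measure)"
  let ?XA = "\<lambda>\<omega>. restrict (\<lambda>i. X i \<omega>) ?A" and ?XB = "\<lambda>\<omega>. restrict (\<lambda>i. X i \<omega>) B"
  have ind: "indep_var ?PA ?XA ?PB ?XB"
  proof (rule indep_var_restrict[OF indep])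
    show "?A \<inter> B = {}" unfolding B_def using disj by blast
    show "B \<subseteq> I" unfolding B_def using sub(2) by blast
  qed (rule sub(1))
  define U where "U = {f \<in> space ?PA. (\<Sum>i\<in>?A. f i) \<le> a}"
  define V where "V = {f \<in> space ?PB. card {y \<in> S. (\<Sum>i\<in>T y. f i) \<le> a} = j}"
  have U: "U \<in> sets ?PA" unfolding U_def by measurable
  have V: "V \<in> sets ?PB"
  proof -
    have meas: "(\<lambda>f. \<Sum>i\<in>T y. f i) \<in> borel_measurable ?PB" if "y \<in> S" for y
      using that by (intro borel_measurable_sum measurable_component_singleton) (auto simp: B_def)
    have "V = {f \<in> space ?PB. (\<Sum>y\<in>S. indicator {f \<in> space ?PB. (\<Sum>i\<in>T y. f i) \<le> a} f :: real) = real j}"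
    proof -
      have "(\<Sum>y\<in>S. indicator {f \<in> space ?PB. (\<Sum>i\<in>T y. f i) \<le> a} f :: real) = real (card {y \<in> S. (\<Sum>i\<in>T y. f i) \<le> a})"
        if "f \<in> space ?PB" for f
        using that S by (simp add: indicator_def sum.If_cases Int_def)
      then show ?thesis by (auto simp: V_def)
    qed
    also have "\<dots> \<in> sets ?PB"
      by (intro borel_measurable_eq borel_measurable_sum borel_measurable_indicator borel_measurable_le meas) auto
    finally show ?thesis .
  qed
  have XA: "?XA \<omega> \<in> space ?PA" and XB: "?XB \<omega> \<in> space ?PB" for \<omega>
    by (auto simp: space_PiM)
  have UX: "?XA -` U \<inter> space M = {\<omega> \<in> space M. total (T z) \<omega> \<le> a}"
    using XA by (auto simp: U_def total_def)
  have eq: "{y \<in> S. (\<Sum>i\<in>T y. ?XB \<omega> i) \<le> a} = {y \<in> S. total (T y) \<omega> \<le> a}" for \<omega>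
  proof -
    have "(\<Sum>i\<in>T y. ?XB \<omega> i) = total (T y) \<omega>" if "y \<in> S" for y
      unfolding total_def using that by (intro sum.cong) (auto simp: B_def)
    then show ?thesis by auto
  qed
  have VX: "?XB -` V \<inter> space M = {\<omega> \<in> space M. card {y \<in> S. total (T y) \<omega> \<le> a} = j}"
  proof (rule set_eqI)
    fix \<omega>
    have "\<omega> \<in> ?XB -` V \<longleftrightarrow> card {y \<in> S. total (T y) \<omega> \<le> a} = j"
      unfolding V_def vimage_eq mem_Collect_eq eq using XB by simp
    then show "\<omega> \<in> ?XB -` V \<inter> space M \<longleftrightarrow> \<omega> \<in> {\<omega> \<in> space M. card {y \<in> S. total (T y) \<omega> \<le> a} = j}"
      by auto
  qed
  have "(\<lambda>\<omega>. (?XA \<omega>, ?XB \<omega>)) -` (U \<times> V) \<inter> space M = (?XA -` U \<inter> space M) \<inter> (?XB -` V \<inter> space M)"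
    by auto
  then show ?thesis
    using indep_varD[OF ind U V] unfolding UX VX by simp
qed

end

section \<open>Scales of the conductances\<close>

text \<open>The level set is nonempty by the intermediate value theorem, bounded away from 0 because
  \<open>G b\<close> already exceeds \<open>1 / u\<close>, and closed by continuity there. So the
  infimum belongs to it.\<close>

lemma inverse_scale_attained:
  fixes G :: "real \<Rightarrow> real"
  assumes cont: "continuous_on UNIV G" and mono: "mono G" and G0: "G 0 = 0"
    and lim: "(G \<longlongrightarrow> 1) at_top" and u: "1 < u"
  shows "0 < inverse_scale G u" "G (1 / inverse_scale G u) = 1 / u"
proof -
  define A where "A = {s. s > 0 \<and> 1 / G (1 / s) = u}"
  have A_iff: "s \<in> A \<longleftrightarrow> s > 0 \<and> G (1 / s) = 1 / u" for s
    using u by (auto simp: A_def)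
  have "\<forall>\<^sub>F x in at_top. 1 / u < G x" using u by (intro order_tendstoD(1)[OF lim]) auto
  then have "\<forall>\<^sub>F x in at_top. 1 / u < G x \<and> 0 < x" by (intro eventually_conj eventually_gt_at_top)
  then obtain b where b: "1 / u < G b" "0 < b" by (auto dest: eventually_happens)
  have "\<exists>x. 0 \<le> x \<and> x \<le> b \<and> G x = 1 / u"
    using b u G0 by (intro IVT') (auto intro: continuous_on_subset[OF cont])
  then obtain x where x: "0 \<le> x" "G x = 1 / u" by blast
  with G0 u have "x \<noteq> 0" by auto
  with x have "1 / x \<in> A" by (simp add: A_iff)
  then have ne: "A \<noteq> {}" by blast
  have lower: "1 / b \<le> s" if "s \<in> A" for s
  proof -
    have "\<not> b \<le> 1 / s" using monoD[OF mono, of b "1 / s"] that b by (auto simp: A_iff)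
    then show ?thesis using that b by (simp add: A_iff field_simps)
  qed
  have "A = {1 / b..} \<inter> (\<lambda>s. G (1 / s)) -` {1 / u}"
  proof (intro equalityI subsetI)
    fix s assume "s \<in> {1 / b..} \<inter> (\<lambda>s. G (1 / s)) -` {1 / u}"
    moreover from this have "0 < s" using b less_le_trans[of 0 "1 / b" s] by simp
    ultimately show "s \<in> A" by (simp add: A_iff)
  qed (use lower A_iff in auto)
  moreover have "closed ({1 / b..} \<inter> (\<lambda>s. G (1 / s)) -` {1 / u})"
  proof (intro continuous_closed_preimage continuous_on_compose2[OF cont] continuous_intros)
    show "\<forall>s\<in>{1 / b..}. s \<noteq> 0" using b less_le_trans[of 0 "1 / b"] by fastforce
  qed auto
  ultimately have "closed A" by simp
  then have "Inf A \<in> A" using ne lower by (intro closed_contains_Inf) (auto intro!: bdd_belowI)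
  moreover have "inverse_scale G u = Inf A" by (simp add: inverse_scale_def A_def)
  ultimately show "0 < inverse_scale G u" "G (1 / inverse_scale G u) = 1 / u" by (simp_all add: A_iff)
qed

text \<open>The deterministic bound in units of \<open>1 / h\<close>. The thresholds are chosen so
  that \<open>1 / s\<close> and \<open>n\<^sup>2 / t\<close> both equal \<open>h / A\<close>, whence
  the single error \<open>2 * C / A\<close>. The fewer than \<open>k\<close> sites with conductance
  at most \<open>b / h\<close> form the exceptional set of the minimax principle.\<close>

lemma dirichlet_eigenvalue_lower_bound:
  fixes c :: "(int ^ 'd::finite) set \<Rightarrow> real" and K n :: nat
  defines "C \<equiv> 1024 * (real K + 1)\<^sup>2 * (real (card (lattice_box (2 * K + 2) :: (int ^ 'd) set)))\<^sup>2"
  assumes dim: "CARD('d) \<ge> 2"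
    and nonneg: "\<And>e. e \<in> edges \<Longrightarrow> 0 \<le> c e"
    and large: "2 * K + 3 \<le> n"
    and pos: "0 < h" "0 < A" "0 < \<theta>" "0 < e" "0 < b" "0 < \<zeta>"
    and few_t: "\<And>x. x \<in> lattice_box (6 * n) \<Longrightarrow>
      card {e \<in> edges. e \<subseteq> (+) x ` lattice_box (2 * K + 2) \<and> c e \<le> A * (real n)\<^sup>2 / h} < K"
    and few_s: "\<And>x. x \<in> lattice_box (6 * n) \<Longrightarrow>
      card {e \<in> edges. e \<subseteq> (+) x ` lattice_box (2 * K + 2) \<and> c e \<le> A / h} < 4 * CARD('d) - 2"
    and k: "card {z \<in> lattice_box n. vertex_conductance c z \<le> b / h} < k" "k \<le> card (lattice_box n :: (int ^ 'd) set)"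
    and coeff: "(1 + e) / b + 2 / \<theta> + (1 + 4 * CARD('d) + 2 * CARD('d) * ((1 + 1 / e) * \<theta> / b)) * (2 * C / A) < 1 / \<zeta>"
  shows "\<zeta> < h * dirichlet_eigenvalue c n k"
proof -
  obtain i1 :: 'd where True by blast
  have "\<exists>i2 :: 'd. i2 \<noteq> i1"
  proof (rule ccontr)
    assume "\<not> ?thesis"
    then have "UNIV = {i1}" by auto
    then have "CARD('d) = 1" by (metis card.empty card.insert empty_iff finite.emptyI One_nat_def)
    with dim show False by simp
  qed
  then obtain i2 :: 'd where i2: "i1 \<noteq> i2" by metis
  have n: "1 \<le> n" using large by simp
  have n2: "1 \<le> (real n)\<^sup>2" using n by (simp add: one_le_power)
  have "\<zeta> / h < dirichlet_eigenvalue c n k"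
  proof (rule dirichlet_eigenvalue_gtI[OF _ k])
    show "finite {z \<in> lattice_box n. vertex_conductance c z \<le> b / h}" by simp
    fix f :: "int ^ 'd \<Rightarrow> real"
    assume f: "\<And>x. x \<notin> lattice_box n \<Longrightarrow> f x = 0" "f \<noteq> (\<lambda>x. 0)"
      "\<And>z. z \<in> {z \<in> lattice_box n. vertex_conductance c z \<le> b / h} \<Longrightarrow> f z = 0"
    interpret conductance_geometry c n K "A / h" "A * (real n)\<^sup>2 / h" i1 i2 f
    proof
      show "A / h \<le> A * (real n)\<^sup>2 / h" using pos n2 by (simp add: divide_right_mono)
    qed (use i2 nonneg large pos few_t few_s f in auto)
    let ?S = "\<Sum>x\<in>lattice_box n. (f x)\<^sup>2" and ?E = "energy c n f"
    let ?q = "(1 + e) / b + 2 / \<theta> + (1 + 4 * CARD('d) + 2 * CARD('d) * ((1 + 1 / e) * \<theta> / b)) * (2 * C / A)"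
    have "?S \<le> ((1 + e) / (b / h) + 2 / (\<theta> / h) + (1 + 4 * CARD('d) + 2 * CARD('d) * ((1 + 1 / e) * (\<theta> / h) / (b / h))) *
        (C * (1 / (A / h) + (real n)\<^sup>2 / (A * (real n)\<^sup>2 / h)))) * ?E"
      using f(3) pos unfolding C_def by (intro sum_squares_le_energy) auto
    also have "(1 + e) / (b / h) + 2 / (\<theta> / h) + (1 + 4 * CARD('d) + 2 * CARD('d) * ((1 + 1 / e) * (\<theta> / h) / (b / h))) *
        (C * (1 / (A / h) + (real n)\<^sup>2 / (A * (real n)\<^sup>2 / h))) = h * ?q"
    proof -
      have "(1 + e) / (b / h) = h * ((1 + e) / b)" "2 / (\<theta> / h) = h * (2 / \<theta>)"
        "(1 + 1 / e) * (\<theta> / h) / (b / h) = (1 + 1 / e) * \<theta> / b"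
        "C * (1 / (A / h) + (real n)\<^sup>2 / (A * (real n)\<^sup>2 / h)) = h * (2 * C / A)"
        using pos n by (simp_all add: field_simps)
      then show ?thesis by (simp only: distrib_left mult.left_commute)
    qed
    finally have S: "?S \<le> h * ?q * ?E" .
    have Spos: "0 < ?S"
    proof -
      obtain x where x: "f x \<noteq> 0" using f(2) by auto
      then have "x \<in> lattice_box n" using f(1) by blast
      with x show ?thesis by (intro sum_pos2[of _ x]) auto
    qed
    have "?E \<noteq> 0" using S Spos by auto
    with energy_nonneg have E: "0 < ?E" by simp
    have "\<zeta> / h * ?S \<le> \<zeta> / h * (h * ?q * ?E)" using S pos by (intro mult_left_mono) auto
    also have "\<dots> = \<zeta> * ?q * ?E" using pos by simp
    also have "\<dots> < \<zeta> * (1 / \<zeta>) * ?E"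
      using coeff pos E by (intro mult_strict_right_mono mult_strict_left_mono) auto
    also have "\<dots> = ?E" using pos by simp
    finally show "\<zeta> / h * ?S < ?E" .
  qed
  then show ?thesis using pos by (simp add: field_simps)
qed

section \<open>Tail exponents at the scale of the smallest vertex conductance\<close>

locale random_conductances = iid_regularly_varying M w "edges :: (int ^ 'd::finite) set set" \<mu> \<gamma>
  for M :: "'a measure" and w :: "(int ^ 'd) set \<Rightarrow> 'a \<Rightarrow> real" and \<mu> \<gamma> +
  assumes dim: "CARD('d) \<ge> 2" and F_cont: "continuous_on UNIV F" and \<gamma>_less: "\<gamma> < 1 / 4"
begin

abbreviation box :: "nat \<Rightarrow> (int ^ 'd) set" where "box \<equiv> lattice_box"

definition vol :: "nat \<Rightarrow> real" where "vol n = real (card (box n))"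

definition F\<pi> :: "real \<Rightarrow> real" where
  "F\<pi> = cdf (distr M borel (total (star 0)))"

definition h :: "nat \<Rightarrow> real" where "h n = inverse_scale F\<pi> (vol n)"

definition p :: real where "p = 2 * real CARD('d) * \<gamma>"

lemma p_pos: "0 < p"
  using \<gamma> dim by (simp add: p_def)

lemma total_star: "total (star z) \<omega> = vertex_conductance (\<lambda>e. w e \<omega>) z"
  by (simp add: total_def vertex_conductance_eq_star)

lemma star_nonempty: "star z \<noteq> ({} :: (int ^ 'd) set set)"
  using card_star[of z] dim by (metis card.empty mult_eq_0_iff not_numeral_le_zero zero_neq_numeral)

lemma prob_star: "prob {\<omega> \<in> space M. total (star z) \<omega> \<le> a} = F\<pi> a"
  unfolding F\<pi>_def cdf_total_eq[OF star_subset_edges]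
  by (rule prob_total_cong) (simp_all add: star_subset_edges card_star)

lemma F\<pi>_eq: "F\<pi> a = prob {\<omega> \<in> space M. total (star 0) \<omega> \<le> a}"
  by (simp add: prob_star)

lemma total_star_sets: "{\<omega> \<in> space M. total (star z) \<omega> \<le> a} \<in> events"
  using measurable_total[OF star_subset_edges[of z]] by measurable

lemma vol_eq: "vol n = (2 * real n + 1) ^ CARD('d)"
  by (simp add: vol_def card_lattice_box add.commute)

lemma vol_ge: "real n \<le> vol n" "1 \<le> n \<Longrightarrow> 1 < vol n"
proof -
  have "2 * real n + 1 \<le> vol n" unfolding vol_eq using dim by (intro self_le_power) auto
  then show "real n \<le> vol n" "1 \<le> n \<Longrightarrow> 1 < vol n" by linarith+
qed

lemma vol_tendsto: "filterlim vol at_top sequentially"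
  by (rule filterlim_at_top_mono[OF filterlim_real_sequentially]) (simp add: vol_ge)

lemma F\<pi>_regularity: "continuous_on UNIV F\<pi>" "mono F\<pi>" "F\<pi> 0 = 0" "(F\<pi> \<longlongrightarrow> 1) at_top"
proof -
  interpret N: real_distribution "distr M borel (total (star 0))"
    by (intro real_distribution_distr measurable_total star_subset_edges)
  show "continuous_on UNIV F\<pi>"
    unfolding F\<pi>_def by (intro continuous_cdf_total F_cont star_subset_edges star_nonempty) simp
  show "mono F\<pi>" unfolding F\<pi>_def by (intro monoI N.cdf_nondecreasing)
  show "(F\<pi> \<longlongrightarrow> 1) at_top" unfolding F\<pi>_def by (rule N.cdf_lim_at_top_prob)
  have "AE \<omega> in M. \<forall>e\<in>star 0. 0 < w e \<omega>"
    using pos star_subset_edges by (intro AE_finite_allI) auto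
  then have "AE \<omega> in M. \<not> total (star 0) \<omega> \<le> 0"
  proof eventually_elim
    case (elim \<omega>)
    then have "0 < total (star 0) \<omega>" unfolding total_def using star_nonempty by (intro sum_pos) auto
    then show ?case by simp
  qed
  then show "F\<pi> 0 = 0" unfolding F\<pi>_eq using total_star_sets by (subst prob_eq_0) auto
qed

lemma h_pos: "1 \<le> n \<Longrightarrow> 0 < h n" and F\<pi>_h: "1 \<le> n \<Longrightarrow> F\<pi> (1 / h n) = 1 / vol n"
  unfolding h_def using F\<pi>_regularity vol_ge by (auto intro!: inverse_scale_attained)

lemma F\<pi>_rv: "regularly_varying_at_zero F\<pi> p"
  using total_regularly_varying[OF finite_star star_subset_edges star_nonempty, of 0]
  by (simp add: F\<pi>_eq[abs_def] card_star p_def)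

lemma F\<pi>_pos: "0 < a \<Longrightarrow> 0 < F\<pi> a"
  by (rule regularly_varying_imp_pos[OF F\<pi>_rv F\<pi>_regularity(2)]) (simp_all add: F\<pi>_eq)

text \<open>\<open>F\<pi> (1 / h n) = 1 / vol n\<close> tends to zero, while \<open>F\<pi>\<close>
  is positive at every fixed positive argument.\<close>

lemma inv_h_tendsto: "filterlim (\<lambda>n. 1 / h n) (at_right 0) sequentially"
  unfolding filterlim_at
proof
  have ev: "\<forall>\<^sub>F n in sequentially. 1 \<le> (n :: nat)" by (rule eventually_ge_at_top)
  then show "\<forall>\<^sub>F n in sequentially. 1 / h n \<in> {0<..} \<and> 1 / h n \<noteq> 0"
  proof eventually_elim
    case (elim n)
    then show ?case using h_pos[of n] by simp
  qed
  show "(\<lambda>n. 1 / h n) \<longlonglongrightarrow> 0"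
  proof (rule order_tendstoI)
    fix y :: real assume "y < 0"
    from ev show "\<forall>\<^sub>F n in sequentially. y < 1 / h n"
    proof eventually_elim
      case (elim n)
      then show ?case using h_pos[of n] \<open>y < 0\<close> less_trans[of y 0 "1 / h n"] by simp
    qed
  next
    fix y :: real assume y: "0 < y"
    have "\<forall>\<^sub>F n in sequentially. 1 / F\<pi> y < vol n"
      using vol_tendsto by (simp add: filterlim_at_top_dense)
    with ev show "\<forall>\<^sub>F n in sequentially. 1 / h n < y"
    proof eventually_elim
      case (elim n)
      have "1 / vol n < F\<pi> y" using elim F\<pi>_pos[OF y] vol_ge(2)[of n] by (simp add: field_simps)
      then show ?case using F\<pi>_h[of n] elim monoD[OF F\<pi>_regularity(2), of y "1 / h n"] by force
    qed
  qed
qed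

lemma scaled_inv_h_tendsto:
  assumes "0 < A"
  shows "filterlim (\<lambda>n. A / h n) (at_right 0) sequentially"
  unfolding filterlim_at
proof
  have "\<forall>\<^sub>F n in sequentially. 1 \<le> (n :: nat)" by (rule eventually_ge_at_top)
  then show "\<forall>\<^sub>F n in sequentially. A / h n \<in> {0<..} \<and> A / h n \<noteq> 0"
  proof eventually_elim
    case (elim n)
    then show ?case using h_pos[of n] assms by simp
  qed
  have "(\<lambda>n. A * (1 / h n)) \<longlonglongrightarrow> A * 0"
    using inv_h_tendsto by (intro tendsto_intros) (simp add: filterlim_at)
  then show "(\<lambda>n. A / h n) \<longlonglongrightarrow> 0" by simp
qed

text \<open>\<open>vol n\<close> is the reciprocal of \<open>F\<pi> (1 / h n)\<close>, so the
  expected number of traps is a ratio to which regular variation applies.\<close>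

lemma vol_F\<pi>_tendsto:
  assumes "0 < \<zeta>"
  shows "(\<lambda>n. vol n * F\<pi> (\<zeta> / h n)) \<longlonglongrightarrow> \<zeta> powr p"
proof -
  have "((\<lambda>t. F\<pi> (t * \<zeta>) / F\<pi> t) \<longlongrightarrow> \<zeta> powr p) (at_right 0)"
    using F\<pi>_rv assms by (simp add: regularly_varying_def)
  from filterlim_compose[OF this inv_h_tendsto]
  have "(\<lambda>n. F\<pi> (1 / h n * \<zeta>) / F\<pi> (1 / h n)) \<longlonglongrightarrow> \<zeta> powr p" .
  moreover have "\<forall>\<^sub>F n in sequentially. F\<pi> (1 / h n * \<zeta>) / F\<pi> (1 / h n) = vol n * F\<pi> (\<zeta> / h n)"
    using eventually_ge_at_top[of 1] by eventually_elim (simp add: F\<pi>_h)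
  ultimately show ?thesis by (rule Lim_transform_eventually)
qed

lemma vol_F_bounded:
  assumes "0 < A"
  obtains l where "(\<lambda>n. vol n * F (A / h n) ^ (2 * CARD('d))) \<longlonglongrightarrow> l"
proof -
  obtain c where c: "0 < c" "((\<lambda>t. F\<pi> t / F t ^ (2 * CARD('d))) \<longlongrightarrow> c) (at_right 0)"
    using total_asymptotics[OF finite_star star_subset_edges star_nonempty, of 0]
    by (auto simp: F\<pi>_eq[symmetric] card_star)
  have "(\<lambda>n. vol n * F\<pi> (A / h n) / (F\<pi> (A / h n) / F (A / h n) ^ (2 * CARD('d)))) \<longlonglongrightarrow> A powr p / c"
    using c(1) by (intro tendsto_divide vol_F\<pi>_tendsto assms filterlim_compose[OF c(2) scaled_inv_h_tendsto]) auto
  moreover have "\<forall>\<^sub>F n in sequentially. vol n * F\<pi> (A / h n) / (F\<pi> (A / h n) / F (A / h n) ^ (2 * CARD('d))) = vol n * F (A / h n) ^ (2 * CARD('d))"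
    using eventually_ge_at_top[of 1]
  proof eventually_elim
    case (elim n)
    then have "F\<pi> (A / h n) > 0" using assms h_pos F\<pi>_pos by simp
    then show ?case by simp
  qed
  ultimately have "(\<lambda>n. vol n * F (A / h n) ^ (2 * CARD('d))) \<longlonglongrightarrow> A powr p / c"
    by (rule Lim_transform_eventually)
  then show ?thesis by (rule that)
qed

lemma F_tendsto_0:
  assumes "0 < A"
  shows "(\<lambda>n. F (A / h n)) \<longlonglongrightarrow> 0"
proof -
  have "isCont F 0" using F_cont by (simp add: continuous_on_eq_continuous_at)
  then have "(\<lambda>n. F (A / h n)) \<longlonglongrightarrow> F 0"
    using scaled_inv_h_tendsto[OF assms] by (intro isCont_tendsto_compose[of 0 F]) (auto simp: filterlim_at)
  then show ?thesis by (simp add: F_nonpos)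
qed

text \<open>The size \<open>2 * CARD('d)\<close> of a star is the critical power: there the product
  with \<open>vol n\<close> stays bounded, and each further factor \<open>F (A / h n)\<close> tends
  to zero. The powers used later are \<open>4 * CARD('d) - 2\<close> for crowded blocks and
  \<open>4 * CARD('d) - 1\<close> for adjacent traps.\<close>

lemma vol_F_higher_power:
  assumes "0 < A" "2 * CARD('d) < m"
  shows "(\<lambda>n. vol n * F (A / h n) ^ m) \<longlonglongrightarrow> 0"
proof -
  obtain l where l: "(\<lambda>n. vol n * F (A / h n) ^ (2 * CARD('d))) \<longlonglongrightarrow> l"
    using vol_F_bounded[OF assms(1)] by blast
  have "(\<lambda>n. vol n * F (A / h n) ^ (2 * CARD('d)) * F (A / h n) ^ (m - 2 * CARD('d))) \<longlonglongrightarrow> l * 0 ^ (m - 2 * CARD('d))"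
    by (intro tendsto_mult l tendsto_power F_tendsto_0 assms)
  moreover have "F a ^ (2 * CARD('d)) * F a ^ (m - 2 * CARD('d)) = F a ^ m" for a
    using assms by (simp add: power_add[symmetric])
  ultimately show ?thesis using assms(2) by (simp add: mult.assoc zero_power)
qed

text \<open>\<open>vol n\<close> is at least \<open>real n ^ CARD('d)\<close>, and the bounded
  product contains the power \<open>2 * CARD('d)\<close> of \<open>F (1 / h n)\<close>. The
  dimension cancels in the root, so the condition on \<gamma> does not depend on it.\<close>

lemma F_inv_h_le:
  obtains C where "0 < C" "\<forall>\<^sub>F n in sequentially. F (1 / h n) \<le> C * real n powr (- 1 / 2)"
proof -
  let ?m = "2 * CARD('d)"
  have m: "0 < ?m" using dim by simp
  obtain l where "(\<lambda>n. vol n * F (1 / h n) ^ ?m) \<longlonglongrightarrow> l" using vol_F_bounded[of 1] by auto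
  then have ev: "\<forall>\<^sub>F n in sequentially. vol n * F (1 / h n) ^ ?m < \<bar>l\<bar> + 1"
    by (rule order_tendstoD) linarith
  define C where "C = (\<bar>l\<bar> + 1) powr (1 / ?m)"
  have Cm: "C ^ ?m = \<bar>l\<bar> + 1"
    unfolding C_def using m by (subst powr_realpow[symmetric]) (auto simp: powr_powr simp del: power_mult)
  have "\<forall>\<^sub>F n in sequentially. F (1 / h n) \<le> C * real n powr (- 1 / 2)"
    using ev eventually_ge_at_top[of 1]
  proof eventually_elim
    case (elim n)
    have "(real n powr (- 1 / 2)) ^ ?m = real n powr (- real CARD('d))"
      using elim by (subst powr_realpow[symmetric]) (auto simp: powr_powr)
    also have "\<dots> = 1 / real n ^ CARD('d)"
      using elim by (simp add: powr_minus powr_realpow field_simps)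
    finally have "(C * real n powr (- 1 / 2)) ^ ?m = (\<bar>l\<bar> + 1) / real n ^ CARD('d)"
      by (simp only: power_mult_distrib Cm) simp
    also have "\<dots> \<ge> (\<bar>l\<bar> + 1) / vol n"
      unfolding vol_eq using elim by (intro divide_left_mono power_mono mult_pos_pos zero_less_power) auto
    also have "(\<bar>l\<bar> + 1) / vol n \<ge> F (1 / h n) ^ ?m"
      using elim vol_ge(2)[of n] by (simp add: field_simps)
    finally have "F (1 / h n) ^ ?m \<le> (C * real n powr (- 1 / 2)) ^ ?m" .
    then show ?case using m by (subst (asm) power_mono_iff) (auto simp: F_nonneg C_def)
  qed
  with that[of C] show ?thesis by (simp add: C_def)
qed

text \<open>This is where \<open>\<gamma> < 1 / 4\<close> enters: edges of conductance below \<open>A * n\<^sup>2 / h n\<close> have polynomially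
  small density.\<close>

lemma F_large_scale_le:
  obtains \<kappa> where "0 < \<kappa>"
    "\<And>A. 0 < A \<Longrightarrow> \<exists>C>0. \<forall>\<^sub>F n in sequentially. F (A * (real n)\<^sup>2 / h n) \<le> C * real n powr (- \<kappa>)"
proof -
  define \<rho> where "\<rho> = (\<gamma> + 1 / 4) / 2"
  have \<rho>: "\<gamma> < \<rho>" "0 < \<rho>" "\<rho> < 1 / 4" using \<gamma> \<gamma>_less by (auto simp: \<rho>_def)
  define \<kappa> where "\<kappa> = 1 / 2 - 2 * \<rho>"
  have \<kappa>: "0 < \<kappa>" using \<rho> by (simp add: \<kappa>_def)
  obtain a0 where a0: "0 < a0" "\<And>a b. 0 < a \<Longrightarrow> a \<le> b \<Longrightarrow> b \<le> a0 \<Longrightarrow> F b \<le> 2 powr \<rho> * (b / a) powr \<rho> * F a"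
    using potter_bound[OF rv F_mono F_nonneg \<rho>(1,2)] by blast
  obtain D where D: "0 < D" "\<forall>\<^sub>F n in sequentially. F (1 / h n) \<le> D * real n powr (- 1 / 2)"
    using F_inv_h_le by blast
  show ?thesis
  proof (rule that[OF \<kappa>])
    fix A :: real assume A: "0 < A"
    define C where "C = 2 powr \<rho> * A powr \<rho> * D"
    have C: "0 < C" using A D by (simp add: C_def)
    let ?b = "\<lambda>n. A * (real n)\<^sup>2 / h n"
    have "(\<lambda>n. C * real n powr (- \<kappa>)) \<longlonglongrightarrow> C * 0"
      using \<kappa> by (intro tendsto_intros tendsto_neg_powr filterlim_real_sequentially) auto
    then have "\<forall>\<^sub>F n in sequentially. C * real n powr (- \<kappa>) < F a0"
      using F_pos[OF a0(1)] by (intro order_tendstoD) auto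
    moreover have "\<forall>\<^sub>F n in sequentially. 1 / h n < a0"
      using inv_h_tendsto a0 by (intro order_tendstoD) (auto simp: filterlim_at)
    moreover have "\<forall>\<^sub>F n in sequentially. 1 / A \<le> real n"
      using filterlim_real_sequentially by (simp add: filterlim_at_top)
    ultimately have "\<forall>\<^sub>F n in sequentially. F (?b n) \<le> C * real n powr (- \<kappa>)"
      using D(2) eventually_ge_at_top[of 1]
    proof eventually_elim
      case (elim n)
      have hn: "0 < h n" using elim h_pos by simp
      \<comment> \<open>The doubling bound holds only below \<open>a0\<close>, and it is not known
        beforehand that \<open>?b n\<close> is so small. The truncated argument satisfies the bound,
        hence \<open>F b < F a0\<close>, and so the truncation was inactive.\<close>
      define b where "b = min a0 (?b n)"
      have "1 \<le> A * real n" using elim A by (simp add: field_simps)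
      also have "\<dots> \<le> A * (real n)\<^sup>2" using A elim by (intro mult_left_mono) (auto simp: power2_eq_square)
      finally have "1 / h n \<le> ?b n" using hn by (intro divide_right_mono) auto
      then have ab: "0 < 1 / h n" "1 / h n \<le> b" "b \<le> a0" using elim hn by (auto simp: b_def)
      have "F b \<le> 2 powr \<rho> * (b / (1 / h n)) powr \<rho> * F (1 / h n)" by (rule a0(2)[OF ab])
      also have "\<dots> \<le> 2 powr \<rho> * (A * (real n)\<^sup>2) powr \<rho> * (D * real n powr (- 1 / 2))"
      proof (intro mult_mono mult_left_mono powr_mono2)
        have "b \<le> ?b n" by (simp add: b_def)
        then show "b / (1 / h n) \<le> A * (real n)\<^sup>2" using hn by (simp add: field_simps)
        have "0 < b" using ab by linarith
        then show "0 \<le> b / (1 / h n)" using hn by simp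
      qed (use elim \<rho> in \<open>auto simp: F_nonneg\<close>)
      also have "(A * (real n)\<^sup>2) powr \<rho> = A powr \<rho> * real n powr (2 * \<rho>)"
        using elim by (simp add: powr_mult powr_powr flip: powr_numeral)
      also have "2 powr \<rho> * (A powr \<rho> * real n powr (2 * \<rho>)) * (D * real n powr (- 1 / 2)) = C * real n powr (- \<kappa>)"
        by (simp add: C_def \<kappa>_def powr_add[symmetric])
      finally have Fb: "F b \<le> C * real n powr (- \<kappa>)" .
      with elim have "b \<noteq> a0" by auto
      then have "b = ?b n" by (auto simp: b_def min_def split: if_splits)
      with Fb show ?case by simp
    qed
    with C show "\<exists>C>0. \<forall>\<^sub>F n in sequentially. F (?b n) \<le> C * real n powr (- \<kappa>)" by blast
  qed
qed

text \<open>Any \<open>K\<close> above \<open>CARD('d) / \<kappa>\<close> works. It is uniform in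
  \<open>A\<close>, which only enters the constant; thus block size and combinatorial constants can
  be fixed before \<open>A\<close> is chosen large.\<close>

lemma vol_F_large_scale:
  obtains K :: nat where "\<And>A. 0 < A \<Longrightarrow> (\<lambda>n. vol n * F (A * (real n)\<^sup>2 / h n) ^ K) \<longlonglongrightarrow> 0"
proof -
  obtain \<kappa> where \<kappa>: "0 < \<kappa>"
    "\<And>A. 0 < A \<Longrightarrow> \<exists>C>0. \<forall>\<^sub>F n in sequentially. F (A * (real n)\<^sup>2 / h n) \<le> C * real n powr (- \<kappa>)"
    using F_large_scale_le by blast
  obtain K where K: "CARD('d) / \<kappa> < real K" using reals_Archimedean2 by blast
  have K': "real CARD('d) - \<kappa> * real K < 0" using K \<kappa> by (simp add: field_simps)
  have "(\<lambda>n. vol n * F (A * (real n)\<^sup>2 / h n) ^ K) \<longlonglongrightarrow> 0" if A: "0 < A" for A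
  proof -
    obtain C where C: "0 < C" "\<forall>\<^sub>F n in sequentially. F (A * (real n)\<^sup>2 / h n) \<le> C * real n powr (- \<kappa>)"
      using \<kappa>(2)[OF A] by blast
    have "(\<lambda>n. 3 ^ CARD('d) * C ^ K * real n powr (real CARD('d) - \<kappa> * real K)) \<longlonglongrightarrow> 3 ^ CARD('d) * C ^ K * 0"
      using K' by (intro tendsto_intros tendsto_neg_powr filterlim_real_sequentially) auto
    then have lim: "(\<lambda>n. 3 ^ CARD('d) * C ^ K * real n powr (real CARD('d) - \<kappa> * real K)) \<longlonglongrightarrow> 0" by simp
    show ?thesis
    proof (rule tendsto_sandwich[OF _ _ tendsto_const lim])
      show "\<forall>\<^sub>F n in sequentially. 0 \<le> vol n * F (A * (real n)\<^sup>2 / h n) ^ K"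
        by (simp add: vol_def F_nonneg)
      show "\<forall>\<^sub>F n in sequentially. vol n * F (A * (real n)\<^sup>2 / h n) ^ K \<le> 3 ^ CARD('d) * C ^ K * real n powr (real CARD('d) - \<kappa> * real K)"
        using C(2) eventually_ge_at_top[of 1]
      proof eventually_elim
        case (elim n)
        have "vol n * F (A * (real n)\<^sup>2 / h n) ^ K \<le> (3 * real n) ^ CARD('d) * (C * real n powr (- \<kappa>)) ^ K"
          unfolding vol_eq using elim by (intro mult_mono power_mono) (auto simp: F_nonneg)
        also have "(C * real n powr (- \<kappa>)) ^ K = C ^ K * real n powr (- (\<kappa> * real K))"
          unfolding power_mult_distrib using elim by (subst (2) powr_realpow[symmetric]) (auto simp: powr_powr)
        also have "(3 * real n) ^ CARD('d) = 3 ^ CARD('d) * real n powr real CARD('d)"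
          using elim by (simp add: power_mult_distrib powr_realpow)
        also have "3 ^ CARD('d) * real n powr real CARD('d) * (C ^ K * real n powr (- (\<kappa> * real K))) =
            3 ^ CARD('d) * C ^ K * real n powr (real CARD('d) - \<kappa> * real K)"
          by (simp add: powr_diff powr_minus divide_inverse)
        finally show ?case .
      qed
    qed
  qed
  then show ?thesis by (rule that)
qed

section \<open>Convergence of the eigenvalues\<close>

text \<open>Union bound over the sites of \<open>S\<close> and over the sets of \<open>m\<close>
  edges inside a block. The double exponential crudely counts the families of vertex sets in a
  block; for a fixed family independence gives \<open>F \<tau> ^ m\<close>.\<close>

lemma prob_many_closed:
  fixes S :: "(int ^ 'd) set" and R m :: nat and \<tau> :: real
  assumes S: "finite S"
  defines "B \<equiv> \<lambda>x. (+) x ` (lattice_box R :: (int ^ 'd) set)"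
  defines "V \<equiv> {\<omega> \<in> space M. \<exists>x\<in>S. m \<le> card {e \<in> edges. e \<subseteq> B x \<and> w e \<omega> \<le> \<tau>}}"
  shows "V \<in> events" "prob V \<le> card S * (2 ^ 2 ^ card (box R) * F \<tau> ^ m)"
proof -
  define Ts where "Ts x = {T. T \<subseteq> {e \<in> edges. e \<subseteq> B x} \<and> card T = m}" for x
  define H where "H T = {\<omega> \<in> space M. \<forall>e\<in>T. w e \<omega> \<le> \<tau>}" for T
  have finB: "finite (B x)" for x by (simp add: B_def)
  have cardB: "card (B x) = card (box R)" for x by (simp add: B_def card_image)
  have Ts_sub: "Ts x \<subseteq> Pow (Pow (B x))" for x by (auto simp: Ts_def)
  have finTs: "finite (Ts x)" for x by (rule finite_subset[OF Ts_sub]) (simp add: finB)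
  have cardTs: "card (Ts x) \<le> 2 ^ 2 ^ card (box R)" for x
    using card_mono[OF _ Ts_sub[of x]] finB by (simp add: card_Pow cardB)
  have T: "finite T" "T \<subseteq> edges" if "T \<in> Ts x" for T x
  proof -
    have "T \<subseteq> Pow (B x)" using that Ts_sub[of x] by blast
    then show "finite T" by (rule finite_subset) (simp add: finB)
    show "T \<subseteq> edges" using that by (auto simp: Ts_def)
  qed
  have H_sets: "H T \<in> events" if "T \<in> Ts x" for T x
  proof -
    have "H T = {\<omega> \<in> space M. \<forall>e\<in>T. w e \<omega> \<le> \<tau>}" by (simp add: H_def)
    also have "\<dots> \<in> events"
    proof (rule sets.sets_Collect_finite_All[OF _ T(1)[OF that]])
      fix e assume "e \<in> T"
      then have "w e \<in> borel_measurable M" using T(2)[OF that] by auto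
      then show "{\<omega> \<in> space M. w e \<omega> \<le> \<tau>} \<in> events" by measurable
    qed
    finally show ?thesis .
  qed
  have V: "V = (\<Union>x\<in>S. \<Union>T\<in>Ts x. H T)"
  proof (intro equalityI subsetI)
    fix \<omega> assume "\<omega> \<in> V"
    then obtain x where x: "\<omega> \<in> space M" "x \<in> S" "m \<le> card {e \<in> edges. e \<subseteq> B x \<and> w e \<omega> \<le> \<tau>}"
      by (auto simp: V_def)
    obtain T where "T \<subseteq> {e \<in> edges. e \<subseteq> B x \<and> w e \<omega> \<le> \<tau>}" "card T = m"
      using obtain_subset_with_card_n[OF x(3)] by blast
    then have "T \<in> Ts x" "\<omega> \<in> H T" using x by (auto simp: Ts_def H_def)
    with x show "\<omega> \<in> (\<Union>x\<in>S. \<Union>T\<in>Ts x. H T)" by blast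
  next
    fix \<omega> assume "\<omega> \<in> (\<Union>x\<in>S. \<Union>T\<in>Ts x. H T)"
    then obtain x T where x: "x \<in> S" "T \<in> Ts x" "\<omega> \<in> H T" by blast
    then have "T \<subseteq> {e \<in> edges. e \<subseteq> B x \<and> w e \<omega> \<le> \<tau>}" by (auto simp: Ts_def H_def)
    moreover have "finite {e \<in> edges. e \<subseteq> B x \<and> w e \<omega> \<le> \<tau>}"
      by (rule finite_subset[of _ "Pow (B x)"]) (use finB in auto)
    ultimately have "card T \<le> card {e \<in> edges. e \<subseteq> B x \<and> w e \<omega> \<le> \<tau>}" by (intro card_mono)
    then show "\<omega> \<in> V" using x by (auto simp: V_def Ts_def H_def)
  qed
  show "V \<in> events" unfolding V using S finTs H_sets by (intro sets.finite_UN) auto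
  have "prob V \<le> (\<Sum>x\<in>S. prob (\<Union>T\<in>Ts x. H T))"
    unfolding V using S finTs H_sets by (intro measure_UNION_le sets.finite_UN) auto
  also have "\<dots> \<le> (\<Sum>x\<in>S. \<Sum>T\<in>Ts x. prob (H T))"
    using finTs H_sets by (intro sum_mono measure_UNION_le) auto
  also have "\<dots> = (\<Sum>x\<in>S. \<Sum>T\<in>Ts x. F \<tau> ^ m)"
  proof (intro sum.cong refl)
    fix x T assume "T \<in> Ts x"
    then show "prob (H T) = F \<tau> ^ m"
      using prob_all_le[OF T[OF \<open>T \<in> Ts x\<close>], of \<tau>] by (simp add: H_def Ts_def)
  qed
  also have "\<dots> \<le> (\<Sum>x\<in>S. 2 ^ 2 ^ card (box R) * F \<tau> ^ m)"
  proof (rule sum_mono)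
    fix x assume "x \<in> S"
    have "real (card (Ts x)) \<le> 2 ^ 2 ^ card (box R)" using cardTs[of x] by (metis of_nat_le_iff of_nat_numeral of_nat_power)
    then show "(\<Sum>T\<in>Ts x. F \<tau> ^ m) \<le> 2 ^ 2 ^ card (box R) * F \<tau> ^ m"
      using F_nonneg by (simp add: mult_right_mono)
  qed
  finally show "prob V \<le> card S * (2 ^ 2 ^ card (box R) * F \<tau> ^ m)" by simp
qed

definition crowded :: "nat \<Rightarrow> nat \<Rightarrow> nat \<Rightarrow> real \<Rightarrow> 'a set" where
  "crowded n R m \<tau> = {\<omega> \<in> space M. \<exists>x\<in>box (6 * n).
     m \<le> card {e \<in> edges. e \<subseteq> (+) x ` lattice_box R \<and> w e \<omega> \<le> \<tau>}}"

lemma crowded_sets: "crowded n R m \<tau> \<in> events"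
  unfolding crowded_def by (rule prob_many_closed) simp

lemma crowded_tendsto_0:
  assumes "(\<lambda>n. vol n * F (\<tau> n) ^ m) \<longlonglongrightarrow> 0"
  shows "(\<lambda>n. prob (crowded n R m (\<tau> n))) \<longlonglongrightarrow> 0"
proof -
  let ?C = "6 ^ CARD('d) * 2 ^ 2 ^ card (box R) :: real"
  have "(\<lambda>n. ?C * (vol n * F (\<tau> n) ^ m)) \<longlonglongrightarrow> ?C * 0" by (intro tendsto_intros assms)
  then have lim: "(\<lambda>n. ?C * (vol n * F (\<tau> n) ^ m)) \<longlonglongrightarrow> 0" by simp
  show ?thesis
  proof (rule tendsto_sandwich[OF _ _ tendsto_const lim])
    show "\<forall>\<^sub>F n in sequentially. prob (crowded n R m (\<tau> n)) \<le> ?C * (vol n * F (\<tau> n) ^ m)"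
    proof (rule always_eventually, rule allI)
      fix n
      have "prob (crowded n R m (\<tau> n)) \<le> vol (6 * n) * (2 ^ 2 ^ card (box R) * F (\<tau> n) ^ m)"
        unfolding crowded_def vol_def by (rule prob_many_closed(2)) simp
      also have "\<dots> \<le> (6 ^ CARD('d) * vol n) * (2 ^ 2 ^ card (box R) * F (\<tau> n) ^ m)"
        unfolding vol_eq power_mult_distrib[symmetric]
        by (intro mult_right_mono power_mono) (auto simp: F_nonneg)
      finally show "prob (crowded n R m (\<tau> n)) \<le> ?C * (vol n * F (\<tau> n) ^ m)" by (simp add: mult_ac)
    qed
  qed simp
qed

definition traps :: "nat \<Rightarrow> real \<Rightarrow> 'a \<Rightarrow> (int ^ 'd) set" where
  "traps n \<zeta> \<omega> = {z \<in> box n. total (star z) \<omega> \<le> \<zeta> / h n}"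

text \<open>The probability that a Poisson variable of mean \<open>\<zeta> powr p\<close> is less
  than \<open>k\<close>.\<close>

definition poisson_tail :: "nat \<Rightarrow> real \<Rightarrow> real" where
  "poisson_tail k \<zeta> = exp (- (\<zeta> powr p)) * (\<Sum>j<k. (\<zeta> powr p) ^ j / fact j)"

lemma AE_positive: "AE \<omega> in M. \<forall>e\<in>edges. 0 < w e \<omega>"
proof -
  have "edges \<subseteq> (\<lambda>(x, y). {x, y}) ` (UNIV :: ((int ^ 'd) \<times> (int ^ 'd)) set)" by (auto simp: edges_def)
  then have "countable (edges :: (int ^ 'd) set set)" by (rule countable_subset) auto
  then show ?thesis using pos by (simp add: AE_ball_countable)
qed

text \<open>Almost surely all conductances are positive, so a small total forces every edge of the
  star to be small. The two stars share exactly one edge.\<close>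

lemma prob_adjacent_pair:
  assumes "adjacent y z"
  shows "prob ({\<omega> \<in> space M. total (star y) \<omega> \<le> a} \<inter> {\<omega> \<in> space M. total (star z) \<omega> \<le> a}) \<le> F a ^ (4 * CARD('d) - 1)"
proof -
  have T: "finite (star y \<union> star z)" "star y \<union> star z \<subseteq> edges" using star_subset_edges by auto
  have "{\<omega> \<in> space M. \<forall>e\<in>star y \<union> star z. w e \<omega> \<le> a} \<in> events"
  proof (rule sets.sets_Collect_finite_All[OF _ T(1)])
    fix e assume "e \<in> star y \<union> star z"
    then have "w e \<in> borel_measurable M" using T by auto
    then show "{\<omega> \<in> space M. w e \<omega> \<le> a} \<in> events" by measurable
  qed
  then have "prob ({\<omega> \<in> space M. total (star y) \<omega> \<le> a} \<inter> {\<omega> \<in> space M. total (star z) \<omega> \<le> a}) \<le>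
      prob {\<omega> \<in> space M. \<forall>e\<in>star y \<union> star z. w e \<omega> \<le> a}"
  proof (rule finite_measure_mono_AE[rotated])
    show "AE \<omega> in M. \<omega> \<in> {\<omega> \<in> space M. total (star y) \<omega> \<le> a} \<inter> {\<omega> \<in> space M. total (star z) \<omega> \<le> a} \<longrightarrow>
        \<omega> \<in> {\<omega> \<in> space M. \<forall>e\<in>star y \<union> star z. w e \<omega> \<le> a}"
      using AE_positive
    proof eventually_elim
      case (elim \<omega>)
      have "w e \<omega> \<le> total (star x) \<omega>" if "e \<in> star x" for e x
        unfolding total_def using that elim star_subset_edges[of x]
        by (intro member_le_sum) (auto intro: less_imp_le)
      then show ?case by (fastforce intro: order_trans)
    qed
  qed
  also have "\<dots> = F a ^ (4 * CARD('d) - 1)"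
    using prob_all_le[OF T] card_star_Un[OF assms] by simp
  finally show ?thesis .
qed

lemma traps_card_sets: "{\<omega> \<in> space M. card (traps n \<zeta> \<omega>) = j} \<in> events"
proof -
  let ?E = "\<lambda>z. {\<omega> \<in> space M. total (star z) \<omega> \<le> \<zeta> / h n}"
  have eq: "real (card (traps n \<zeta> \<omega>)) = (\<Sum>z\<in>box n. indicator (?E z) \<omega>)" if "\<omega> \<in> space M" for \<omega>
    using that by (simp add: traps_def indicator_def sum.If_cases Int_def)
  have "{\<omega> \<in> space M. card (traps n \<zeta> \<omega>) = j} = {\<omega> \<in> space M. (\<Sum>z\<in>box n. indicator (?E z) \<omega> :: real) = real j}"
    by (rule Collect_cong, rule conj_cong[OF refl]) (simp only: eq[symmetric] of_nat_eq_iff)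
  also have "\<dots> \<in> events"
    by (intro borel_measurable_eq borel_measurable_sum borel_measurable_indicator total_star_sets) auto
  finally show ?thesis .
qed

lemma few_traps_eq: "{\<omega> \<in> space M. card (traps n \<zeta> \<omega>) < k} = (\<Union>j<k. {\<omega> \<in> space M. card (traps n \<zeta> \<omega>) = j})"
  by auto

lemma few_traps_sets: "{\<omega> \<in> space M. card (traps n \<zeta> \<omega>) < k} \<in> events"
  unfolding few_traps_eq by (intro sets.finite_UN traps_card_sets) simp

text \<open>The binomial approximation has error of order
  \<open>vol n * (\<rho> n + (q n)\<^sup>2)\<close>. The first part vanishes because
  \<open>\<rho>\<close> has more than the critical power, the second because
  \<open>vol n * q n\<close> converges and \<open>q n\<close> tends to zero.\<close>

lemma traps_poisson:
  assumes \<zeta>: "0 < \<zeta>"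
  shows "(\<lambda>n. prob {\<omega> \<in> space M. card (traps n \<zeta> \<omega>) = j}) \<longlonglongrightarrow> exp (- (\<zeta> powr p)) * ((\<zeta> powr p) ^ j / fact j)"
proof -
  define q where "q n = F\<pi> (\<zeta> / h n)" for n
  define \<rho> where "\<rho> n = F (\<zeta> / h n) ^ (4 * CARD('d) - 1)" for n
  let ?D = "2 * CARD('d)"
  have close: "\<bar>prob {\<omega> \<in> space M. card (traps n \<zeta> \<omega>) = j} - binomial_weight (card (box n)) (q n) j\<bar> \<le>
      vol n * (2 * ?D * (\<rho> n + (q n)\<^sup>2))" for n
    unfolding vol_def traps_def
  proof (rule order_trans[OF eq_refl])
    define E where "E z = {\<omega> \<in> space M. total (star z) \<omega> \<le> \<zeta> / h n}" for z :: "int ^ 'd"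
    have count: "{\<omega> \<in> space M. card {z \<in> S. total (star z) \<omega> \<le> \<zeta> / h n} = i} = {\<omega> \<in> space M. card {z \<in> S. \<omega> \<in> E z} = i}"
      for S :: "(int ^ 'd) set" and i
      by (rule Collect_cong, rule conj_cong) (auto simp: E_def)
    show "\<bar>prob {\<omega> \<in> space M. card {z \<in> box n. total (star z) \<omega> \<le> \<zeta> / h n} = j} - binomial_weight (card (box n)) (q n) j\<bar> =
      \<bar>prob {\<omega> \<in> space M. card {z \<in> box n. \<omega> \<in> E z} = j} - binomial_weight (card (box n)) (q n) j\<bar>"
      by (simp only: count)
    show "\<dots> \<le> real (card (box n)) * (2 * ?D * (\<rho> n + (q n)\<^sup>2))"
    proof (rule count_close_to_binomial[where nbr = "\<lambda>y z. adjacent y z"])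
      fix z :: "int ^ 'd" and S :: "(int ^ 'd) set" and i
      assume S: "finite S" "z \<notin> S" "\<And>y. y \<in> S \<Longrightarrow> \<not> adjacent y z"
      have "prob ({\<omega> \<in> space M. total (star z) \<omega> \<le> \<zeta> / h n} \<inter> {\<omega> \<in> space M. card {y \<in> S. total (star y) \<omega> \<le> \<zeta> / h n} = i}) =
        prob {\<omega> \<in> space M. total (star z) \<omega> \<le> \<zeta> / h n} * prob {\<omega> \<in> space M. card {y \<in> S. total (star y) \<omega> \<le> \<zeta> / h n} = i}"
        using S by (intro totals_independent star_subset_edges star_disjoint) auto
      then show "prob (E z \<inter> {\<omega> \<in> space M. card {z \<in> S. \<omega> \<in> E z} = i}) = q n * prob {\<omega> \<in> space M. card {z \<in> S. \<omega> \<in> E z} = i}"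
        unfolding prob_star by (simp only: count E_def[symmetric] q_def)
    qed (simp_all add: E_def total_star_sets prob_star q_def \<rho>_def F_nonneg prob_adjacent_pair[unfolded One_nat_def] card_adjacent)
  qed
  have vq: "(\<lambda>n. vol n * q n) \<longlonglongrightarrow> \<zeta> powr p" unfolding q_def by (rule vol_F\<pi>_tendsto[OF \<zeta>])
  have q0: "q \<longlonglongrightarrow> 0"
  proof -
    have "isCont F\<pi> 0" using F\<pi>_regularity(1) by (simp add: continuous_on_eq_continuous_at)
    then have "(\<lambda>n. F\<pi> (\<zeta> / h n)) \<longlonglongrightarrow> F\<pi> 0"
      using scaled_inv_h_tendsto[OF \<zeta>] by (intro isCont_tendsto_compose[of 0 F\<pi>]) (auto simp: filterlim_at)
    then show ?thesis by (simp add: F\<pi>_regularity(3) q_def[abs_def])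
  qed
  have v\<rho>: "(\<lambda>n. vol n * \<rho> n) \<longlonglongrightarrow> 0"
    unfolding \<rho>_def using dim by (intro vol_F_higher_power \<zeta>) simp
  have "(\<lambda>n. 2 * ?D * (vol n * \<rho> n + vol n * q n * q n)) \<longlonglongrightarrow> 2 * ?D * (0 + \<zeta> powr p * 0)"
    by (intro tendsto_intros v\<rho> vq q0)
  then have err: "(\<lambda>n. vol n * (2 * ?D * (\<rho> n + (q n)\<^sup>2))) \<longlonglongrightarrow> 0"
    by (simp add: power2_eq_square algebra_simps)
  have "filterlim (\<lambda>n. card (box n)) at_top sequentially"
    by (rule filterlim_at_top_mono[OF filterlim_ident])
      (use vol_ge(1) in \<open>simp add: vol_def\<close>)
  then have "(\<lambda>n. binomial_weight (card (box n)) (q n) j) \<longlonglongrightarrow> exp (- (\<zeta> powr p)) * ((\<zeta> powr p) ^ j / fact j)"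
    using vq by (intro binomial_weight_tendsto) (auto simp: q_def F\<pi>_eq vol_def)
  moreover have "(\<lambda>n. prob {\<omega> \<in> space M. card (traps n \<zeta> \<omega>) = j} - binomial_weight (card (box n)) (q n) j) \<longlonglongrightarrow> 0"
    by (rule Lim_null_comparison[OF always_eventually err]) (use close in simp)
  ultimately have "(\<lambda>n. binomial_weight (card (box n)) (q n) j + (prob {\<omega> \<in> space M. card (traps n \<zeta> \<omega>) = j} - binomial_weight (card (box n)) (q n) j))
      \<longlonglongrightarrow> exp (- (\<zeta> powr p)) * ((\<zeta> powr p) ^ j / fact j) + 0"
    by (rule tendsto_add)
  then show ?thesis by simp
qed

lemma few_traps_tendsto:
  assumes \<zeta>: "0 < \<zeta>"
  shows "(\<lambda>n. prob {\<omega> \<in> space M. card (traps n \<zeta> \<omega>) < k}) \<longlonglongrightarrow> poisson_tail k \<zeta>"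
proof -
  have "prob {\<omega> \<in> space M. card (traps n \<zeta> \<omega>) < k} = (\<Sum>j<k. prob {\<omega> \<in> space M. card (traps n \<zeta> \<omega>) = j})" for n
    unfolding few_traps_eq
    by (rule finite_measure_finite_Union) (auto simp: traps_card_sets disjoint_family_on_def)
  moreover have "(\<lambda>n. \<Sum>j<k. prob {\<omega> \<in> space M. card (traps n \<zeta> \<omega>) = j}) \<longlonglongrightarrow> (\<Sum>j<k. exp (- (\<zeta> powr p)) * ((\<zeta> powr p) ^ j / fact j))"
    by (intro tendsto_sum traps_poisson \<zeta>)
  ultimately show ?thesis by (simp add: poisson_tail_def sum_distrib_left)
qed

section \<open>Comparison of the eigenvalue with the number of traps\<close>

definition eig :: "nat \<Rightarrow> nat \<Rightarrow> 'a \<Rightarrow> real" where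
  "eig k n \<omega> = dirichlet_eigenvalue (\<lambda>e. w e \<omega>) n k"

definition exceed :: "nat \<Rightarrow> nat \<Rightarrow> real \<Rightarrow> 'a set" where
  "exceed k n \<zeta> = {\<omega> \<in> space M. \<zeta> < h n * eig k n \<omega>}"

lemma eventually_card_box: "\<forall>\<^sub>F n in sequentially. k \<le> card (box n)"
  using eventually_ge_at_top[of k]
proof eventually_elim
  case (elim n)
  have "real k \<le> real n" using elim by simp
  also have "\<dots> \<le> real (card (box n))" using vol_ge(1)[of n] by (simp add: vol_def)
  finally show ?case by simp
qed

lemma measurable_eig:
  assumes "1 \<le> k" "k \<le> card (box n)"
  shows "eig k n \<in> borel_measurable M"
  unfolding eig_def[abs_def] using assms by (intro borel_measurable_dirichlet_eigenvalue) auto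

lemma exceed_sets: "1 \<le> k \<Longrightarrow> k \<le> card (box n) \<Longrightarrow> exceed k n \<zeta> \<in> events"
  unfolding exceed_def using measurable_eig by measurable

lemma exceed_upper:
  assumes \<zeta>: "0 < \<zeta>" and k: "1 \<le> k"
  shows "\<forall>\<^sub>F n in sequentially. prob (exceed k n \<zeta>) \<le>
    prob {\<omega> \<in> space M. card (traps n \<zeta> \<omega>) < k} + 2 * CARD('d) * (vol n * F (\<zeta> / h n) ^ (4 * CARD('d) - 1))"
  using eventually_ge_at_top[of 1]
proof eventually_elim
  case (elim n)
  let ?E = "\<lambda>z. {\<omega> \<in> space M. total (star z) \<omega> \<le> \<zeta> / h n}"
  let ?few = "{\<omega> \<in> space M. card (traps n \<zeta> \<omega>) < k}"
  let ?P = "\<Union>z\<in>box n. \<Union>y\<in>{y. adjacent y z}. ?E y \<inter> ?E z"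
  have P: "?P \<in> events" by (intro sets.finite_UN sets.Int total_star_sets) auto
  have "exceed k n \<zeta> \<subseteq> ?few \<union> ?P"
  proof
    fix \<omega> assume \<omega>: "\<omega> \<in> exceed k n \<zeta>"
    show "\<omega> \<in> ?few \<union> ?P"
    proof (rule ccontr)
      assume not: "\<omega> \<notin> ?few \<union> ?P"
      have sp: "\<omega> \<in> space M" using \<omega> by (simp add: exceed_def)
      then have "k \<le> card (traps n \<zeta> \<omega>)" using not by auto
      then obtain Z where Z: "Z \<subseteq> traps n \<zeta> \<omega>" "card Z = k" by (rule obtain_subset_with_card_n)
      have "eig k n \<omega> \<le> \<zeta> / h n"
        unfolding eig_def
      proof (rule dirichlet_eigenvalue_leI)
        show "Z \<subseteq> box n" using Z by (auto simp: traps_def)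
        show "\<not> adjacent x y" if "x \<in> Z" "y \<in> Z" for x y
        proof
          assume "adjacent x y"
          then have "\<omega> \<in> ?P" using that Z sp by (auto simp: traps_def intro!: bexI[of _ y] exI[of _ x])
          with not show False by blast
        qed
        show "vertex_conductance (\<lambda>e. w e \<omega>) z \<le> \<zeta> / h n" if "z \<in> Z" for z
          using that Z by (auto simp: traps_def total_star)
      qed (use Z k in auto)
      then have "h n * eig k n \<omega> \<le> \<zeta>" using h_pos[of n] elim by (simp add: field_simps)
      with \<omega> show False by (simp add: exceed_def)
    qed
  qed
  then have "prob (exceed k n \<zeta>) \<le> prob (?few \<union> ?P)"
    using P few_traps_sets by (intro finite_measure_mono sets.Un)
  also have "\<dots> \<le> prob ?few + prob ?P" using P few_traps_sets by (intro measure_Un_le)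
  also have "prob ?P \<le> (\<Sum>z\<in>box n. prob (\<Union>y\<in>{y. adjacent y z}. ?E y \<inter> ?E z))"
    by (intro measure_UNION_le sets.finite_UN sets.Int total_star_sets) auto
  also have "\<dots> \<le> (\<Sum>z\<in>box n. \<Sum>y | adjacent y z. prob (?E y \<inter> ?E z))"
    by (intro sum_mono measure_UNION_le sets.Int total_star_sets) auto
  also have "\<dots> \<le> (\<Sum>z\<in>box n. \<Sum>y | adjacent y z. F (\<zeta> / h n) ^ (4 * CARD('d) - 1))"
    by (intro sum_mono prob_adjacent_pair) simp
  also have "\<dots> = 2 * CARD('d) * (vol n * F (\<zeta> / h n) ^ (4 * CARD('d) - 1))"
    by (simp add: card_adjacent vol_def)
  finally show ?case by simp
qed

text \<open>Counting traps up to the larger threshold \<open>(1 + \<epsilon>) * \<zeta>\<close> buys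
  the room for all error terms of the deterministic bound. The exceptional events are the two kinds
  of crowded blocks.\<close>

lemma exceed_lower:
  assumes \<zeta>: "0 < \<zeta>" and k: "1 \<le> k" and \<epsilon>: "0 < \<epsilon>"
  obtains r where "r \<longlonglongrightarrow> 0"
    "\<forall>\<^sub>F n in sequentially. prob {\<omega> \<in> space M. card (traps n ((1 + \<epsilon>) * \<zeta>) \<omega>) < k} \<le> prob (exceed k n \<zeta>) + r n"
proof -
  obtain K :: nat where K: "\<And>A. 0 < A \<Longrightarrow> (\<lambda>n. vol n * F (A * (real n)\<^sup>2 / h n) ^ K) \<longlonglongrightarrow> 0"
    using vol_F_large_scale by blast
  let ?R = "2 * K + 2"
  define C where "C = 1024 * (real K + 1)\<^sup>2 * (real (card (box ?R)))\<^sup>2"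
  define b where "b = (1 + \<epsilon>) * \<zeta>"
  \<comment> \<open>Half of the slack \<open>\<epsilon>\<close> is spent as the weight in the
    expansion around the neighbours; \<open>gap\<close> is what remains for the other two errors,
    each of which will receive a quarter of it.\<close>
  define gap where "gap = 1 / \<zeta> - (1 + \<epsilon> / 2) / b"
  have b: "0 < b" using \<zeta> \<epsilon> by (simp add: b_def)
  have "(1 + \<epsilon> / 2) / b < (1 + \<epsilon>) / b" using b \<epsilon> by (intro divide_strict_right_mono) auto
  also have "(1 + \<epsilon>) / b = 1 / \<zeta>" using \<zeta> \<epsilon> by (simp add: b_def)
  finally have gap: "0 < gap" by (simp add: gap_def)
  define \<theta> where "\<theta> = 8 / gap"
  have \<theta>: "0 < \<theta>" "2 / \<theta> = gap / 4" using gap by (simp_all add: \<theta>_def)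
  define Q where "Q = 1 + 4 * CARD('d) + 2 * CARD('d) * ((1 + 1 / (\<epsilon> / 2)) * \<theta> / b)"
  have Q: "1 \<le> Q" unfolding Q_def using \<theta> b \<epsilon> by simp
  have "0 < real (card (box ?R))" using vol_ge(1)[of ?R] by (simp add: vol_def)
  then have C: "0 < C" unfolding C_def by (intro mult_pos_pos zero_less_power) auto
  \<comment> \<open>\<open>A\<close> comes last: \<open>Q\<close> depends on \<open>\<theta>\<close>
    and \<open>C\<close> on \<open>K\<close>, but neither on \<open>A\<close>.\<close>
  define A where "A = 8 * Q * C / gap"
  have A: "0 < A" "Q * (2 * C / A) = gap / 4" using Q C gap by (simp_all add: A_def)
  have coeff: "(1 + \<epsilon> / 2) / b + 2 / \<theta> + (1 + 4 * CARD('d) + 2 * CARD('d) * ((1 + 1 / (\<epsilon> / 2)) * \<theta> / b)) * (2 * C / A) < 1 / \<zeta>"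
  proof -
    have "1 / \<zeta> = (1 + \<epsilon> / 2) / b + gap" by (simp add: gap_def)
    then show ?thesis unfolding Q_def[symmetric] A(2) \<theta>(2) using gap by linarith
  qed
  let ?bad1 = "\<lambda>n. crowded n ?R K (A * (real n)\<^sup>2 / h n)"
  let ?bad2 = "\<lambda>n. crowded n ?R (4 * CARD('d) - 2) (A / h n)"
  show ?thesis
  proof (rule that[of "\<lambda>n. prob (?bad1 n) + prob (?bad2 n)"])
    have "(\<lambda>n. prob (?bad1 n) + prob (?bad2 n)) \<longlonglongrightarrow> 0 + 0"
      using A(1) dim by (intro tendsto_add crowded_tendsto_0 K vol_F_higher_power) auto
    then show "(\<lambda>n. prob (?bad1 n) + prob (?bad2 n)) \<longlonglongrightarrow> 0" by simp
    show "\<forall>\<^sub>F n in sequentially. prob {\<omega> \<in> space M. card (traps n ((1 + \<epsilon>) * \<zeta>) \<omega>) < k} \<le>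
        prob (exceed k n \<zeta>) + (prob (?bad1 n) + prob (?bad2 n))"
      using eventually_ge_at_top[of "2 * K + 3"] eventually_card_box[of k]
    proof eventually_elim
      case (elim n)
      let ?few = "{\<omega> \<in> space M. card (traps n b \<omega>) < k}"
      have hn: "0 < h n" using elim by (intro h_pos) simp
      have "prob ?few \<le> prob (exceed k n \<zeta> \<union> (?bad1 n \<union> ?bad2 n))"
      proof (rule finite_measure_mono_AE)
        show "AE \<omega> in M. \<omega> \<in> ?few \<longrightarrow> \<omega> \<in> exceed k n \<zeta> \<union> (?bad1 n \<union> ?bad2 n)"
          using AE_positive
        proof eventually_elim
          case (elim \<omega>)
          show ?case
          proof (intro impI, rule ccontr)
            assume few: "\<omega> \<in> ?few" and not: "\<omega> \<notin> exceed k n \<zeta> \<union> (?bad1 n \<union> ?bad2 n)"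
            have "\<zeta> < h n * dirichlet_eigenvalue (\<lambda>e. w e \<omega>) n k"
            proof (rule dirichlet_eigenvalue_lower_bound[where K = K and A = A and \<theta> = \<theta> and e = "\<epsilon> / 2" and b = b])
              show "card {e \<in> edges. e \<subseteq> (+) x ` lattice_box ?R \<and> w e \<omega> \<le> A * (real n)\<^sup>2 / h n} < K"
                if "x \<in> box (6 * n)" for x
                using not few that by (auto simp: crowded_def not_le)
              show "card {e \<in> edges. e \<subseteq> (+) x ` lattice_box ?R \<and> w e \<omega> \<le> A / h n} < 4 * CARD('d) - 2"
                if "x \<in> box (6 * n)" for x
                using not few that by (auto simp: crowded_def not_le)
              show "card {z \<in> box n. vertex_conductance (\<lambda>e. w e \<omega>) z \<le> b / h n} < k"
                using few by (simp add: traps_def total_star)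
              show "0 \<le> w e \<omega>" if "e \<in> edges" for e using elim that by (auto intro: less_imp_le)
              show "2 * K + 3 \<le> n" "k \<le> card (box n)" by fact+
            qed (use dim hn A(1) \<theta>(1) \<epsilon> b \<zeta> coeff in \<open>simp_all add: C_def\<close>)
            with few not show False by (auto simp: exceed_def eig_def)
          qed
        qed
        show "exceed k n \<zeta> \<union> (?bad1 n \<union> ?bad2 n) \<in> events"
          using k elim by (intro sets.Un crowded_sets exceed_sets)
      qed
      also have "\<dots> \<le> prob (exceed k n \<zeta>) + prob (?bad1 n \<union> ?bad2 n)"
        using k elim by (intro measure_Un_le sets.Un crowded_sets exceed_sets)
      also have "prob (?bad1 n \<union> ?bad2 n) \<le> prob (?bad1 n) + prob (?bad2 n)"
        by (intro measure_Un_le crowded_sets)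
      finally show ?case by (simp add: b_def)
    qed
  qed
qed

lemma poisson_tail_tendsto: "0 \<le> \<zeta> \<Longrightarrow> (poisson_tail k \<longlongrightarrow> poisson_tail k \<zeta>) (at_right \<zeta>)"
  unfolding poisson_tail_def[abs_def] using p_pos
  by (intro tendsto_intros tendsto_powr') (auto simp: eventually_at_right_less intro!: eventually_mono[OF eventually_at_right_less])

text \<open>The upper bound counts traps at \<open>\<zeta>\<close> itself, the lower bound at any
  threshold strictly above. Right continuity of \<open>poisson_tail\<close> closes the gap between
  them.\<close>

lemma exceed_tendsto:
  assumes \<zeta>: "0 < \<zeta>" and k: "1 \<le> k"
  shows "(\<lambda>n. prob (exceed k n \<zeta>)) \<longlonglongrightarrow> poisson_tail k \<zeta>"
proof (rule order_tendstoI)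
  fix y assume y: "poisson_tail k \<zeta> < y"
  have v: "(\<lambda>n. vol n * F (\<zeta> / h n) ^ (4 * CARD('d) - 1)) \<longlonglongrightarrow> 0"
    by (rule vol_F_higher_power[OF \<zeta>]) (use dim in simp)
  have "(\<lambda>n. prob {\<omega> \<in> space M. card (traps n \<zeta> \<omega>) < k} + 2 * CARD('d) * (vol n * F (\<zeta> / h n) ^ (4 * CARD('d) - 1)))
      \<longlonglongrightarrow> poisson_tail k \<zeta> + 2 * CARD('d) * (0 :: real)"
    by (rule tendsto_add[OF few_traps_tendsto[OF \<zeta>] tendsto_mult[OF tendsto_const v]])
  then have "\<forall>\<^sub>F n in sequentially. prob {\<omega> \<in> space M. card (traps n \<zeta> \<omega>) < k} + 2 * CARD('d) * (vol n * F (\<zeta> / h n) ^ (4 * CARD('d) - 1)) < y"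
    by (rule order_tendstoD) (use y in simp)
  with exceed_upper[OF \<zeta> k] show "\<forall>\<^sub>F n in sequentially. prob (exceed k n \<zeta>) < y"
    by eventually_elim linarith
next
  fix y assume y: "y < poisson_tail k \<zeta>"
  have "\<forall>\<^sub>F z in at_right \<zeta>. y < poisson_tail k z"
    using poisson_tail_tendsto[of \<zeta> k] \<zeta> y by (intro order_tendstoD) auto
  then have "\<forall>\<^sub>F z in at_right \<zeta>. y < poisson_tail k z \<and> \<zeta> < z"
    by (intro eventually_conj eventually_at_right_less)
  then obtain z where z: "y < poisson_tail k z" "\<zeta> < z" by (auto dest: eventually_happens)
  define \<epsilon> where "\<epsilon> = z / \<zeta> - 1"
  have \<epsilon>: "0 < \<epsilon>" "(1 + \<epsilon>) * \<zeta> = z" using \<zeta> z by (simp_all add: \<epsilon>_def field_simps)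
  obtain r where r: "r \<longlonglongrightarrow> 0"
    "\<forall>\<^sub>F n in sequentially. prob {\<omega> \<in> space M. card (traps n z \<omega>) < k} \<le> prob (exceed k n \<zeta>) + r n"
    using exceed_lower[OF \<zeta> k \<epsilon>(1)] unfolding \<epsilon>(2) by blast
  have "(\<lambda>n. prob {\<omega> \<in> space M. card (traps n z \<omega>) < k} - r n) \<longlonglongrightarrow> poisson_tail k z - 0"
    using \<zeta> z by (intro tendsto_diff few_traps_tendsto r) auto
  then have "\<forall>\<^sub>F n in sequentially. y < prob {\<omega> \<in> space M. card (traps n z \<omega>) < k} - r n"
    by (rule order_tendstoD) (use z in simp)
  with r(2) show "\<forall>\<^sub>F n in sequentially. y < prob (exceed k n \<zeta>)"
    by eventually_elim linarith
qed

lemma poisson_tail_0: "1 \<le> k \<Longrightarrow> poisson_tail k 0 = 1"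
proof -
  assume "1 \<le> k"
  then have "(\<Sum>j<k. (0 :: real) ^ j / fact j) = (\<Sum>j\<in>{0}. 0 ^ j / fact j)"
    by (intro sum.mono_neutral_right) auto
  then show ?thesis by (simp add: poisson_tail_def)
qed

text \<open>The trap count needs a positive threshold. At 0 the claim follows by monotonicity from
  small positive thresholds, where the limit is close to 1.\<close>

lemma exceed_tendsto_nonneg:
  assumes \<zeta>: "0 \<le> \<zeta>" and k: "1 \<le> k"
  shows "(\<lambda>n. prob (exceed k n \<zeta>)) \<longlonglongrightarrow> poisson_tail k \<zeta>"
proof (cases "\<zeta> = 0")
  case False
  with assms show ?thesis by (intro exceed_tendsto) auto
next
  case True
  show ?thesis unfolding True poisson_tail_0[OF k]
  proof (rule order_tendstoI)
    fix y :: real assume "1 < y"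
    then show "\<forall>\<^sub>F n in sequentially. prob (exceed k n 0) < y"
      using prob_le_1 le_less_trans by (intro always_eventually allI) blast
  next
    fix y :: real assume y: "y < 1"
    have "\<forall>\<^sub>F z in at_right 0. y < poisson_tail k z"
      using poisson_tail_tendsto[of 0 k] y poisson_tail_0[OF k] by (intro order_tendstoD) auto
    then have "\<forall>\<^sub>F z in at_right 0. y < poisson_tail k z \<and> 0 < z"
      by (intro eventually_conj eventually_at_right_less)
    then obtain z where z: "y < poisson_tail k z" "0 < z" by (auto dest: eventually_happens)
    have "\<forall>\<^sub>F n in sequentially. y < prob (exceed k n z)"
      using exceed_tendsto[OF z(2) k] z(1) by (rule order_tendstoD)
    with eventually_card_box[of k] show "\<forall>\<^sub>F n in sequentially. y < prob (exceed k n 0)"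
    proof eventually_elim
      case (elim n)
      have "prob (exceed k n z) \<le> prob (exceed k n 0)"
        using z(2) elim k by (intro finite_measure_mono exceed_sets) (auto simp: exceed_def)
      with elim show ?case by linarith
    qed
  qed
qed

text \<open>The law of \<open>G powr (1 / p)\<close>, where \<open>G\<close> is the
  \<open>k\<close>-th arrival time of a Poisson process of rate one. The library indexes Erlang
  densities from zero, hence \<open>k - 1\<close>; \<open>max 0\<close> makes the map monotone on
  the whole line.\<close>

definition limit_law :: "nat \<Rightarrow> real measure" where
  "limit_law k = distr (density lborel (erlang_density (k - 1) 1)) borel (\<lambda>x. max 0 x powr (1 / p))"

lemma real_distribution_limit_law: "real_distribution (limit_law k)"
proof -
  interpret N: prob_space "density lborel (erlang_density (k - 1) 1)"
    by (rule prob_space_erlang_density) simp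
  show ?thesis unfolding limit_law_def by (rule N.real_distribution_distr) simp
qed

lemma cdf_limit_law:
  assumes k: "1 \<le> k"
  shows "cdf (limit_law k) x = (if x < 0 then 0 else 1 - poisson_tail k x)"
proof -
  let ?N = "density lborel (erlang_density (k - 1) 1)"
  have N: "cdf (limit_law k) x = measure ?N {y. max 0 y powr (1 / p) \<le> x}"
    unfolding cdf_def limit_law_def by (subst measure_distr) (auto simp: vimage_def)
  show ?thesis
  proof (cases "x < 0")
    case True
    then have "{y. max 0 y powr (1 / p) \<le> x} = {}" by (auto simp: not_le intro: less_le_trans)
    then show ?thesis using True by (simp add: N)
  next
    case False
    have "max 0 y powr (1 / p) \<le> x \<longleftrightarrow> y \<le> x powr p" for y
    proof
      assume "max 0 y powr (1 / p) \<le> x"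
      then have "(max 0 y powr (1 / p)) powr p \<le> x powr p" using p_pos by (intro powr_mono2) auto
      then show "y \<le> x powr p" using p_pos by (simp add: powr_powr)
    next
      assume "y \<le> x powr p"
      then have "max 0 y powr (1 / p) \<le> (x powr p) powr (1 / p)" using p_pos by (intro powr_mono2) auto
      then show "max 0 y powr (1 / p) \<le> x" using p_pos False by (simp add: powr_powr)
    qed
    then have "cdf (limit_law k) x = measure ?N {..x powr p}" unfolding N by (simp add: atMost_def)
    also have "\<dots> = erlang_CDF (k - 1) 1 (x powr p)"
      by (simp add: measure_def emeasure_erlang_density)
    also have "\<dots> = 1 - (\<Sum>j<k. (x powr p) ^ j * exp (- (x powr p)) / fact j)"
    proof -
      have "{..k - 1} = {..<k}" using k by auto
      then show ?thesis by (simp add: erlang_CDF_def)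
    qed
    also have "(\<Sum>j<k. (x powr p) ^ j * exp (- (x powr p)) / fact j) = poisson_tail k x"
      unfolding poisson_tail_def sum_distrib_left by (intro sum.cong) auto
    finally show ?thesis using False by simp
  qed
qed

text \<open>The mass of a point is at most the distribution function there, which stays below 1
  because the Poisson probabilities are positive.\<close>

lemma limit_law_nondegenerate:
  assumes k: "1 \<le> k"
  shows "measure (limit_law k) {x} < 1"
proof -
  interpret N: real_distribution "limit_law k" by (rule real_distribution_limit_law)
  have "measure (limit_law k) {x} \<le> cdf (limit_law k) x"
    unfolding cdf_def by (intro N.finite_measure_mono) auto
  also have "\<dots> < 1"
  proof -
    have "0 < (\<Sum>j<k. (x powr p) ^ j / fact j)"
      using k by (intro sum_pos2[of _ 0]) auto
    then have "0 < poisson_tail k x" by (simp add: poisson_tail_def)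
    then show ?thesis by (simp add: cdf_limit_law[OF k])
  qed
  finally show ?thesis .
qed

text \<open>Distribution functions are complements of \<open>exceed\<close> probabilities, and
  negative arguments are dominated by the argument 0. Finitely many \<open>n\<close> are left free:
  those where the box has fewer than \<open>k\<close> sites, and \<open>n = 0\<close>, where
  \<open>X n\<close> is not tied to \<open>h n\<close>.\<close>

lemma weak_conv_eig:
  assumes k: "1 \<le> k" and X: "\<And>n. 1 \<le> n \<Longrightarrow> X n = (\<lambda>\<omega>. h n * eig k n \<omega>)"
  shows "weak_conv_m (\<lambda>n. distr M borel (X n)) (limit_law k)"
  unfolding weak_conv_m_def weak_conv_def
proof (intro allI impI)
  fix x
  have cdf: "\<forall>\<^sub>F n in sequentially. cdf (distr M borel (X n)) x = 1 - prob (exceed k n x)"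
    using eventually_card_box[of k] eventually_ge_at_top[of 1]
  proof eventually_elim
    case (elim n)
    have meas: "X n \<in> borel_measurable M"
      unfolding X[OF elim(2)] using measurable_eig[OF k elim(1)] by measurable
    have "cdf (distr M borel (X n)) x = prob (space M - exceed k n x)"
      unfolding cdf_def using meas
      by (subst measure_distr) (auto simp: X[OF elim(2)] exceed_def not_less intro!: arg_cong[where f = prob])
    also have "\<dots> = 1 - prob (exceed k n x)" using exceed_sets[OF k elim(1)] by (rule prob_compl)
    finally show ?case .
  qed
  show "(\<lambda>n. cdf (distr M borel (X n)) x) \<longlonglongrightarrow> cdf (limit_law k) x"
  proof (cases "x < 0")
    case False
    have "(\<lambda>n. 1 - prob (exceed k n x)) \<longlonglongrightarrow> 1 - poisson_tail k x"
      using False k by (intro tendsto_diff tendsto_const exceed_tendsto_nonneg) auto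
    then show ?thesis
      using False cdf by (simp add: cdf_limit_law[OF k] tendsto_cong)
  next
    case True
    have "(\<lambda>n. 1 - prob (exceed k n 0)) \<longlonglongrightarrow> 1 - poisson_tail k 0"
      using k by (intro tendsto_diff tendsto_const exceed_tendsto_nonneg) auto
    then have lim: "(\<lambda>n. 1 - prob (exceed k n 0)) \<longlonglongrightarrow> 0" by (simp add: poisson_tail_0[OF k])
    have "(\<lambda>n. 1 - prob (exceed k n x)) \<longlonglongrightarrow> 0"
    proof (rule tendsto_sandwich[OF _ _ tendsto_const lim])
      show "\<forall>\<^sub>F n in sequentially. 1 - prob (exceed k n x) \<le> 1 - prob (exceed k n 0)"
        using eventually_card_box[of k]
      proof eventually_elim
        case (elim n)
        have "prob (exceed k n 0) \<le> prob (exceed k n x)"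
          using True elim k by (intro finite_measure_mono exceed_sets) (auto simp: exceed_def)
        then show ?case by simp
      qed
    qed simp
    then show ?thesis using True cdf by (simp add: cdf_limit_law[OF k] tendsto_cong)
  qed
qed

end

theorem corollary2p3:
  fixes M :: "'a measure"
    and w :: "(int ^ 'd::finite) set \<Rightarrow> 'a \<Rightarrow> real"
    and \<mu> :: "real measure"
    and F F\<pi> L :: "real \<Rightarrow> real"
    and \<gamma> :: real
    and k :: nat
  assumes dim: "CARD('d) \<ge> 2"
    and prob: "prob_space M"
    and indep: "prob_space.indep_vars M (\<lambda>_. borel) w edges"
    and ident: "\<And>e. e \<in> edges \<Longrightarrow> distr M borel (w e) = \<mu>"
    and pos: "\<And>e. e \<in> edges \<Longrightarrow> AE \<omega> in M. w e \<omega> > 0"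
    and F: "F = cdf \<mu>"
    and F_cont: "continuous_on UNIV F"
    and gamma: "0 < \<gamma>" "\<gamma> < 1 / 4"
    and F_rv: "regularly_varying_at_zero F \<gamma>"
    and F_lower: "\<exists>a'>0. \<forall>a\<le>a'. \<forall>b. 0 \<le> b \<and> b \<le> 1 \<longrightarrow> F (a * b) \<ge> b * F a"
    and F\<pi>: "F\<pi> = cdf (distr M borel (\<lambda>\<omega>. vertex_conductance (\<lambda>e. w e \<omega>) 0))"
    and L_sv: "slowly_varying_at_infinity L"
    and L: "\<And>n. n \<ge> 1 \<Longrightarrow>
      inverse_scale F\<pi> (real (card (lattice_box n :: (int ^ 'd) set))) =
        real n powr (1 / (2 * \<gamma>)) * L (real n)"
    and k: "k \<ge> 1"
  shows "(\<exists>\<nu>. real_distribution \<nu> \<and> (\<forall>c. measure \<nu> {c} < 1) \<and>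
      weak_conv_m
        (\<lambda>n. distr M borel (\<lambda>\<omega>. L (real n) * real n powr (1 / (2 * \<gamma>)) *
           dirichlet_eigenvalue (\<lambda>e. w e \<omega>) n k)) \<nu>) \<and>
    (\<forall>\<zeta>\<ge>0.
      (\<lambda>n. measure M {\<omega> \<in> space M. L (real n) * real n powr (1 / (2 * \<gamma>)) *
           dirichlet_eigenvalue (\<lambda>e. w e \<omega>) n k > \<zeta>})
      \<longlonglongrightarrow> exp (- (\<zeta> powr (2 * real CARD('d) * \<gamma>))) *
            (\<Sum>j<k. (\<zeta> powr (2 * real CARD('d) * \<gamma>)) ^ j / fact j))"
proof -
  interpret iid: iid_positive M w "edges :: (int ^ 'd) set set" \<mu>
  proof (intro iid_positive.intro iid_positive_axioms.intro)
    obtain i :: 'd where True by blast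
    have "{axis i 1, 0 :: int ^ 'd} \<in> edges" by (auto simp: adjacent_0_iff)
    then show "(edges :: (int ^ 'd) set set) \<noteq> {}" by blast
  qed fact+
  have F_eq: "iid.F = F" by (simp add: iid.F_def F)
  interpret random_conductances M w \<mu> \<gamma>
    by unfold_locales (use dim gamma F_rv F_cont F_eq in auto)
  have "iid.total (star 0) = (\<lambda>\<omega>. vertex_conductance (\<lambda>e. w e \<omega>) 0)" by (simp add: total_star fun_eq_iff)
  then have F\<pi>_same: "random_conductances.F\<pi> M w = F\<pi>" by (simp add: F\<pi>_def F\<pi>)
  \<comment> \<open>For \<open>n \<ge> 1\<close> the hypothesis on \<open>L\<close> identifies the
    prefactor with \<open>h n\<close>, so that both claims become statements about
    \<open>h n * eig k n \<omega>\<close>.\<close>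
  have scale: "L (real n) * real n powr (1 / (2 * \<gamma>)) * dirichlet_eigenvalue (\<lambda>e. w e \<omega>) n k = h n * eig k n \<omega>"
    if "1 \<le> n" for n \<omega>
    using L[OF that] by (simp add: h_def F\<pi>_same vol_def eig_def mult.commute)
  have "weak_conv_m (\<lambda>n. distr M borel (\<lambda>\<omega>. L (real n) * real n powr (1 / (2 * \<gamma>)) *
      dirichlet_eigenvalue (\<lambda>e. w e \<omega>) n k)) (limit_law k)"
    using k scale by (intro weak_conv_eig) auto
  moreover have "(\<lambda>n. measure M {\<omega> \<in> space M. L (real n) * real n powr (1 / (2 * \<gamma>)) *
      dirichlet_eigenvalue (\<lambda>e. w e \<omega>) n k > \<zeta>}) \<longlonglongrightarrow> exp (- (\<zeta> powr (2 * real CARD('d) * \<gamma>))) *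
            (\<Sum>j<k. (\<zeta> powr (2 * real CARD('d) * \<gamma>)) ^ j / fact j)" if "0 \<le> \<zeta>" for \<zeta>
  proof -
    have "(\<lambda>n. measure M (exceed k n \<zeta>)) \<longlonglongrightarrow> exp (- (\<zeta> powr (2 * real CARD('d) * \<gamma>))) *
            (\<Sum>j<k. (\<zeta> powr (2 * real CARD('d) * \<gamma>)) ^ j / fact j)"
      using exceed_tendsto_nonneg[OF that k] unfolding poisson_tail_def p_def .
    moreover have "\<forall>\<^sub>F n in sequentially. measure M (exceed k n \<zeta>) = measure M {\<omega> \<in> space M. L (real n) * real n powr (1 / (2 * \<gamma>)) *
      dirichlet_eigenvalue (\<lambda>e. w e \<omega>) n k > \<zeta>}"
      using eventually_ge_at_top[of 1] by eventually_elim (simp add: exceed_def scale)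
    ultimately show ?thesis by (rule Lim_transform_eventually)
  qed
  ultimately show ?thesis
    using real_distribution_limit_law limit_law_nondegenerate[OF k] by blast
qed

end
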